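(* A posetal pre-stack $\mathcal{X}:|\mathcal{X}|\to\mathbf{Set}$ is equivalent to a relative realizability hyperdoctrine if and only if 1. $\mathcal{X}$ models the logical connectives $\top,\wedge,\Rightarrow,\exists,\forall$ (with quantification along all maps), and 2. there exist a family $(A_i)_{i\in I}$ of sets (indexed by a set $I$) and a family $(\pi_i\in\mathcal{X}_{A_i})_{i\in I}$ of $\exists$-prime predicates such that - the subfibration $\mathcal{A}\subseteq\mathcal{X}$ generated by the $(\pi_i)_{i\in I}$ is closed under finite meets, - all $\pi_i$ are modest in $\mathcal{A}$, and - $\mathcal{A}$ generates $\mathcal{X}$ under existential quantification.
   Context: **Posetal fibrations.** A posetal fibration $\mathcal{X}:|\mathcal{X}|\to\mathbf{Set}$ is a fibration that is faithful as a functor; its fibers $\mathcal{X}_M$ are preorders, whose elements are called predicates on $M$; $u^*$ is reindexing along $u$. It is a pre-stack if $e^*\varphi\le e^*\psi$ implies $\varphi\le\psi$ for every surjection $e$. Equivalence means fibered equivalence over $\mathbf{Set}$. $\mathcal{X}$ models $\top,\wedge,\Rightarrow$ if its fibers have finite meets and Heyting implication, preserved by reindexing; it models $\exists$ (resp. $\forall$) if all reindexing functions $u^*$ have left adjoints $\exists_u$ (resp. right adjoints $\forall_u$) satisfying the Beck–Chevalley condition. **Generated subfibration.** $\mathcal{A}$ is the full subfibration of $\mathcal{X}$ on predicates isomorphic to $f^*\pi_i$ for some $i\in I$ and $f:M\to A_i$. $\mathcal{A}$ generates $\mathcal{X}$ under existential quantification if for each $\varphi\in\mathcal{X}_M$ there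 are $u:N\to M$ and $\psi\in\mathcal{A}_N$ with $\varphi\cong\exists_u\psi$. **$\exists$-prime.** $\pi\in\mathcal{X}_I$ is $\exists$-prime if whenever $I\xleftarrow{u}J\xleftarrow{v}K$ and $\theta\in\mathcal{X}_K$ satisfy $u^*\pi\le\exists_v\theta$, there are a surjection $e:L\to J$ and a map $w:L\to K$ with $vw=e$ and $(ue)^*\pi\le w^*\theta$. **Modest.** $\mu\in\mathcal{A}_I$ is modest in $\mathcal{A}$ if for any span $J\xleftarrow{e}K\xrightarrow{f}I$ with $e$ surjective and any $\varphi\in\mathcal{A}_J$ with $e^*\varphi\le f^*\mu$, there is $h:J\to I$ with $he=f$ and $\varphi\le h^*\mu$. **Typed pcas.** Application is partial, associates to the left, written by juxtaposition; $t\!\downarrow$ means $t$ is defined; an asserted equation or membership implies that the terms involved are defined; $t\succeq s$ means that if $s$ is defined then so is $t$ and $s=t$. A typed pca $(I,(\mathcal{A}_i)_{i\in I})$ consists of a set $I$ with binary operations $*,\Rightarrow$ ($\Rightarrow$ associating to the right), sets $\mathcal{A}_i$, and partial application maps $\mathcal{A}_{i\Rightarrow j}\times\mathcal{A}_i\rightharpoonup\mathcal{A}_j$, such that for all $i,j,k$ there exist $\mathsf{k}\in\mathcal{A}_{i\Rightarrow j\Rightarrow i}$, $\mathsf{s}\in\mathcal{A}_{(i\Rightarrow j\Rightarrow k)\Rightarrow(i\Rightarrow j)\Rightarrow i\Rightarrow k}$, $\mathsf{pair}\in\mathcal{A}_{i\Rightarrow j\Rightarrow(i*j)}$, $\mathsf{fst}\in\mathcal{A}_{(i*j)\Rightarrow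 i}$, $\mathsf{snd}\in\mathcal{A}_{(i*j)\Rightarrow j}$ with $\mathsf{k}xy=x$, $\mathsf{s}xy\!\downarrow$, $\mathsf{s}xyz\succeq xz(yz)$, $\mathsf{fst}(\mathsf{pair}\,x\,y)=x$, $\mathsf{snd}(\mathsf{pair}\,x\,y)=y$. A typed sub-pca is a family of subsets $\mathcal{A}_{\#,i}\subseteq\mathcal{A}_i$ closed under application (if $a\in\mathcal{A}_{\#,i\Rightarrow j}$, $b\in\mathcal{A}_{\#,i}$, $ab\!\downarrow$ then $ab\in\mathcal{A}_{\#,j}$) such that all combinators can be chosen in the subsets. A typed pca with a typed sub-pca is an inclusion of typed pcas. **Relative realizability hyperdoctrine** of an inclusion $(I,\mathcal{A}_\#\subseteq\mathcal{A})$ of typed pcas: the posetal fibration $\mathcal{H}(I,\mathcal{A},\mathcal{A}_\#)$ on $\mathbf{Set}$ whose predicates on $M$ are pairs $(i\in I,\varphi:M\to P\mathcal{A}_i)$, with $(i,\varphi)\le(j,\psi)$ iff $\exists e\in\mathcal{A}_{\#,i\Rightarrow j}\ \forall m\in M\ \forall a\in\varphi(m):\ ea\in\psi(m)$, and reindexing by precomposition.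
   Formalization: The set I of types of a typed pca is required to be nonempty (for I empty the hyperdoctrine has empty fibers and does not model ⊤), and kx, sx, pair x are required to be defined even when the type of the next argument is empty. *)

theory Defs
  imports "HOL-Library.FuncSet" "HOL-Library.Equipollence"
begin

section \<open>The category of sets\<close>

text \<open>HOL has no type of all sets, so the category of sets is taken relative to a universe: its
  objects are the subsets of a type \<open>'u\<close> of cardinality less than that of \<open>'u\<close>, its morphisms
  from \<open>M\<close> to \<open>N\<close> are the elements of \<open>M \<rightarrow>\<^sub>E N\<close>, and the cardinality of \<open>'u\<close> is assumed to be a
  regular strong limit (the sets in a Grothendieck universe, up to bijection). Uncountability is
  not required, so finite sets are also an instance.\<close>

definition small :: "'u set \<Rightarrow> bool" where
  "small A \<longleftrightarrow> A \<prec> (UNIV :: 'u set)"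

definition set_universe :: "'u itself \<Rightarrow> bool" where
  "set_universe _ \<longleftrightarrow>
     infinite (UNIV :: 'u set) \<and>
     (\<forall>A :: 'u set. small A \<longrightarrow> Pow A \<prec> (UNIV :: 'u set)) \<and>
     (\<forall>(I :: 'u set) (F :: 'u \<Rightarrow> 'u set).
        small I \<and> (\<forall>i\<in>I. small (F i)) \<longrightarrow> small (\<Union>i\<in>I. F i))"

lemma small_nat_iff: "small (A :: nat set) \<longleftrightarrow> finite A"
  unfolding small_def
proof
  assume "A \<prec> (UNIV :: nat set)"
  then show "finite A"
    by (meson infinite_le_lepoll lesspoll_not_refl lesspoll_trans1)
next
  assume "finite A"
  then show "A \<prec> (UNIV :: nat set)"
    by (simp add: finite_lesspoll_infinite)
qed

lemma set_universe_nat: "set_universe TYPE(nat)"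
  unfolding set_universe_def small_nat_iff
  by (auto simp: finite_lesspoll_infinite)

definition surjection :: "'u set \<Rightarrow> 'u set \<Rightarrow> ('u \<Rightarrow> 'u) \<Rightarrow> bool" where
  "surjection N M e \<longleftrightarrow> e \<in> N \<rightarrow>\<^sub>E M \<and> e ` N = M"

text \<open>A commuting square \<open>v \<circ> u' = u \<circ> v'\<close> with \<open>u' : L \<rightarrow> K\<close>, \<open>v' : L \<rightarrow> N\<close>, \<open>u : N \<rightarrow> M\<close>,
  \<open>v : K \<rightarrow> M\<close> such that \<open>L\<close> is the fibre product of \<open>v\<close> and \<open>u\<close>.\<close>

definition pullback_square ::
  "'u set \<Rightarrow> 'u set \<Rightarrow> 'u set \<Rightarrow> 'u set \<Rightarrow>
   ('u \<Rightarrow> 'u) \<Rightarrow> ('u \<Rightarrow> 'u) \<Rightarrow> ('u \<Rightarrow> 'u) \<Rightarrow> ('u \<Rightarrow> 'u) \<Rightarrow> bool" where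
  "pullback_square L K N M u' v' u v \<longleftrightarrow>
     small L \<and> small K \<and> small N \<and> small M \<and>
     u' \<in> L \<rightarrow>\<^sub>E K \<and> v' \<in> L \<rightarrow>\<^sub>E N \<and> u \<in> N \<rightarrow>\<^sub>E M \<and> v \<in> K \<rightarrow>\<^sub>E M \<and>
     bij_betw (\<lambda>l. (u' l, v' l)) L {(k, n). k \<in> K \<and> n \<in> N \<and> v k = u n}"


section \<open>Posetal fibrations\<close>

text \<open>A faithful functor into the category of sets is presented by its objects, their images
  \<open>base X \<phi>\<close>, and the predicate \<open>lift X \<phi> u \<psi>\<close> stating that \<open>u : base X \<phi> \<rightarrow> base X \<psi>\<close> is the image
  of a (by faithfulness unique) morphism \<open>\<phi> \<rightarrow> \<psi>\<close>. Only the values of \<open>lift\<close> at objects in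
  \<open>Pred X\<close> and functions \<open>u\<close> between their bases are meaningful.\<close>

record ('u, 'x) fibration =
  Pred :: "'x set"
  base :: "'x \<Rightarrow> 'u set"
  lift :: "'x \<Rightarrow> ('u \<Rightarrow> 'u) \<Rightarrow> 'x \<Rightarrow> bool"

definition cartesian :: "('u, 'x) fibration \<Rightarrow> 'x \<Rightarrow> ('u \<Rightarrow> 'u) \<Rightarrow> 'x \<Rightarrow> bool" where
  "cartesian X \<phi> u \<psi> \<longleftrightarrow>
     \<phi> \<in> Pred X \<and> \<psi> \<in> Pred X \<and> u \<in> base X \<phi> \<rightarrow>\<^sub>E base X \<psi> \<and> lift X \<phi> u \<psi> \<and>
     (\<forall>\<chi>\<in>Pred X. \<forall>v\<in>base X \<chi> \<rightarrow>\<^sub>E base X \<phi>.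
        lift X \<chi> (compose (base X \<chi>) u v) \<psi> \<longrightarrow> lift X \<chi> v \<phi>)"

definition posetal_fibration :: "('u, 'x) fibration \<Rightarrow> bool" where
  "posetal_fibration X \<longleftrightarrow>
     (\<forall>\<phi>\<in>Pred X. small (base X \<phi>)) \<and>
     (\<forall>\<phi>\<in>Pred X. lift X \<phi> (\<lambda>m\<in>base X \<phi>. m) \<phi>) \<and>
     (\<forall>\<phi>\<in>Pred X. \<forall>\<psi>\<in>Pred X. \<forall>\<chi>\<in>Pred X.
        \<forall>u\<in>base X \<phi> \<rightarrow>\<^sub>E base X \<psi>. \<forall>v\<in>base X \<psi> \<rightarrow>\<^sub>E base X \<chi>.
          lift X \<phi> u \<psi> \<and> lift X \<psi> v \<chi> \<longrightarrow> lift X \<phi> (compose (base X \<phi>) v u) \<chi>) \<and>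
     (\<forall>\<psi>\<in>Pred X. \<forall>M. small M \<longrightarrow>
        (\<forall>u\<in>M \<rightarrow>\<^sub>E base X \<psi>. \<exists>\<phi>. base X \<phi> = M \<and> cartesian X \<phi> u \<psi>))"

definition fiber :: "('u, 'x) fibration \<Rightarrow> 'u set \<Rightarrow> 'x set" where
  "fiber X M = {\<phi> \<in> Pred X. base X \<phi> = M}"

definition le :: "('u, 'x) fibration \<Rightarrow> 'x \<Rightarrow> 'x \<Rightarrow> bool" where
  "le X \<phi> \<psi> \<longleftrightarrow>
     \<phi> \<in> Pred X \<and> \<psi> \<in> Pred X \<and> base X \<phi> = base X \<psi> \<and> lift X \<phi> (\<lambda>m\<in>base X \<phi>. m) \<psi>"

definition iso :: "('u, 'x) fibration \<Rightarrow> 'x \<Rightarrow> 'x \<Rightarrow> bool" where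
  "iso X \<phi> \<psi> \<longleftrightarrow> le X \<phi> \<psi> \<and> le X \<psi> \<phi>"

text \<open>\<open>reindex X N u \<psi>\<close> is \<open>u\<^sup>*\<psi>\<close> for \<open>u : N \<rightarrow> base X \<psi>\<close>; it is a choice of cartesian lifting,
  unique up to isomorphism only.\<close>

definition reindex :: "('u, 'x) fibration \<Rightarrow> 'u set \<Rightarrow> ('u \<Rightarrow> 'u) \<Rightarrow> 'x \<Rightarrow> 'x" where
  "reindex X N u \<psi> = (SOME \<phi>. base X \<phi> = N \<and> cartesian X \<phi> u \<psi>)"

definition pre_stack :: "('u, 'x) fibration \<Rightarrow> bool" where
  "pre_stack X \<longleftrightarrow>
     (\<forall>N M e. small N \<and> small M \<and> surjection N M e \<longrightarrow>
        (\<forall>\<phi>\<in>fiber X M. \<forall>\<psi>\<in>fiber X M.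
           le X (reindex X N e \<phi>) (reindex X N e \<psi>) \<longrightarrow> le X \<phi> \<psi>))"

definition fibered_functor ::
  "('u, 'x) fibration \<Rightarrow> ('u, 'y) fibration \<Rightarrow> ('x \<Rightarrow> 'y) \<Rightarrow> bool" where
  "fibered_functor X Y F \<longleftrightarrow>
     (\<forall>\<phi>\<in>Pred X. F \<phi> \<in> Pred Y \<and> base Y (F \<phi>) = base X \<phi>) \<and>
     (\<forall>\<phi>\<in>Pred X. \<forall>\<psi>\<in>Pred X. \<forall>u\<in>base X \<phi> \<rightarrow>\<^sub>E base X \<psi>.
        (lift X \<phi> u \<psi> \<longrightarrow> lift Y (F \<phi>) u (F \<psi>)) \<and>
        (cartesian X \<phi> u \<psi> \<longrightarrow> cartesian Y (F \<phi>) u (F \<psi>)))"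

text \<open>The unit and counit are vertical; their naturality is automatic by faithfulness.\<close>

definition fibered_equivalent :: "('u, 'x) fibration \<Rightarrow> ('u, 'y) fibration \<Rightarrow> bool" where
  "fibered_equivalent X Y \<longleftrightarrow>
     (\<exists>F G. fibered_functor X Y F \<and> fibered_functor Y X G \<and>
        (\<forall>\<phi>\<in>Pred X. iso X \<phi> (G (F \<phi>))) \<and> (\<forall>\<psi>\<in>Pred Y. iso Y (F (G \<psi>)) \<psi>))"


section \<open>Logical structure\<close>

definition is_top :: "('u, 'x) fibration \<Rightarrow> 'u set \<Rightarrow> 'x \<Rightarrow> bool" where
  "is_top X M \<tau> \<longleftrightarrow> \<tau> \<in> fiber X M \<and> (\<forall>\<phi>\<in>fiber X M. le X \<phi> \<tau>)"

definition is_meet :: "('u, 'x) fibration \<Rightarrow> 'x \<Rightarrow> 'x \<Rightarrow> 'x \<Rightarrow> bool" where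
  "is_meet X \<phi> \<psi> \<chi> \<longleftrightarrow>
     le X \<chi> \<phi> \<and> le X \<chi> \<psi> \<and> (\<forall>\<theta>. le X \<theta> \<phi> \<and> le X \<theta> \<psi> \<longrightarrow> le X \<theta> \<chi>)"

definition is_imp :: "('u, 'x) fibration \<Rightarrow> 'x \<Rightarrow> 'x \<Rightarrow> 'x \<Rightarrow> bool" where
  "is_imp X \<phi> \<psi> \<chi> \<longleftrightarrow>
     \<chi> \<in> fiber X (base X \<phi>) \<and>
     (\<forall>\<theta>\<in>fiber X (base X \<phi>). le X \<theta> \<chi> \<longleftrightarrow> (\<exists>\<mu>. is_meet X \<theta> \<phi> \<mu> \<and> le X \<mu> \<psi>))"

definition models_top :: "('u, 'x) fibration \<Rightarrow> bool" where
  "models_top X \<longleftrightarrow>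
     (\<forall>M. small M \<longrightarrow> (\<exists>\<tau>. is_top X M \<tau>)) \<and>
     (\<forall>N M. small N \<and> small M \<longrightarrow>
        (\<forall>u\<in>N \<rightarrow>\<^sub>E M. \<forall>\<tau>. is_top X M \<tau> \<longrightarrow> is_top X N (reindex X N u \<tau>)))"

definition models_meet :: "('u, 'x) fibration \<Rightarrow> bool" where
  "models_meet X \<longleftrightarrow>
     (\<forall>M. small M \<longrightarrow> (\<forall>\<phi>\<in>fiber X M. \<forall>\<psi>\<in>fiber X M. \<exists>\<chi>. is_meet X \<phi> \<psi> \<chi>)) \<and>
     (\<forall>N M. small N \<and> small M \<longrightarrow>
        (\<forall>u\<in>N \<rightarrow>\<^sub>E M. \<forall>\<phi>\<in>fiber X M. \<forall>\<psi>\<in>fiber X M. \<forall>\<chi>. is_meet X \<phi> \<psi> \<chi> \<longrightarrow>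
           is_meet X (reindex X N u \<phi>) (reindex X N u \<psi>) (reindex X N u \<chi>)))"

definition models_imp :: "('u, 'x) fibration \<Rightarrow> bool" where
  "models_imp X \<longleftrightarrow>
     (\<forall>M. small M \<longrightarrow> (\<forall>\<phi>\<in>fiber X M. \<forall>\<psi>\<in>fiber X M. \<exists>\<chi>. is_imp X \<phi> \<psi> \<chi>)) \<and>
     (\<forall>N M. small N \<and> small M \<longrightarrow>
        (\<forall>u\<in>N \<rightarrow>\<^sub>E M. \<forall>\<phi>\<in>fiber X M. \<forall>\<psi>\<in>fiber X M. \<forall>\<chi>. is_imp X \<phi> \<psi> \<chi> \<longrightarrow>
           is_imp X (reindex X N u \<phi>) (reindex X N u \<psi>) (reindex X N u \<chi>)))"

text \<open>\<open>\<chi>\<close> is a value at \<open>\<phi>\<close> of the left (right) adjoint of reindexing along \<open>u : N \<rightarrow> M\<close>.\<close>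

definition is_ex ::
  "('u, 'x) fibration \<Rightarrow> 'u set \<Rightarrow> 'u set \<Rightarrow> ('u \<Rightarrow> 'u) \<Rightarrow> 'x \<Rightarrow> 'x \<Rightarrow> bool" where
  "is_ex X N M u \<phi> \<chi> \<longleftrightarrow>
     \<chi> \<in> fiber X M \<and> (\<forall>\<psi>\<in>fiber X M. le X \<chi> \<psi> \<longleftrightarrow> le X \<phi> (reindex X N u \<psi>))"

definition is_all ::
  "('u, 'x) fibration \<Rightarrow> 'u set \<Rightarrow> 'u set \<Rightarrow> ('u \<Rightarrow> 'u) \<Rightarrow> 'x \<Rightarrow> 'x \<Rightarrow> bool" where
  "is_all X N M u \<phi> \<chi> \<longleftrightarrow>
     \<chi> \<in> fiber X M \<and> (\<forall>\<psi>\<in>fiber X M. le X \<psi> \<chi> \<longleftrightarrow> le X (reindex X N u \<psi>) \<phi>)"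

definition ex_along ::
  "('u, 'x) fibration \<Rightarrow> 'u set \<Rightarrow> 'u set \<Rightarrow> ('u \<Rightarrow> 'u) \<Rightarrow> 'x \<Rightarrow> 'x" where
  "ex_along X N M u \<phi> = (SOME \<chi>. is_ex X N M u \<phi> \<chi>)"

definition all_along ::
  "('u, 'x) fibration \<Rightarrow> 'u set \<Rightarrow> 'u set \<Rightarrow> ('u \<Rightarrow> 'u) \<Rightarrow> 'x \<Rightarrow> 'x" where
  "all_along X N M u \<phi> = (SOME \<chi>. is_all X N M u \<phi> \<chi>)"

definition models_ex :: "('u, 'x) fibration \<Rightarrow> bool" where
  "models_ex X \<longleftrightarrow>
     (\<forall>N M. small N \<and> small M \<longrightarrow>
        (\<forall>u\<in>N \<rightarrow>\<^sub>E M. \<forall>\<phi>\<in>fiber X N. \<exists>\<chi>. is_ex X N M u \<phi> \<chi>)) \<and>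
     (\<forall>L K N M u' v' u v. pullback_square L K N M u' v' u v \<longrightarrow>
        (\<forall>\<phi>\<in>fiber X N.
           iso X (reindex X K v (ex_along X N M u \<phi>)) (ex_along X L K u' (reindex X L v' \<phi>))))"

definition models_all :: "('u, 'x) fibration \<Rightarrow> bool" where
  "models_all X \<longleftrightarrow>
     (\<forall>N M. small N \<and> small M \<longrightarrow>
        (\<forall>u\<in>N \<rightarrow>\<^sub>E M. \<forall>\<phi>\<in>fiber X N. \<exists>\<chi>. is_all X N M u \<phi> \<chi>)) \<and>
     (\<forall>L K N M u' v' u v. pullback_square L K N M u' v' u v \<longrightarrow>
        (\<forall>\<phi>\<in>fiber X N.
           iso X (reindex X K v (all_along X N M u \<phi>)) (all_along X L K u' (reindex X L v' \<phi>))))"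


section \<open>Generated subfibrations, existential primality, modesty\<close>

definition generated_subfibration ::
  "('u, 'x) fibration \<Rightarrow> 'u set \<Rightarrow> ('u \<Rightarrow> 'u set) \<Rightarrow> ('u \<Rightarrow> 'x) \<Rightarrow> ('u, 'x) fibration" where
  "generated_subfibration X I A \<pi> =
     X\<lparr>Pred := {\<phi> \<in> Pred X. \<exists>i\<in>I. \<exists>f\<in>base X \<phi> \<rightarrow>\<^sub>E A i.
                  iso X \<phi> (reindex X (base X \<phi>) f (\<pi> i))}\<rparr>"

text \<open>The second argument is a full subfibration of the first.\<close>

definition closed_under_finite_meets ::
  "('u, 'x) fibration \<Rightarrow> ('u, 'x) fibration \<Rightarrow> bool" where
  "closed_under_finite_meets X \<A> \<longleftrightarrow>
     (\<forall>M \<tau>. small M \<and> is_top X M \<tau> \<longrightarrow> \<tau> \<in> Pred \<A>) \<and>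
     (\<forall>\<phi>\<in>Pred \<A>. \<forall>\<psi>\<in>Pred \<A>. \<forall>\<chi>. is_meet X \<phi> \<psi> \<chi> \<longrightarrow> \<chi> \<in> Pred \<A>)"

definition generates_under_ex ::
  "('u, 'x) fibration \<Rightarrow> ('u, 'x) fibration \<Rightarrow> bool" where
  "generates_under_ex X \<A> \<longleftrightarrow>
     (\<forall>M. small M \<longrightarrow> (\<forall>\<phi>\<in>fiber X M.
        \<exists>N. small N \<and> (\<exists>u\<in>N \<rightarrow>\<^sub>E M. \<exists>\<psi>\<in>fiber \<A> N. iso X \<phi> (ex_along X N M u \<psi>))))"

definition ex_prime :: "('u, 'x) fibration \<Rightarrow> 'u set \<Rightarrow> 'x \<Rightarrow> bool" where
  "ex_prime X I \<pi> \<longleftrightarrow>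
     (\<forall>J K. small J \<and> small K \<longrightarrow>
        (\<forall>u\<in>J \<rightarrow>\<^sub>E I. \<forall>v\<in>K \<rightarrow>\<^sub>E J. \<forall>\<theta>\<in>fiber X K.
           le X (reindex X J u \<pi>) (ex_along X K J v \<theta>) \<longrightarrow>
           (\<exists>L e w. small L \<and> surjection L J e \<and> w \<in> L \<rightarrow>\<^sub>E K \<and> compose L v w = e \<and>
              le X (reindex X L (compose L u e) \<pi>) (reindex X L w \<theta>))))"

definition modest :: "('u, 'x) fibration \<Rightarrow> 'u set \<Rightarrow> 'x \<Rightarrow> bool" where
  "modest \<A> I \<mu> \<longleftrightarrow>
     (\<forall>J K e f. small J \<and> small K \<and> surjection K J e \<and> f \<in> K \<rightarrow>\<^sub>E I \<longrightarrow>
        (\<forall>\<phi>\<in>fiber \<A> J. le \<A> (reindex \<A> K e \<phi>) (reindex \<A> K f \<mu>) \<longrightarrow>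
           (\<exists>h\<in>J \<rightarrow>\<^sub>E I. compose K h e = f \<and> le \<A> \<phi> (reindex \<A> J h \<mu>))))"


section \<open>Typed partial combinatory algebras\<close>

text \<open>\<open>app P i j a b\<close> is the partial application of \<open>a \<in> carr P (imp P i j)\<close> to \<open>b \<in> carr P i\<close>.
  It depends on the types \<open>i\<close> and \<open>j\<close> because \<open>imp P\<close> need not be injective and the carriers need
  not be disjoint.\<close>

record 'u typed_pca =
  Ty :: "'u set"
  prd :: "'u \<Rightarrow> 'u \<Rightarrow> 'u"
  imp :: "'u \<Rightarrow> 'u \<Rightarrow> 'u"
  carr :: "'u \<Rightarrow> 'u set"
  app :: "'u \<Rightarrow> 'u \<Rightarrow> 'u \<Rightarrow> 'u \<Rightarrow> 'u option"

text \<open>In the following three definitions the partial applications \<open>k x\<close>, \<open>s x\<close> and \<open>pair x\<close> are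
  defined for every \<open>x\<close>, also when the carrier of the second argument is empty.\<close>

definition is_k :: "'u typed_pca \<Rightarrow> 'u \<Rightarrow> 'u \<Rightarrow> 'u \<Rightarrow> bool" where
  "is_k P i j k \<longleftrightarrow>
     (\<forall>x\<in>carr P i. \<exists>kx. app P i (imp P j i) k x = Some kx \<and>
        (\<forall>y\<in>carr P j. app P j i kx y = Some x))"

definition is_s :: "'u typed_pca \<Rightarrow> 'u \<Rightarrow> 'u \<Rightarrow> 'u \<Rightarrow> 'u \<Rightarrow> bool" where
  "is_s P i j k s \<longleftrightarrow>
     (\<forall>x\<in>carr P (imp P i (imp P j k)). \<exists>sx.
        app P (imp P i (imp P j k)) (imp P (imp P i j) (imp P i k)) s x = Some sx \<and>
        (\<forall>y\<in>carr P (imp P i j). \<exists>sxy.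
           app P (imp P i j) (imp P i k) sx y = Some sxy \<and>
           (\<forall>z\<in>carr P i. \<forall>xz yz r.
              app P i (imp P j k) x z = Some xz \<and> app P i j y z = Some yz \<and>
              app P j k xz yz = Some r \<longrightarrow> app P i k sxy z = Some r)))"

definition is_pairing :: "'u typed_pca \<Rightarrow> 'u \<Rightarrow> 'u \<Rightarrow> 'u \<Rightarrow> 'u \<Rightarrow> 'u \<Rightarrow> bool" where
  "is_pairing P i j pr p1 p2 \<longleftrightarrow>
     (\<forall>x\<in>carr P i. \<exists>px. app P i (imp P j (prd P i j)) pr x = Some px \<and>
        (\<forall>y\<in>carr P j. \<exists>xy. app P j (prd P i j) px y = Some xy \<and>
           app P (prd P i j) i p1 xy = Some x \<and>
           app P (prd P i j) j p2 xy = Some y))"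

text \<open>The combinators can be chosen in \<open>S\<close>; their equations always range over all of \<open>carr P\<close>.\<close>

definition has_combinators :: "'u typed_pca \<Rightarrow> ('u \<Rightarrow> 'u set) \<Rightarrow> bool" where
  "has_combinators P S \<longleftrightarrow>
     (\<forall>i\<in>Ty P. \<forall>j\<in>Ty P.
        (\<exists>k\<in>S (imp P i (imp P j i)). is_k P i j k) \<and>
        (\<exists>pr\<in>S (imp P i (imp P j (prd P i j))). \<exists>p1\<in>S (imp P (prd P i j) i).
           \<exists>p2\<in>S (imp P (prd P i j) j). is_pairing P i j pr p1 p2)) \<and>
     (\<forall>i\<in>Ty P. \<forall>j\<in>Ty P. \<forall>k\<in>Ty P.
        \<exists>s\<in>S (imp P (imp P i (imp P j k)) (imp P (imp P i j) (imp P i k))). is_s P i j k s)"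

text \<open>The set of types is required to be nonempty: the hyperdoctrine of the empty typed pca has
  empty fibers, hence no greatest elements.\<close>

definition typed_pca :: "'u typed_pca \<Rightarrow> bool" where
  "typed_pca P \<longleftrightarrow>
     small (Ty P) \<and> Ty P \<noteq> {} \<and>
     (\<forall>i\<in>Ty P. small (carr P i)) \<and>
     (\<forall>i\<in>Ty P. \<forall>j\<in>Ty P. prd P i j \<in> Ty P \<and> imp P i j \<in> Ty P) \<and>
     (\<forall>i\<in>Ty P. \<forall>j\<in>Ty P. \<forall>a\<in>carr P (imp P i j). \<forall>b\<in>carr P i. \<forall>c.
        app P i j a b = Some c \<longrightarrow> c \<in> carr P j) \<and>
     has_combinators P (carr P)"

definition typed_sub_pca :: "'u typed_pca \<Rightarrow> ('u \<Rightarrow> 'u set) \<Rightarrow> bool" where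
  "typed_sub_pca P S \<longleftrightarrow>
     (\<forall>i\<in>Ty P. S i \<subseteq> carr P i) \<and>
     (\<forall>i\<in>Ty P. \<forall>j\<in>Ty P. \<forall>a\<in>S (imp P i j). \<forall>b\<in>S i. \<forall>c.
        app P i j a b = Some c \<longrightarrow> c \<in> S j) \<and>
     has_combinators P S"

definition typed_pca_inclusion :: "'u typed_pca \<Rightarrow> ('u \<Rightarrow> 'u set) \<Rightarrow> bool" where
  "typed_pca_inclusion P S \<longleftrightarrow> typed_pca P \<and> typed_sub_pca P S"

text \<open>A predicate \<open>(i, \<phi>)\<close> on \<open>M\<close> is the triple \<open>(M, i, \<phi>)\<close>, and \<open>u\<close> lifts to a morphism
  \<open>(M, i, \<phi>) \<rightarrow> (N, j, \<psi>)\<close> iff \<open>(i, \<phi>) \<le> (j, \<psi> \<circ> u)\<close> holds over \<open>M\<close>.\<close>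

definition realizability_hyperdoctrine ::
  "'u typed_pca \<Rightarrow> ('u \<Rightarrow> 'u set) \<Rightarrow> ('u, 'u set \<times> 'u \<times> ('u \<Rightarrow> 'u set)) fibration" where
  "realizability_hyperdoctrine P S =
     \<lparr>Pred = {(M, i, \<phi>). small M \<and> i \<in> Ty P \<and> \<phi> \<in> M \<rightarrow>\<^sub>E Pow (carr P i)},
      base = (\<lambda>(M, i, \<phi>). M),
      lift = (\<lambda>(M, i, \<phi>) u (N, j, \<psi>).
        \<exists>e\<in>S (imp P i j). \<forall>m\<in>M. \<forall>a\<in>\<phi> m. \<exists>b\<in>\<psi> (u m). app P i j e a = Some b)\<rparr>"

end

theory Submission
  imports Defs
begin

text \<open>From an equivalence with the hyperdoctrine of \<open>\<A>\<^sub># \<subseteq> \<A>\<close>, take \<open>\<pi> i\<close> to be the singleton predicate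
  \<open>a \<mapsto> {a}\<close> on the carrier of type \<open>i\<close>. The predicates generated by the \<open>\<pi> i\<close> are the families of
  singletons, and everything is computed with realizers.

  Conversely, the product of the types \<open>i\<close> and \<open>j\<close> comes from writing the meet of \<open>\<pi> i\<close> and \<open>\<pi> j\<close> over
  \<open>A i \<times> A j\<close> as a reindexing of some \<open>\<pi> k\<close>. For the arrow type, let \<open>\<rho>\<close> be the predicate
  \<open>r \<mapsto> \<forall>(b, c) \<in> r. \<pi> i b \<Rightarrow> \<pi> j c\<close> on the set of relations between \<open>A i\<close> and \<open>A j\<close>, and write
  \<open>\<rho> \<cong> \<exists>\<^sub>u g\<^sup>*(\<pi> k)\<close>; then \<open>k\<close> is the arrow type, and \<open>a\<close> applied to \<open>b\<close> is \<open>c\<close> iff \<open>a = g n\<close> and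
  \<open>(b, c) \<in> u n\<close> for some \<open>n\<close>. Modesty of \<open>\<pi> j\<close> makes this single-valued. Primality and modesty of
  \<open>\<pi> k\<close> turn an entailment with parameters into a function with values in \<open>A k\<close>, which yields all
  combinators; the sub-pca consists of the \<open>a \<in> A i\<close> at which \<open>\<pi> i\<close> holds. A predicate
  \<open>\<exists>\<^sub>u g\<^sup>*(\<pi> i)\<close> corresponds to the family \<open>m \<mapsto> {g n | u n = m}\<close>. Here primality turns inequalities
  into realizers; for the converse, a section of the resulting surjection exists by choice.\<close>


section \<open>Small sets\<close>

text \<open>Both directions meet in the locale \<open>realized\<close>: each predicate is assigned a
  type and a family of realizer sets, liftings are exactly the realizable entailments, and every
  small family occurs. An equivalence yields such an assignment and so does a presentation; the
  connectives, the generating family and the equivalence with the hyperdoctrine are all derived from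
  it.

  Reindexing and quantification are chosen values, determined only up to isomorphism. Arguments are
  therefore phrased by liftings at arbitrary stages (\<open>lifts\<close>): stability and
  Beck-Chevalley turn each connective into a Kripke-Joyal clause, after which no coherence
  isomorphisms have to be tracked.

  Relations enter the arrow type because currying needs one object through which all families with
  parameters factor: a parameter is sent to the relation of the pairs (argument, value) required
  over it, and every relation has a code. Neither the relations nor the map \<open>g\<close> from
  indices to elements of \<open>A k\<close> are restricted, which is why single-valuedness of
  application has to be recovered from modesty.\<close>

lemma small_subset: "small B \<Longrightarrow> A \<subseteq> B \<Longrightarrow> small A"
  unfolding small_def using lesspoll_trans1 subset_imp_lepoll by blast

lemma small_image: "small A \<Longrightarrow> small (f ` A)" for f :: "'u \<Rightarrow> 'u"
  unfolding small_def by (erule lesspoll_trans1[OF image_lepoll])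

text \<open>Objects are subsets of \<open>'u\<close>, so products, fibre products and graphs have to
  be coded back into \<open>'u\<close>. As \<open>'u\<close> is infinite, pairs of its elements
  inject into it.\<close>

definition upair :: "'u \<Rightarrow> 'u \<Rightarrow> 'u" where
  "upair = (SOME f. inj (\<lambda>(x, y). f x y))"

definition ufst :: "'u \<Rightarrow> 'u" where
  "ufst z = fst (inv (\<lambda>(x, y). upair x y) z)"

definition usnd :: "'u \<Rightarrow> 'u" where
  "usnd z = snd (inv (\<lambda>(x, y). upair x y) z)"

locale universe =
  fixes U :: "'u itself"
  assumes univ: "set_universe TYPE('u)"
begin

lemma infinite_univ: "infinite (UNIV :: 'u set)"
  using univ by (simp add: set_universe_def)

lemma small_finite: "finite (A :: 'u set) \<Longrightarrow> small A"
  unfolding small_def by (simp add: finite_lesspoll_infinite infinite_univ)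

lemma small_UN: "small (I :: 'u set) \<Longrightarrow> (\<And>i. i \<in> I \<Longrightarrow> small (F i :: 'u set)) \<Longrightarrow> small (\<Union>i\<in>I. F i)"
  using univ by (simp add: set_universe_def)

lemma inj_upair: "inj (\<lambda>(x, y). upair x y :: 'u)"
proof -
  have "\<exists>f. bij_betw f ((UNIV :: 'u set) \<times> (UNIV :: 'u set)) (UNIV :: 'u set)"
    by (rule card_of_ordIso[THEN iffD2, OF card_of_Times_same_infinite[OF infinite_univ]])
  then obtain f :: "'u \<times> 'u \<Rightarrow> 'u" where "inj f"
    using bij_betw_imp_inj_on UNIV_Times_UNIV by metis
  then have "inj (\<lambda>(x, y). curry f x y)"
    by simp
  then show ?thesis
    unfolding upair_def by (rule someI[where P = "\<lambda>f. inj (\<lambda>(x, y). f x y)"])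
qed

lemma ufst_upair [simp]: "ufst (upair x y) = (x :: 'u)"
  using inv_f_f[OF inj_upair, of "(x, y)"] by (simp add: ufst_def)

lemma usnd_upair [simp]: "usnd (upair x y) = (y :: 'u)"
  using inv_f_f[OF inj_upair, of "(x, y)"] by (simp add: usnd_def)

lemma upair_eq_iff [simp]: "upair x y = upair x' y' \<longleftrightarrow> x = (x' :: 'u) \<and> y = y'"
  by (metis ufst_upair usnd_upair)

text \<open>The codes lie in a union, indexed by \<open>A\<close>, of images of \<open>B\<close>,
  which is small by regularity. The existential form of the hypothesis covers any set of codes drawn
  from \<open>A\<close> and \<open>B\<close>.\<close>

lemma small_upair:
  assumes "small (A :: 'u set)" "small B" and "\<And>z. z \<in> C \<Longrightarrow> \<exists>a\<in>A. \<exists>b\<in>B. z = upair a b"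
  shows "small C"
proof (rule small_subset)
  show "small (\<Union>a\<in>A. upair a ` B)"
    using assms by (intro small_UN small_image)
  show "C \<subseteq> (\<Union>a\<in>A. upair a ` B)"
    using assms(3) by blast
qed

text \<open>A power set is a set of sets and so not an object itself. The strong limit property
  gives it a small set \<open>F\<close> of codes in \<open>'u\<close>, and \<open>dec\<close> reads
  them.\<close>

lemma small_Pow_code:
  assumes "small (A :: 'u set)"
  obtains F :: "'u set" and dec where "small F" "dec ` F = Pow A"
proof -
  have less: "Pow A \<prec> (UNIV :: 'u set)"
    using assms univ by (simp add: set_universe_def)
  then obtain f :: "'u set \<Rightarrow> 'u" where f: "inj_on f (Pow A)"
    unfolding lesspoll_def lepoll_def by blast
  have "f ` Pow A \<lesssim> Pow A"
    by (rule image_lepoll)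
  then have "small (f ` Pow A)"
    unfolding small_def using less lesspoll_trans1 by blast
  moreover have "inv_into (Pow A) f ` f ` Pow A = Pow A"
    using f by (rule inv_into_image_cancel) simp
  ultimately show ?thesis
    by (rule that)
qed

end


section \<open>Liftings along arbitrary functions\<close>

locale posetal_fib = universe "TYPE('u)" for X :: "('u, 'x) fibration" +
  assumes fib: "posetal_fibration X"
begin

text \<open>Maps in the base are extensional functions in \<open>lift\<close> and \<open>reindex\<close>; the following variants
  only depend on the values of a function on its domain.\<close>

definition lifts :: "'x \<Rightarrow> ('u \<Rightarrow> 'u) \<Rightarrow> 'x \<Rightarrow> bool" where
  "lifts \<phi> u \<psi> \<longleftrightarrow> \<phi> \<in> Pred X \<and> \<psi> \<in> Pred X \<and> u \<in> base X \<phi> \<rightarrow> base X \<psi> \<and>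
     lift X \<phi> (restrict u (base X \<phi>)) \<psi>"

definition pull :: "'u set \<Rightarrow> ('u \<Rightarrow> 'u) \<Rightarrow> 'x \<Rightarrow> 'x" where
  "pull N u \<psi> = reindex X N (restrict u N) \<psi>"

lemma reindex_eq_pull: "u \<in> N \<rightarrow>\<^sub>E M \<Longrightarrow> reindex X N u \<psi> = pull N u \<psi>"
  unfolding pull_def by (simp add: PiE_restrict)

lemma small_base: "\<phi> \<in> Pred X \<Longrightarrow> small (base X \<phi>)"
  using fib unfolding posetal_fibration_def by blast

lemma liftsD: "lifts \<phi> u \<psi> \<Longrightarrow> \<phi> \<in> Pred X" "lifts \<phi> u \<psi> \<Longrightarrow> \<psi> \<in> Pred X"
  "lifts \<phi> u \<psi> \<Longrightarrow> x \<in> base X \<phi> \<Longrightarrow> u x \<in> base X \<psi>"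
  by (auto simp: lifts_def)

lemma lifts_cong:
  assumes "\<And>x. x \<in> base X \<phi> \<Longrightarrow> u x = v x"
  shows "lifts \<phi> u \<psi> \<longleftrightarrow> lifts \<phi> v \<psi>"
proof -
  have "restrict u (base X \<phi>) = restrict v (base X \<phi>)"
    using assms by (rule restrict_ext)
  then show ?thesis
    using assms by (auto simp: lifts_def Pi_iff)
qed

lemma lifts_id: "\<phi> \<in> Pred X \<Longrightarrow> lifts \<phi> (\<lambda>x. x) \<phi>"
  using fib by (auto simp: posetal_fibration_def lifts_def)

lemma compose_restrict:
  "v \<in> A \<rightarrow> B \<Longrightarrow> compose A (restrict u B) (restrict v A) = restrict (\<lambda>x. u (v x)) A"
  by (rule ext) (auto simp: compose_def restrict_def Pi_iff)

lemma lift_comp: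
  assumes "\<phi> \<in> Pred X" "\<psi> \<in> Pred X" "\<chi> \<in> Pred X"
    and "u \<in> base X \<phi> \<rightarrow>\<^sub>E base X \<psi>" "v \<in> base X \<psi> \<rightarrow>\<^sub>E base X \<chi>"
    and "lift X \<phi> u \<psi>" "lift X \<psi> v \<chi>"
  shows "lift X \<phi> (compose (base X \<phi>) v u) \<chi>"
proof -
  have "\<forall>\<phi>\<in>Pred X. \<forall>\<psi>\<in>Pred X. \<forall>\<chi>\<in>Pred X.
        \<forall>u\<in>base X \<phi> \<rightarrow>\<^sub>E base X \<psi>. \<forall>v\<in>base X \<psi> \<rightarrow>\<^sub>E base X \<chi>.
          lift X \<phi> u \<psi> \<and> lift X \<psi> v \<chi> \<longrightarrow> lift X \<phi> (compose (base X \<phi>) v u) \<chi>"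
    using fib unfolding posetal_fibration_def by (elim conjE)
  then show ?thesis
    using assms by meson
qed

lemma lifts_comp:
  assumes "lifts \<phi> u \<psi>" "lifts \<psi> v \<chi>"
  shows "lifts \<phi> (\<lambda>x. v (u x)) \<chi>"
proof -
  have "lift X \<phi> (compose (base X \<phi>) (restrict v (base X \<psi>)) (restrict u (base X \<phi>))) \<chi>"
    by (rule lift_comp[where \<psi> = \<psi>]) (use assms in \<open>auto simp: lifts_def\<close>)
  then show ?thesis
    using assms by (auto simp: lifts_def compose_restrict)
qed

lemma le_iff_lifts: "le X \<phi> \<psi> \<longleftrightarrow> base X \<phi> = base X \<psi> \<and> lifts \<phi> (\<lambda>x. x) \<psi>"
  by (auto simp: le_def lifts_def)

lemma le_refl: "\<phi> \<in> Pred X \<Longrightarrow> le X \<phi> \<phi>"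
  by (simp add: le_iff_lifts lifts_id)

lemma le_trans: "le X \<phi> \<psi> \<Longrightarrow> le X \<psi> \<chi> \<Longrightarrow> le X \<phi> \<chi>"
  using lifts_comp[of \<phi> "\<lambda>x. x" \<psi> "\<lambda>x. x" \<chi>] by (simp add: le_iff_lifts)

lemma le_lifts: "le X \<psi> \<chi> \<Longrightarrow> lifts \<phi> u \<psi> \<Longrightarrow> lifts \<phi> u \<chi>"
  using lifts_comp[of \<phi> u \<psi> "\<lambda>x. x" \<chi>] by (simp add: le_iff_lifts)

lemma lifts_le: "le X \<phi> \<psi> \<Longrightarrow> lifts \<psi> u \<chi> \<Longrightarrow> lifts \<phi> u \<chi>"
  using lifts_comp[of \<phi> "\<lambda>x. x" \<psi> u \<chi>] by (simp add: le_iff_lifts)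

lemma iso_lifts_right: "iso X \<psi> \<chi> \<Longrightarrow> lifts \<phi> u \<psi> \<longleftrightarrow> lifts \<phi> u \<chi>"
  unfolding iso_def using le_lifts by blast

lemma iso_sym: "iso X \<phi> \<psi> \<Longrightarrow> iso X \<psi> \<phi>"
  by (auto simp: iso_def)

lemma iso_trans: "iso X \<phi> \<psi> \<Longrightarrow> iso X \<psi> \<chi> \<Longrightarrow> iso X \<phi> \<chi>"
  unfolding iso_def using le_trans by blast

text \<open>Restricting \<open>v\<close> to \<open>base X \<chi>\<close> translates a test by an
  arbitrary function into one by an extensional function; \<open>compose_restrict\<close> identifies
  the two composites.\<close>

lemma cartesian_iff:
  assumes "\<phi> \<in> Pred X" "\<psi> \<in> Pred X" "u \<in> base X \<phi> \<rightarrow> base X \<psi>"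
  shows "cartesian X \<phi> (restrict u (base X \<phi>)) \<psi> \<longleftrightarrow>
    lifts \<phi> u \<psi> \<and>
    (\<forall>\<chi>\<in>Pred X. \<forall>v\<in>base X \<chi> \<rightarrow> base X \<phi>. lifts \<chi> (\<lambda>x. u (v x)) \<psi> \<longrightarrow> lifts \<chi> v \<phi>)"
    (is "?l \<longleftrightarrow> ?r")
proof
  assume l: ?l
  have uni: "lifts \<chi> v \<phi>" if \<chi>: "\<chi> \<in> Pred X" and v: "v \<in> base X \<chi> \<rightarrow> base X \<phi>"
    and *: "lifts \<chi> (\<lambda>x. u (v x)) \<psi>" for \<chi> v
  proof -
    let ?v = "restrict v (base X \<chi>)"
    have "lift X \<chi> (compose (base X \<chi>) (restrict u (base X \<phi>)) ?v) \<psi>"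
      unfolding compose_restrict[OF v] using * by (simp add: lifts_def)
    moreover have "?v \<in> base X \<chi> \<rightarrow>\<^sub>E base X \<phi>"
      using v by auto
    ultimately have "lift X \<chi> ?v \<phi>"
      using l \<chi> unfolding cartesian_def by meson
    then show ?thesis
      using assms \<chi> v by (simp add: lifts_def)
  qed
  have "lifts \<phi> u \<psi>"
    using l assms by (simp add: cartesian_def lifts_def)
  show ?r
  proof (intro conjI ballI impI)
    show "lifts \<phi> u \<psi>" by fact
    fix \<chi> v
    assume "\<chi> \<in> Pred X" "v \<in> base X \<chi> \<rightarrow> base X \<phi>" "lifts \<chi> (\<lambda>x. u (v x)) \<psi>"
    then show "lifts \<chi> v \<phi>"
      by (rule uni)
  qed
next
  assume r: ?r
  have uni: "lift X \<chi> v \<phi>" if \<chi>: "\<chi> \<in> Pred X" and v: "v \<in> base X \<chi> \<rightarrow>\<^sub>E base X \<phi>"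
    and *: "lift X \<chi> (compose (base X \<chi>) (restrict u (base X \<phi>)) v) \<psi>" for \<chi> v
  proof -
    have v': "v \<in> base X \<chi> \<rightarrow> base X \<phi>" "restrict v (base X \<chi>) = v"
      using v by (auto simp: PiE_restrict)
    have "lift X \<chi> (restrict (\<lambda>x. u (v x)) (base X \<chi>)) \<psi>"
      using compose_restrict[OF v'(1), of u] * by (simp only: v'(2))
    moreover have "(\<lambda>x. u (v x)) \<in> base X \<chi> \<rightarrow> base X \<psi>"
      using v'(1) assms(3) by blast
    ultimately have "lifts \<chi> (\<lambda>x. u (v x)) \<psi>"
      using \<chi> assms(2) by (simp only: lifts_def)
    then have "lifts \<chi> v \<phi>"
      by (rule r[THEN conjunct2, rule_format, OF \<chi> v'(1)])
    then show ?thesis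
      using v'(2) by (simp add: lifts_def)
  qed
  have ext: "restrict u (base X \<phi>) \<in> base X \<phi> \<rightarrow>\<^sub>E base X \<psi>"
    using assms(3) by auto
  have li: "lift X \<phi> (restrict u (base X \<phi>)) \<psi>"
    using r[THEN conjunct1] by (simp only: lifts_def)
  show ?l
    unfolding cartesian_def
  proof (intro conjI ballI impI)
    fix \<chi> v
    assume "\<chi> \<in> Pred X" "v \<in> base X \<chi> \<rightarrow>\<^sub>E base X \<phi>"
      and "lift X \<chi> (compose (base X \<chi>) (restrict u (base X \<phi>)) v) \<psi>"
    then show "lift X \<chi> v \<phi>"
      by (rule uni)
  next
    show "\<phi> \<in> Pred X" "\<psi> \<in> Pred X"
      using assms(1,2) .
    show "restrict u (base X \<phi>) \<in> base X \<phi> \<rightarrow>\<^sub>E base X \<psi>"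
      using ext .
    show "lift X \<phi> (restrict u (base X \<phi>)) \<psi>"
      using li .
  qed
qed

section \<open>Universal property of the chosen reindexing\<close>

context
  fixes N :: "'u set" and u :: "'u \<Rightarrow> 'u" and \<psi> :: 'x
  assumes \<psi>: "\<psi> \<in> Pred X" and N: "small N" and u: "u \<in> N \<rightarrow> base X \<psi>"
begin

lemma pull_cartesian: "base X (pull N u \<psi>) = N \<and> cartesian X (pull N u \<psi>) (restrict u N) \<psi>"
proof -
  have "\<forall>\<psi>\<in>Pred X. \<forall>M. small M \<longrightarrow>
      (\<forall>u\<in>M \<rightarrow>\<^sub>E base X \<psi>. \<exists>\<phi>. base X \<phi> = M \<and> cartesian X \<phi> u \<psi>)"
    using fib unfolding posetal_fibration_def by (elim conjE)
  moreover have "restrict u N \<in> N \<rightarrow>\<^sub>E base X \<psi>"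
    using u by auto
  ultimately have "\<exists>\<phi>. base X \<phi> = N \<and> cartesian X \<phi> (restrict u N) \<psi>"
    using \<psi> N by meson
  then show ?thesis
    unfolding pull_def reindex_def by (rule someI_ex)
qed

lemma base_pull [simp]: "base X (pull N u \<psi>) = N"
  using pull_cartesian by simp

lemma pull_Pred [simp]: "pull N u \<psi> \<in> Pred X"
  using pull_cartesian by (simp add: cartesian_def)

lemma pull_fiber: "pull N u \<psi> \<in> fiber X N"
  by (simp add: fiber_def)

text \<open>Together with \<open>base_pull\<close> and \<open>pull_Pred\<close>, these are the facts
  through which the arbitrary choice in \<open>reindex\<close> is used: a lifting into a reindexed
  predicate is a lifting of the composite map.\<close>

lemma lifts_pull: "lifts (pull N u \<psi>) u \<psi>"
  and lifts_pull_iff: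
    "v \<in> base X \<chi> \<rightarrow> N \<Longrightarrow> lifts \<chi> v (pull N u \<psi>) \<longleftrightarrow> lifts \<chi> (\<lambda>x. u (v x)) \<psi>"
proof -
  have "u \<in> base X (pull N u \<psi>) \<rightarrow> base X \<psi>"
    using u by simp
  from cartesian_iff[OF pull_Pred \<psi> this]
  have *: "lifts (pull N u \<psi>) u \<psi>"
    "\<And>\<chi> v. \<chi> \<in> Pred X \<Longrightarrow> v \<in> base X \<chi> \<rightarrow> N \<Longrightarrow> lifts \<chi> (\<lambda>x. u (v x)) \<psi> \<Longrightarrow> lifts \<chi> v (pull N u \<psi>)"
    using pull_cartesian by simp_all
  show "lifts (pull N u \<psi>) u \<psi>"
    by fact
  show "lifts \<chi> v (pull N u \<psi>) \<longleftrightarrow> lifts \<chi> (\<lambda>x. u (v x)) \<psi>" if "v \<in> base X \<chi> \<rightarrow> N"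
  proof
    show "lifts \<chi> (\<lambda>x. u (v x)) \<psi>" if "lifts \<chi> v (pull N u \<psi>)"
      using that *(1) by (rule lifts_comp)
    show "lifts \<chi> v (pull N u \<psi>)" if "lifts \<chi> (\<lambda>x. u (v x)) \<psi>"
      using liftsD(1)[OF that] \<open>v \<in> base X \<chi> \<rightarrow> N\<close> that by (rule *(2))
  qed
qed

lemma le_pull_iff: "base X \<chi> = N \<Longrightarrow> le X \<chi> (pull N u \<psi>) \<longleftrightarrow> lifts \<chi> u \<psi>"
  using lifts_pull_iff[of "\<lambda>x. x" \<chi>] by (auto simp: le_iff_lifts)

end

text \<open>Yoneda in a fiber: the equivalence, tested at \<phi> and at \<psi> themselves, turns the
  two identity liftings into the two inequalities.\<close>

lemma iso_if_lifts_iff: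
  assumes "\<phi> \<in> Pred X" "\<psi> \<in> Pred X" "base X \<phi> = base X \<psi>"
    and "\<And>\<chi>. \<chi> \<in> Pred X \<Longrightarrow> base X \<chi> = base X \<phi> \<Longrightarrow> lifts \<chi> (\<lambda>x. x) \<phi> \<longleftrightarrow> lifts \<chi> (\<lambda>x. x) \<psi>"
  shows "iso X \<phi> \<psi>"
  using assms(3) assms(4)[of \<phi>] assms(4)[of \<psi>] lifts_id[OF assms(1)] lifts_id[OF assms(2)]
  by (simp add: iso_def le_iff_lifts assms(1,2))

end

section \<open>Realizers\<close>

locale pca_inclusion =
  fixes P :: "'u typed_pca" and S :: "'u \<Rightarrow> 'u set"
  assumes incl: "typed_pca_inclusion P S"
begin

abbreviation "T \<equiv> Ty P"
abbreviation "C \<equiv> carr P"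
abbreviation to (infixr "~>" 70) where "i ~> j \<equiv> imp P i j"
abbreviation times (infixr "\<otimes>" 75) where "i \<otimes> j \<equiv> prd P i j"

lemma to_T [simp]: "i \<in> T \<Longrightarrow> j \<in> T \<Longrightarrow> i ~> j \<in> T"
  and times_T [simp]: "i \<in> T \<Longrightarrow> j \<in> T \<Longrightarrow> i \<otimes> j \<in> T"
  and T_nonempty: "T \<noteq> {}"
  and small_T: "small T"
  and small_C: "i \<in> T \<Longrightarrow> small (C i)"
  using incl by (auto simp: typed_pca_inclusion_def typed_pca_def)

lemma S_C: "i \<in> T \<Longrightarrow> a \<in> S i \<Longrightarrow> a \<in> C i"
  using incl by (auto simp: typed_pca_inclusion_def typed_sub_pca_def)

lemma app_C: "i \<in> T \<Longrightarrow> j \<in> T \<Longrightarrow> a \<in> C (i ~> j) \<Longrightarrow> b \<in> C i \<Longrightarrow> app P i j a b = Some c \<Longrightarrow> c \<in> C j"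
  using incl unfolding typed_pca_inclusion_def typed_pca_def by blast

lemma app_S: "i \<in> T \<Longrightarrow> j \<in> T \<Longrightarrow> a \<in> S (i ~> j) \<Longrightarrow> b \<in> S i \<Longrightarrow> app P i j a b = Some c \<Longrightarrow> c \<in> S j"
  using incl unfolding typed_pca_inclusion_def typed_sub_pca_def by blast

lemma combinators: "has_combinators P S"
  using incl by (simp add: typed_pca_inclusion_def typed_sub_pca_def)

lemma k_S:
  assumes "i \<in> T" "j \<in> T"
  obtains k where "k \<in> S (i ~> j ~> i)" "is_k P i j k"
  using combinators assms unfolding has_combinators_def by blast

text \<open>The realizer is \<open>k c\<close>, which lies in the sub-pca because \<open>c\<close>
  does.\<close>

lemma const_S:
  assumes "i \<in> T" "j \<in> T" "c \<in> S j"
  obtains e where "e \<in> S (i ~> j)" "\<forall>a\<in>C i. app P i j e a = Some c"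
proof -
  obtain k where k: "k \<in> S (j ~> i ~> j)" "is_k P j i k"
    using k_S[OF assms(2,1)] by blast
  have "c \<in> C j"
    using S_C assms by blast
  then obtain e where e: "app P j (i ~> j) k c = Some e" "\<forall>a\<in>C i. app P i j e a = Some c"
    using k(2) unfolding is_k_def by blast
  then have "e \<in> S (i ~> j)"
    using app_S[OF _ _ k(1) assms(3)] assms by simp
  then show ?thesis
    using e(2) that by blast
qed

lemma s_S:
  assumes T: "i \<in> T" "j \<in> T" "k \<in> T" and x: "x \<in> S (i ~> j ~> k)"
  obtains q where "q \<in> S ((i ~> j) ~> i ~> k)"
    "\<forall>y\<in>C (i ~> j). \<exists>g. app P (i ~> j) (i ~> k) q y = Some g \<and>
      (\<forall>z\<in>C i. \<forall>xz yz r. app P i (j ~> k) x z = Some xz \<and> app P i j y z = Some yz \<and>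
         app P j k xz yz = Some r \<longrightarrow> app P i k g z = Some r)"
proof -
  obtain s where s: "s \<in> S ((i ~> j ~> k) ~> (i ~> j) ~> i ~> k)" "is_s P i j k s"
    using combinators T unfolding has_combinators_def by blast
  have "x \<in> C (i ~> j ~> k)"
    by (rule S_C) (use T x in auto)
  then obtain q where q: "app P (i ~> j ~> k) ((i ~> j) ~> i ~> k) s x = Some q"
    "\<forall>y\<in>C (i ~> j). \<exists>g. app P (i ~> j) (i ~> k) q y = Some g \<and>
      (\<forall>z\<in>C i. \<forall>xz yz r. app P i (j ~> k) x z = Some xz \<and> app P i j y z = Some yz \<and>
         app P j k xz yz = Some r \<longrightarrow> app P i k g z = Some r)"
    using s(2) unfolding is_s_def by blast
  have "q \<in> S ((i ~> j) ~> i ~> k)"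
    using app_S[OF _ _ s(1) x q(1)] T by simp
  then show ?thesis
    using that q(2) by blast
qed

lemma s_app_S:
  assumes T: "i \<in> T" "j \<in> T" "k \<in> T"
    and x: "x \<in> S (i ~> j ~> k)" and y: "y \<in> S (i ~> j)"
  obtains g where "g \<in> S (i ~> k)"
    "\<forall>z\<in>C i. \<forall>xz yz r. app P i (j ~> k) x z = Some xz \<longrightarrow>
      app P i j y z = Some yz \<longrightarrow>
      app P j k xz yz = Some r \<longrightarrow>
      app P i k g z = Some r"
proof -
  obtain q where q: "q \<in> S ((i ~> j) ~> i ~> k)"
    "\<forall>y\<in>C (i ~> j). \<exists>g. app P (i ~> j) (i ~> k) q y = Some g \<and>
      (\<forall>z\<in>C i. \<forall>xz yz r. app P i (j ~> k) x z = Some xz \<and> app P i j y z = Some yz \<and>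
         app P j k xz yz = Some r \<longrightarrow> app P i k g z = Some r)"
    using s_S[OF T x] .
  have "y \<in> C (i ~> j)"
    by (rule S_C) (use T y in auto)
  from q(2)[rule_format, OF this] obtain g where g: "app P (i ~> j) (i ~> k) q y = Some g"
      "\<forall>z\<in>C i. \<forall>xz yz r. app P i (j ~> k) x z = Some xz \<and> app P i j y z = Some yz \<and>
         app P j k xz yz = Some r \<longrightarrow> app P i k g z = Some r"
    by blast
  have "g \<in> S (i ~> k)"
    using app_S[OF _ _ q(1) y g(1)] T by simp
  then show ?thesis
    using that g(2) by blast
qed

text \<open>This is \<open>s k k'\<close>, where \<open>k\<close> discards an argument of type
  \<open>i ~> i\<close> and \<open>k'\<close> supplies one: \<open>s k k' a\<close> reduces to
  \<open>k a (k' a)\<close>, hence to \<open>a\<close>.\<close>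

lemma id_S:
  assumes "i \<in> T"
  obtains e where "e \<in> S (i ~> i)" "\<forall>a\<in>C i. app P i i e a = Some a"
proof -
  let ?j = "i ~> i"
  have T: "i \<in> T" "?j \<in> T" "i \<in> T"
    using assms by simp_all
  obtain k where k: "k \<in> S (i ~> ?j ~> i)" "is_k P i ?j k"
    using k_S[OF T(1,2)] by blast
  obtain k' where k': "k' \<in> S (i ~> ?j)" "is_k P i i k'"
    using k_S[OF T(1,1)] by blast
  obtain e where e: "e \<in> S (i ~> i)"
    "\<forall>z\<in>C i. \<forall>xz yz r. app P i (?j ~> i) k z = Some xz \<longrightarrow>
      app P i ?j k' z = Some yz \<longrightarrow>
      app P ?j i xz yz = Some r \<longrightarrow>
      app P i i e z = Some r"
    using s_app_S[OF T k(1) k'(1)] .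
  have "app P i i e a = Some a" if a: "a \<in> C i" for a
  proof -
    obtain ka where ka: "app P i (?j ~> i) k a = Some ka" "\<forall>y\<in>C ?j. app P ?j i ka y = Some a"
      using k(2) a unfolding is_k_def by blast
    obtain ka' where ka': "app P i ?j k' a = Some ka'"
      using k'(2) a unfolding is_k_def by blast
    have "ka' \<in> C ?j"
      using app_C[OF T(1,2) S_C[OF _ k'(1)] a ka'] T by simp
    then show ?thesis
      using e(2)[rule_format, OF a ka(1) ka'] ka(2) by blast
  qed
  then show ?thesis
    using that e(1) by blast
qed

text \<open>Composition is \<open>s (k f) e\<close>; the constant function at \<open>f\<close> comes
  from \<open>const_S\<close>.\<close>

lemma comp_S:
  assumes T: "i \<in> T" "j \<in> T" "k \<in> T" and e: "e \<in> S (i ~> j)" and f: "f \<in> S (j ~> k)"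
  obtains g where "g \<in> S (i ~> k)"
    "\<forall>a\<in>C i. \<forall>b c. app P i j e a = Some b \<longrightarrow>
      app P j k f b = Some c \<longrightarrow>
      app P i k g a = Some c"
proof -
  obtain h where h: "h \<in> S (i ~> j ~> k)" "\<forall>a\<in>C i. app P i (j ~> k) h a = Some f"
    using const_S[OF T(1) to_T[OF T(2,3)] f] .
  obtain g where g: "g \<in> S (i ~> k)"
    "\<forall>z\<in>C i. \<forall>xz yz r. app P i (j ~> k) h z = Some xz \<longrightarrow>
      app P i j e z = Some yz \<longrightarrow>
      app P j k xz yz = Some r \<longrightarrow>
      app P i k g z = Some r"
    using s_app_S[OF T h(1) e] .
  show ?thesis
    by (rule that[OF g(1)], intro ballI allI impI) (rule g(2)[rule_format, OF _ h(2)[rule_format]])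
qed

text \<open>Fixing the combinators by choice makes the pair of two elements a function
  \<open>tup\<close> of types and elements, so that meets can be written as sets of pairs.\<close>

definition pairing :: "'u \<Rightarrow> 'u \<Rightarrow> 'u \<times> 'u \<times> 'u" where
  "pairing i j = (SOME (pr, p1, p2). pr \<in> S (i ~> j ~> i \<otimes> j) \<and>
     p1 \<in> S (i \<otimes> j ~> i) \<and> p2 \<in> S (i \<otimes> j ~> j) \<and> is_pairing P i j pr p1 p2)"

definition tup :: "'u \<Rightarrow> 'u \<Rightarrow> 'u \<Rightarrow> 'u \<Rightarrow> 'u" where
  "tup i j a b =
     the (app P j (i \<otimes> j) (the (app P i (j ~> i \<otimes> j) (fst (pairing i j)) a)) b)"

lemma pairing:
  assumes T: "i \<in> T" "j \<in> T"
  obtains pr p1 p2 where "pr \<in> S (i ~> j ~> i \<otimes> j)" "p1 \<in> S (i \<otimes> j ~> i)" "p2 \<in> S (i \<otimes> j ~> j)"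
    "\<forall>a\<in>C i. \<exists>pa. app P i (j ~> i \<otimes> j) pr a = Some pa \<and>
      (\<forall>b\<in>C j. app P j (i \<otimes> j) pa b = Some (tup i j a b))"
    "\<forall>a\<in>C i. \<forall>b\<in>C j. app P (i \<otimes> j) i p1 (tup i j a b) = Some a"
    "\<forall>a\<in>C i. \<forall>b\<in>C j. app P (i \<otimes> j) j p2 (tup i j a b) = Some b"
proof -
  have "\<exists>pr p1 p2. pr \<in> S (i ~> j ~> i \<otimes> j) \<and>
     p1 \<in> S (i \<otimes> j ~> i) \<and> p2 \<in> S (i \<otimes> j ~> j) \<and> is_pairing P i j pr p1 p2"
    using combinators T unfolding has_combinators_def by blast
  then have "\<exists>x. case x of (pr, p1, p2) \<Rightarrow> pr \<in> S (i ~> j ~> i \<otimes> j) \<and>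
     p1 \<in> S (i \<otimes> j ~> i) \<and> p2 \<in> S (i \<otimes> j ~> j) \<and> is_pairing P i j pr p1 p2"
    by auto
  from someI_ex[OF this, folded pairing_def]
  obtain pr p1 p2 where eq: "pairing i j = (pr, p1, p2)" and S: "pr \<in> S (i ~> j ~> i \<otimes> j)"
     "p1 \<in> S (i \<otimes> j ~> i)" "p2 \<in> S (i \<otimes> j ~> j)" and p: "is_pairing P i j pr p1 p2"
    by (cases "pairing i j") auto
  have *: "\<exists>pa. app P i (j ~> i \<otimes> j) pr a = Some pa \<and>
      (\<forall>b\<in>C j. app P j (i \<otimes> j) pa b = Some (tup i j a b) \<and>
        app P (i \<otimes> j) i p1 (tup i j a b) = Some a \<and> app P (i \<otimes> j) j p2 (tup i j a b) = Some b)"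
    if a: "a \<in> C i" for a
  proof -
    obtain pa where pa: "app P i (j ~> i \<otimes> j) pr a = Some pa"
      "\<forall>b\<in>C j. \<exists>c. app P j (i \<otimes> j) pa b = Some c \<and>
        app P (i \<otimes> j) i p1 c = Some a \<and> app P (i \<otimes> j) j p2 c = Some b"
      using p a unfolding is_pairing_def by blast
    then show ?thesis
      by (auto simp: tup_def eq)
  qed
  show ?thesis
    by (rule that[OF S]) (use * in blast)+
qed

lemma tup_C: "i \<in> T \<Longrightarrow> j \<in> T \<Longrightarrow> a \<in> C i \<Longrightarrow> b \<in> C j \<Longrightarrow> tup i j a b \<in> C (i \<otimes> j)"
proof -
  assume T: "i \<in> T" "j \<in> T" and ab: "a \<in> C i" "b \<in> C j"
  obtain pr p1 p2 where p: "pr \<in> S (i ~> j ~> i \<otimes> j)"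
    "\<forall>a\<in>C i. \<exists>pa. app P i (j ~> i \<otimes> j) pr a = Some pa \<and>
      (\<forall>b\<in>C j. app P j (i \<otimes> j) pa b = Some (tup i j a b))"
    using pairing[OF T] .
  obtain pa where pa: "app P i (j ~> i \<otimes> j) pr a = Some pa"
      "app P j (i \<otimes> j) pa b = Some (tup i j a b)"
    using p(2) ab by blast
  have "pa \<in> C (j ~> i \<otimes> j)"
    using app_C[OF _ _ S_C[OF _ p(1)] ab(1) pa(1)] T by simp
  from app_C[OF _ _ this ab(2) pa(2)] show ?thesis
    using T by simp
qed

lemma fst_S:
  assumes "i \<in> T" "j \<in> T"
  obtains e where "e \<in> S (i \<otimes> j ~> i)"
    "\<forall>a\<in>C i. \<forall>b\<in>C j. app P (i \<otimes> j) i e (tup i j a b) = Some a"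
  by (rule pairing[OF assms]) (erule that)

lemma snd_S:
  assumes "i \<in> T" "j \<in> T"
  obtains e where "e \<in> S (i \<otimes> j ~> j)"
    "\<forall>a\<in>C i. \<forall>b\<in>C j. app P (i \<otimes> j) j e (tup i j a b) = Some b"
  by (rule pairing[OF assms]) (erule that)

text \<open>The realizer is \<open>s\<close> applied to the composite of \<open>pr\<close> with
  \<open>e\<close> and to \<open>f\<close>.\<close>

lemma tup_S:
  assumes T: "i \<in> T" "j \<in> T" "k \<in> T" and e: "e \<in> S (i ~> j)" and f: "f \<in> S (i ~> k)"
  obtains g where "g \<in> S (i ~> j \<otimes> k)"
    "\<forall>a\<in>C i. \<forall>b c. app P i j e a = Some b \<longrightarrow>
      app P i k f a = Some c \<longrightarrow>
      app P i (j \<otimes> k) g a = Some (tup j k b c)"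
proof -
  obtain pr p1 p2 where p: "pr \<in> S (j ~> k ~> j \<otimes> k)"
    "\<forall>a\<in>C j. \<exists>pa. app P j (k ~> j \<otimes> k) pr a = Some pa \<and>
      (\<forall>b\<in>C k. app P k (j \<otimes> k) pa b = Some (tup j k a b))"
    using pairing[OF T(2,3)] .
  obtain h where h: "h \<in> S (i ~> k ~> j \<otimes> k)"
    "\<forall>a\<in>C i. \<forall>b c. app P i j e a = Some b \<longrightarrow>
      app P j (k ~> j \<otimes> k) pr b = Some c \<longrightarrow>
      app P i (k ~> j \<otimes> k) h a = Some c"
    using comp_S[OF T(1,2) to_T[OF T(3) times_T[OF T(2,3)]] e p(1)] .
  obtain g where g: "g \<in> S (i ~> j \<otimes> k)"
    "\<forall>z\<in>C i. \<forall>xz yz r. app P i (k ~> j \<otimes> k) h z = Some xz \<longrightarrow>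
      app P i k f z = Some yz \<longrightarrow>
      app P k (j \<otimes> k) xz yz = Some r \<longrightarrow>
      app P i (j \<otimes> k) g z = Some r"
    using s_app_S[OF T(1,3) times_T[OF T(2,3)] h(1) f] .
  have "app P i (j \<otimes> k) g a = Some (tup j k b c)"
    if a: "a \<in> C i" and b: "app P i j e a = Some b" and c: "app P i k f a = Some c" for a b c
  proof -
    have C: "b \<in> C j" "c \<in> C k"
      using app_C[OF T(1,2) S_C[OF _ e] a b] app_C[OF T(1,3) S_C[OF _ f] a c] T by simp_all
    then obtain pa where "app P j (k ~> j \<otimes> k) pr b = Some pa"
        "app P k (j \<otimes> k) pa c = Some (tup j k b c)"
      using p(2) by blast
    then show ?thesis
      using g(2)[rule_format, OF a h(2)[rule_format, OF a b] c] by blast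
  qed
  then show ?thesis
    using that g(1) by blast
qed

text \<open>Applying the first component to the second is \<open>s p1 p2\<close>.\<close>

lemma eval_S:
  assumes T: "i \<in> T" "j \<in> T"
  obtains g where "g \<in> S ((i ~> j) \<otimes> i ~> j)"
    "\<forall>a\<in>C (i ~> j). \<forall>b\<in>C i. \<forall>c. app P i j a b = Some c \<longrightarrow>
      app P ((i ~> j) \<otimes> i) j g (tup (i ~> j) i a b) = Some c"
proof -
  let ?l = "(i ~> j) \<otimes> i"
  have T': "i ~> j \<in> T" "?l \<in> T"
    using T by simp_all
  obtain p1 where p1: "p1 \<in> S (?l ~> i ~> j)"
    "\<forall>a\<in>C (i ~> j). \<forall>b\<in>C i. app P ?l (i ~> j) p1 (tup (i ~> j) i a b) = Some a"
    using fst_S[OF T'(1) T(1)] .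
  obtain p2 where p2: "p2 \<in> S (?l ~> i)"
    "\<forall>a\<in>C (i ~> j). \<forall>b\<in>C i. app P ?l i p2 (tup (i ~> j) i a b) = Some b"
    using snd_S[OF T'(1) T(1)] .
  obtain g where g: "g \<in> S (?l ~> j)"
    "\<forall>z\<in>C ?l. \<forall>xz yz r. app P ?l (i ~> j) p1 z = Some xz \<longrightarrow>
      app P ?l i p2 z = Some yz \<longrightarrow>
      app P i j xz yz = Some r \<longrightarrow>
      app P ?l j g z = Some r"
    using s_app_S[OF T'(2) T p1(1) p2(1)] .
  show ?thesis
    by (rule that[OF g(1)], intro ballI allI impI)
      (rule g(2)[rule_format, OF tup_C[OF T'(1) T(1)] p1(2)[rule_format] p2(2)[rule_format]])
qed

text \<open>For given \<open>a\<close> the function \<open>h\<close> is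
  \<open>s (k e) (pr a)\<close>. It exists for every \<open>a\<close> in \<open>C i\<close>, even
  where \<open>e\<close> is undefined on pairs, because \<open>s x y\<close> is always
  defined.\<close>

lemma curry_S:
  assumes T: "i \<in> T" "j \<in> T" "k \<in> T" and e: "e \<in> S (i \<otimes> j ~> k)"
  obtains g where "g \<in> S (i ~> j ~> k)"
    "\<forall>a\<in>C i. \<exists>h. app P i (j ~> k) g a = Some h \<and>
      (\<forall>b\<in>C j. \<forall>c. app P (i \<otimes> j) k e (tup i j a b) = Some c \<longrightarrow> app P j k h b = Some c)"
proof -
  let ?l = "i \<otimes> j"
  have T': "?l \<in> T" "j ~> ?l \<in> T" "j ~> k \<in> T"
    using T by simp_all
  obtain f where f: "f \<in> S (j ~> ?l ~> k)" "\<forall>b\<in>C j. app P j (?l ~> k) f b = Some e"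
    using const_S[OF T(2) to_T[OF T'(1) T(3)] e] .
  obtain q where q: "q \<in> S ((j ~> ?l) ~> j ~> k)"
    "\<forall>y\<in>C (j ~> ?l). \<exists>g. app P (j ~> ?l) (j ~> k) q y = Some g \<and>
      (\<forall>z\<in>C j. \<forall>xz yz r. app P j (?l ~> k) f z = Some xz \<and> app P j ?l y z = Some yz \<and>
         app P ?l k xz yz = Some r \<longrightarrow> app P j k g z = Some r)"
    using s_S[OF T(2) T'(1) T(3) f(1)] .
  obtain pr p1 p2 where p: "pr \<in> S (i ~> j ~> i \<otimes> j)"
    "\<forall>a\<in>C i. \<exists>pa. app P i (j ~> i \<otimes> j) pr a = Some pa \<and>
      (\<forall>b\<in>C j. app P j (i \<otimes> j) pa b = Some (tup i j a b))"
    using pairing[OF T(1,2)] .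
  obtain g where g: "g \<in> S (i ~> j ~> k)"
    "\<forall>a\<in>C i. \<forall>b c. app P i (j ~> ?l) pr a = Some b \<longrightarrow>
      app P (j ~> ?l) (j ~> k) q b = Some c \<longrightarrow>
      app P i (j ~> k) g a = Some c"
    using comp_S[OF T(1) T'(2,3) p(1) q(1)] .
  have "\<exists>h. app P i (j ~> k) g a = Some h \<and>
      (\<forall>b\<in>C j. \<forall>c. app P (i \<otimes> j) k e (tup i j a b) = Some c \<longrightarrow> app P j k h b = Some c)"
    if a: "a \<in> C i" for a
  proof -
    obtain pa where pa: "app P i (j ~> ?l) pr a = Some pa"
      "\<forall>b\<in>C j. app P j ?l pa b = Some (tup i j a b)"
      using p(2) a by blast
    have "pa \<in> C (j ~> ?l)"
      using app_C[OF T(1) T'(2) S_C[OF _ p(1)] a pa(1)] T by simp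
    then obtain h where h: "app P (j ~> ?l) (j ~> k) q pa = Some h"
      "\<forall>z\<in>C j. \<forall>xz yz r. app P j (?l ~> k) f z = Some xz \<and> app P j ?l pa z = Some yz \<and>
         app P ?l k xz yz = Some r \<longrightarrow> app P j k h z = Some r"
      using q(2) by blast
    then show ?thesis
      using g(2)[rule_format, OF a pa(1)] f(2) pa(2) by blast
  qed
  then show ?thesis
    using that g(1) by blast
qed


section \<open>Realizable entailment between families of realizer sets, and its Heyting
  structure\<close>

definition rl :: "'u set \<Rightarrow> 'u \<Rightarrow> ('u \<Rightarrow> 'u set) \<Rightarrow> 'u \<Rightarrow> ('u \<Rightarrow> 'u set) \<Rightarrow> bool" where
  "rl M i f j g \<longleftrightarrow> (\<exists>e\<in>S (i ~> j). \<forall>m\<in>M. \<forall>a\<in>f m. \<exists>b\<in>g m. app P i j e a = Some b)"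

definition val :: "'u set \<Rightarrow> 'u \<Rightarrow> ('u \<Rightarrow> 'u set) \<Rightarrow> bool" where
  "val M i f \<longleftrightarrow> i \<in> T \<and> f \<in> M \<rightarrow> Pow (C i)"

lemma rl_cong:
  "(\<And>m. m \<in> M \<Longrightarrow> f m = f' m) \<Longrightarrow> (\<And>m. m \<in> M \<Longrightarrow> g m = g' m) \<Longrightarrow> rl M i f j g \<longleftrightarrow> rl M i f' j g'"
  by (simp add: rl_def)

lemma rl_mono:
  assumes "val M i f" "\<And>m. m \<in> M \<Longrightarrow> f m \<subseteq> g m"
  shows "rl M i f i g"
proof -
  obtain e where "e \<in> S (i ~> i)" "\<forall>a\<in>C i. app P i i e a = Some a"
    using assms(1) unfolding val_def by (elim conjE) (rule id_S)
  then show ?thesis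
    using assms unfolding rl_def val_def by blast
qed

lemma rl_refl: "val M i f \<Longrightarrow> rl M i f i f"
  by (rule rl_mono) auto

lemma rl_trans:
  assumes "val M i f" "j \<in> T" "k \<in> T" "rl M i f j g" "rl M j g k h"
  shows "rl M i f k h"
proof -
  obtain e e' where e: "e \<in> S (i ~> j)" "e' \<in> S (j ~> k)"
    "\<forall>m\<in>M. \<forall>a\<in>f m. \<exists>b\<in>g m. app P i j e a = Some b" "\<forall>m\<in>M. \<forall>a\<in>g m. \<exists>b\<in>h m. app P j k e' a = Some b"
    using assms unfolding rl_def by blast
  obtain c where c: "c \<in> S (i ~> k)"
    "\<forall>x\<in>C i. \<forall>y z. app P i j e x = Some y \<longrightarrow>
      app P j k e' y = Some z \<longrightarrow>
      app P i k c x = Some z"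
    using comp_S[OF assms(1)[unfolded val_def, THEN conjunct1] assms(2,3) e(1,2)] .
  have "\<exists>b\<in>h m. app P i k c a = Some b" if m: "m \<in> M" "a \<in> f m" for m a
  proof -
    obtain b where b: "b \<in> g m" "app P i j e a = Some b"
      using e(3) m by blast
    then obtain d where "d \<in> h m" "app P j k e' b = Some d"
      using e(4) m by blast
    moreover have "a \<in> C i"
      using m assms(1) by (auto simp: val_def)
    ultimately show ?thesis
      using c(2) b by blast
  qed
  then show ?thesis
    using c(1) unfolding rl_def by blast
qed

lemma rl_subst: "rl M i f j g \<Longrightarrow> u \<in> N \<rightarrow> M \<Longrightarrow> rl N i (\<lambda>n. f (u n)) j (\<lambda>n. g (u n))"
  unfolding rl_def by blast

lemma rl_const:
  assumes "val M i f" "j \<in> T" "c \<in> S j" "\<And>m. m \<in> M \<Longrightarrow> c \<in> g m"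
  shows "rl M i f j g"
proof -
  obtain e where "e \<in> S (i ~> j)" "\<forall>a\<in>C i. app P i j e a = Some c"
    using const_S[OF assms(1)[unfolded val_def, THEN conjunct1] assms(2,3)] .
  then show ?thesis
    using assms unfolding rl_def val_def by blast
qed

definition meetv :: "'u \<Rightarrow> 'u \<Rightarrow> ('u \<Rightarrow> 'u set) \<Rightarrow> ('u \<Rightarrow> 'u set) \<Rightarrow> 'u \<Rightarrow> 'u set" where
  "meetv i j f g m = {tup i j a b |a b. a \<in> f m \<and> b \<in> g m}"

definition impv :: "'u \<Rightarrow> 'u \<Rightarrow> ('u \<Rightarrow> 'u set) \<Rightarrow> ('u \<Rightarrow> 'u set) \<Rightarrow> 'u \<Rightarrow> 'u set" where
  "impv i j f g m = {a \<in> C (i ~> j). \<forall>b\<in>f m. \<exists>c\<in>g m. app P i j a b = Some c}"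

lemma val_meetv: "val M i f \<Longrightarrow> val M j g \<Longrightarrow> val M (i \<otimes> j) (meetv i j f g)"
  by (auto simp: val_def meetv_def Pi_iff intro!: tup_C)

lemma val_impv: "i \<in> T \<Longrightarrow> j \<in> T \<Longrightarrow> val M (i ~> j) (impv i j f g)"
  by (auto simp: val_def impv_def)

lemma val_subst: "val M i f \<Longrightarrow> u \<in> N \<rightarrow> M \<Longrightarrow> val N i (\<lambda>n. f (u n))"
  unfolding val_def by blast

lemma rl_fst:
  assumes "val M i f" "val M j g"
  shows "rl M (i \<otimes> j) (meetv i j f g) i f"
proof -
  obtain e where "e \<in> S (i \<otimes> j ~> i)"
    "\<forall>a\<in>C i. \<forall>b\<in>C j. app P (i \<otimes> j) i e (tup i j a b) = Some a"
    using fst_S[OF assms(1)[unfolded val_def, THEN conjunct1] assms(2)[unfolded val_def, THEN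
        conjunct1]] .
  then show ?thesis
    using assms unfolding rl_def val_def meetv_def by blast
qed

lemma rl_snd:
  assumes "val M i f" "val M j g"
  shows "rl M (i \<otimes> j) (meetv i j f g) j g"
proof -
  obtain e where "e \<in> S (i \<otimes> j ~> j)"
    "\<forall>a\<in>C i. \<forall>b\<in>C j. app P (i \<otimes> j) j e (tup i j a b) = Some b"
    using snd_S[OF assms(1)[unfolded val_def, THEN conjunct1] assms(2)[unfolded val_def, THEN
        conjunct1]] .
  then show ?thesis
    using assms unfolding rl_def val_def meetv_def by blast
qed

lemma rl_meetv:
  assumes "val M i f" "j \<in> T" "k \<in> T" "rl M i f j g" "rl M i f k h"
  shows "rl M i f (j \<otimes> k) (meetv j k g h)"
proof -
  obtain e e' where e: "e \<in> S (i ~> j)" "e' \<in> S (i ~> k)"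
    "\<forall>m\<in>M. \<forall>a\<in>f m. \<exists>b\<in>g m. app P i j e a = Some b" "\<forall>m\<in>M. \<forall>a\<in>f m. \<exists>b\<in>h m. app P i k e' a = Some b"
    using assms unfolding rl_def by blast
  obtain c where c: "c \<in> S (i ~> j \<otimes> k)"
    "\<forall>x\<in>C i. \<forall>y z. app P i j e x = Some y \<longrightarrow>
      app P i k e' x = Some z \<longrightarrow>
      app P i (j \<otimes> k) c x = Some (tup j k y z)"
    using tup_S[OF assms(1)[unfolded val_def, THEN conjunct1] assms(2,3) e(1,2)] .
  have "\<exists>b\<in>meetv j k g h m. app P i (j \<otimes> k) c a = Some b" if m: "m \<in> M" "a \<in> f m" for m a
  proof -
    have "a \<in> C i"
      using m assms(1) by (auto simp: val_def)
    moreover obtain y z where y: "y \<in> g m" "app P i j e a = Some y"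
      and z: "z \<in> h m" "app P i k e' a = Some z"
      using e(3,4) m by blast
    ultimately have "app P i (j \<otimes> k) c a = Some (tup j k y z)"
      using c(2) by blast
    then show ?thesis
      using y(1) z(1) by (auto simp: meetv_def)
  qed
  then show ?thesis
    using c(1) unfolding rl_def by blast
qed

text \<open>Evaluation gives one direction and currying the other. An element of
  \<open>impv j k g h\<close> at \<open>m\<close> only has to be defined on the realizers in
  \<open>g m\<close>, and there \<open>curry_S\<close> provides the values.\<close>

lemma rl_meetv_impv_iff:
  assumes f: "val M i f" and g: "val M j g" and k: "k \<in> T"
  shows "rl M i f (j ~> k) (impv j k g h) \<longleftrightarrow> rl M (i \<otimes> j) (meetv i j f g) k h"
proof
  have T: "i \<in> T" "j \<in> T" "j ~> k \<in> T"
    using assms by (simp_all add: val_def)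
  assume *: "rl M i f (j ~> k) (impv j k g h)"
  have v: "val M (i \<otimes> j) (meetv i j f g)"
    using val_meetv[OF f g] .
  have "rl M (i \<otimes> j) (meetv i j f g) (j ~> k) (impv j k g h)"
    by (rule rl_trans[OF v T(1,3) rl_fst[OF f g] *])
  then have 1: "rl M (i \<otimes> j) (meetv i j f g) ((j ~> k) \<otimes> j) (meetv (j ~> k) j (impv j k g h) g)"
    by (rule rl_meetv[OF v T(3,2) _ rl_snd[OF f g]])
  obtain e where e: "e \<in> S ((j ~> k) \<otimes> j ~> k)"
    "\<forall>a\<in>C (j ~> k). \<forall>b\<in>C j. \<forall>c. app P j k a b = Some c \<longrightarrow>
      app P ((j ~> k) \<otimes> j) k e (tup (j ~> k) j a b) = Some c"
    using eval_S[OF T(2) k] .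
  have "rl M ((j ~> k) \<otimes> j) (meetv (j ~> k) j (impv j k g h) g) k h"
    unfolding rl_def
  proof (intro bexI[OF _ e(1)] ballI)
    fix m x assume m: "m \<in> M" and x: "x \<in> meetv (j ~> k) j (impv j k g h) g m"
    then obtain a b where ab: "x = tup (j ~> k) j a b" "a \<in> impv j k g h m" "b \<in> g m"
      unfolding meetv_def by blast
    obtain c where c: "c \<in> h m" "app P j k a b = Some c"
      using ab unfolding impv_def by blast
    have "b \<in> C j" "a \<in> C (j ~> k)"
      using ab m g by (auto simp: impv_def val_def)
    then show "\<exists>b\<in>h m. app P ((j ~> k) \<otimes> j) k e x = Some b"
      using e(2) c ab(1) by blast
  qed
  from rl_trans[OF v _ k 1 this] show "rl M (i \<otimes> j) (meetv i j f g) k h"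
    using T by simp
next
  have T: "i \<in> T" "j \<in> T"
    using assms by (simp_all add: val_def)
  assume "rl M (i \<otimes> j) (meetv i j f g) k h"
  then obtain e where e: "e \<in> S (i \<otimes> j ~> k)"
    "\<forall>m\<in>M. \<forall>a\<in>meetv i j f g m. \<exists>b\<in>h m. app P (i \<otimes> j) k e a = Some b"
    unfolding rl_def by blast
  obtain q where q: "q \<in> S (i ~> j ~> k)"
    "\<forall>a\<in>C i. \<exists>h. app P i (j ~> k) q a = Some h \<and>
      (\<forall>b\<in>C j. \<forall>c. app P (i \<otimes> j) k e (tup i j a b) = Some c \<longrightarrow> app P j k h b = Some c)"
    using curry_S[OF T k e(1)] .
  show "rl M i f (j ~> k) (impv j k g h)"
    unfolding rl_def
  proof (intro bexI[OF _ q(1)] ballI)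
    fix m a assume m: "m \<in> M" and a: "a \<in> f m"
    have aC: "a \<in> C i"
      using m a f by (auto simp: val_def)
    then obtain r where r: "app P i (j ~> k) q a = Some r"
      "\<forall>b\<in>C j. \<forall>c. app P (i \<otimes> j) k e (tup i j a b) = Some c \<longrightarrow> app P j k r b = Some c"
      using q(2) by blast
    have "r \<in> C (j ~> k)"
      using app_C[OF T(1) _ S_C[OF _ q(1)] aC r(1)] T k by simp
    moreover have "\<exists>c\<in>h m. app P j k r b = Some c" if b: "b \<in> g m" for b
    proof -
      have "b \<in> C j"
        using m b g by (auto simp: val_def)
      moreover have "tup i j a b \<in> meetv i j f g m"
        using a b by (auto simp: meetv_def)
      ultimately show ?thesis
        using e(2) r(2) m by blast
    qed
    ultimately have "r \<in> impv j k g h m"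
      by (simp add: impv_def)
    then show "\<exists>b\<in>impv j k g h m. app P i (j ~> k) q a = Some b"
      using r(1) by blast
  qed
qed

text \<open>A typed pca has no designated unit type. Any type inhabited in the sub-pca serves, since
  a constant realizer sends everything to the chosen element; \<open>i ~> i\<close> with its
  identity shows that there is one.\<close>

definition unit_type :: "'u" where
  "unit_type = (SOME i. i \<in> T \<and> S i \<noteq> {})"

definition unit_elem :: "'u" where
  "unit_elem = (SOME c. c \<in> S unit_type)"

lemma unit_type: "unit_type \<in> T"
  and unit_elem: "unit_elem \<in> S unit_type"
proof -
  obtain i where i: "i \<in> T"
    using T_nonempty by blast
  obtain e where "e \<in> S (i ~> i)"
    using id_S[OF i] by blast
  then have "\<exists>i. i \<in> T \<and> S i \<noteq> {}"
    using i to_T by blast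
  then have *: "unit_type \<in> T \<and> S unit_type \<noteq> {}"
    unfolding unit_type_def by (rule someI_ex)
  then show "unit_type \<in> T" "unit_elem \<in> S unit_type"
    unfolding unit_elem_def by (auto intro: someI)
qed

end

section \<open>Functoriality of reindexing up to isomorphism\<close>

context posetal_fib
begin

lemma pull_pull:
  assumes "\<psi> \<in> Pred X" "small N" "u \<in> N \<rightarrow> base X \<psi>" "small L" "v \<in> L \<rightarrow> N"
  shows "iso X (pull L v (pull N u \<psi>)) (pull L (\<lambda>x. u (v x)) \<psi>)"
proof -
  have uv: "(\<lambda>x. u (v x)) \<in> L \<rightarrow> base X \<psi>" and v: "v \<in> L \<rightarrow> base X (pull N u \<psi>)"
    using assms by auto
  note r = base_pull[OF assms(1-3)] pull_Pred[OF assms(1-3)] base_pull[OF assms(1) assms(4) uv]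
    pull_Pred[OF assms(1) assms(4) uv] base_pull[OF pull_Pred[OF assms(1-3)] assms(4) v]
    pull_Pred[OF pull_Pred[OF assms(1-3)] assms(4) v]
  show ?thesis
  proof (rule iso_if_lifts_iff)
    fix \<chi> assume \<chi>: "base X \<chi> = base X (pull L v (pull N u \<psi>))"
    have "lifts \<chi> (\<lambda>x. x) (pull L v (pull N u \<psi>)) \<longleftrightarrow> lifts \<chi> v (pull N u \<psi>)"
      by (rule lifts_pull_iff[OF pull_Pred[OF assms(1-3)] assms(4) v]) (use \<chi> r in auto)
    also have "\<dots> \<longleftrightarrow> lifts \<chi> (\<lambda>x. u (v x)) \<psi>"
      by (rule lifts_pull_iff[OF assms(1-3)]) (use \<chi> r v in auto)
    also have "\<dots> \<longleftrightarrow> lifts \<chi> (\<lambda>x. x) (pull L (\<lambda>x. u (v x)) \<psi>)"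
      by (rule lifts_pull_iff[OF assms(1) assms(4) uv, symmetric]) (use \<chi> r in auto)
    finally show "lifts \<chi> (\<lambda>x. x) (pull L v (pull N u \<psi>)) \<longleftrightarrow>
        lifts \<chi> (\<lambda>x. x) (pull L (\<lambda>x. u (v x)) \<psi>)" .
  qed (use r in auto)
qed

lemma pull_mono:
  assumes "le X \<phi> \<psi>" "small N" "u \<in> N \<rightarrow> base X \<phi>"
  shows "le X (pull N u \<phi>) (pull N u \<psi>)"
proof -
  have P: "\<phi> \<in> Pred X" "\<psi> \<in> Pred X" and u: "u \<in> N \<rightarrow> base X \<psi>"
    using assms by (auto simp: le_def)
  show ?thesis
    using le_pull_iff[OF P(2) assms(2) u, of "pull N u \<phi>"] base_pull[OF P(1) assms(2,3)]
      le_lifts[OF assms(1) lifts_pull[OF P(1) assms(2,3)]] by simp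
qed

lemma iso_Pred: "iso X \<phi> \<psi> \<Longrightarrow> \<phi> \<in> Pred X" "iso X \<phi> \<psi> \<Longrightarrow> \<psi> \<in> Pred X"
  "iso X \<phi> \<psi> \<Longrightarrow> base X \<psi> = base X \<phi>"
  unfolding iso_def le_def by blast+

lemma pull_iso:
  assumes "iso X \<phi> \<psi>" "small N" "u \<in> N \<rightarrow> base X \<phi>"
  shows "iso X (pull N u \<phi>) (pull N u \<psi>)"
proof -
  have "le X \<phi> \<psi>" "le X \<psi> \<phi>" "u \<in> N \<rightarrow> base X \<psi>"
    using assms iso_Pred(3)[OF assms(1)] by (auto simp: iso_def)
  then show ?thesis
    unfolding iso_def using pull_mono assms(2,3) by blast
qed


section \<open>Full subfibrations\<close>

context
  fixes Q
  assumes Q: "Q \<subseteq> Pred X"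
    and Q_pull: "\<And>\<phi> N u. \<phi> \<in> Q \<Longrightarrow> small N \<Longrightarrow> u \<in> N \<rightarrow> base X \<phi> \<Longrightarrow> pull N u \<phi> \<in> Q"
begin

abbreviation "\<A> \<equiv> X\<lparr>Pred := Q\<rparr>"

text \<open>Closure of \<open>Q\<close> under \<open>pull\<close> keeps the cartesian liftings of
  \<open>X\<close> inside \<open>Q\<close>, and they remain cartesian because the subfibration has
  fewer test objects.\<close>

lemma posetal_fib_sub: "posetal_fib \<A>"
proof
  show "posetal_fibration \<A>"
    unfolding posetal_fibration_def
  proof (intro conjI ballI allI impI)
    show "small (base \<A> \<phi>)" if "\<phi> \<in> Pred \<A>" for \<phi>
      using that Q small_base by auto
    show "lift \<A> \<phi> (\<lambda>m\<in>base \<A> \<phi>. m) \<phi>" if "\<phi> \<in> Pred \<A>" for \<phi>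
      using lifts_id[of \<phi>] that Q by (auto simp: lifts_def)
  next
    fix \<phi> \<psi> \<chi> u v
    assume a: "\<phi> \<in> Pred \<A>" "\<psi> \<in> Pred \<A>" "\<chi> \<in> Pred \<A>" "u \<in> base \<A> \<phi> \<rightarrow>\<^sub>E base \<A> \<psi>"
      "v \<in> base \<A> \<psi> \<rightarrow>\<^sub>E base \<A> \<chi>" "lift \<A> \<phi> u \<psi> \<and> lift \<A> \<psi> v \<chi>"
    show "lift \<A> \<phi> (compose (base \<A> \<phi>) v u) \<chi>"
      using lift_comp[of \<phi> \<psi> \<chi> u v] a Q by auto
  next
    fix \<psi> and M :: "'u set" and u :: "'u \<Rightarrow> 'u"
    assume a: "\<psi> \<in> Pred \<A>" "small M" "u \<in> M \<rightarrow>\<^sub>E base \<A> \<psi>"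
    then have \<psi>: "\<psi> \<in> Pred X" and u: "u \<in> M \<rightarrow> base X \<psi>" "restrict u M = u"
      using Q by (auto simp: PiE_restrict)
    have c: "base X (pull M u \<psi>) = M" "cartesian X (pull M u \<psi>) u \<psi>"
      using pull_cartesian[OF \<psi> a(2) u(1)] u(2) by simp_all
    have "cartesian \<A> (pull M u \<psi>) u \<psi>"
      unfolding cartesian_def
    proof (intro conjI ballI impI)
      show "pull M u \<psi> \<in> Pred \<A>"
        using Q_pull a u by simp
      fix \<chi> v
      assume "\<chi> \<in> Pred \<A>" "v \<in> base \<A> \<chi> \<rightarrow>\<^sub>E base \<A> (pull M u \<psi>)"
        "lift \<A> \<chi> (compose (base \<A> \<chi>) u v) \<psi>"
      then show "lift \<A> \<chi> v (pull M u \<psi>)"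
        using c(2) Q unfolding cartesian_def by auto
    qed (use c(2) a in \<open>auto simp: cartesian_def\<close>)
    then show "\<exists>\<phi>. base \<A> \<phi> = M \<and> cartesian \<A> \<phi> u \<psi>"
      using c(1) by auto
  qed
qed

text \<open>The choices behind \<open>reindex\<close> in the subfibration and in \<open>X\<close>
  may differ, but they are isomorphic in \<open>X\<close> by the universal properties. Modesty can
  thus be expressed by liftings of \<open>X\<close> along functions that need not be
  extensional.\<close>

lemma modest_sub_iff:
  assumes \<mu>: "\<mu> \<in> Q" "base X \<mu> = I"
  shows "modest \<A> I \<mu> \<longleftrightarrow>
    (\<forall>J K e f \<phi>. small J \<and> small K \<and> e \<in> K \<rightarrow> J \<and> e ` K = J \<and> f \<in> K \<rightarrow> I \<and>
       \<phi> \<in> Q \<and> base X \<phi> = J \<and> lifts (pull K e \<phi>) f \<mu> \<longrightarrow>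
       (\<exists>h\<in>J \<rightarrow> I. (\<forall>x\<in>K. h (e x) = f x) \<and> lifts \<phi> h \<mu>))" (is "?l \<longleftrightarrow> ?r")
proof -
  interpret sub: posetal_fib \<A>
    by (rule posetal_fib_sub)
  have sub_lifts: "sub.lifts \<phi> u \<psi> \<longleftrightarrow> \<phi> \<in> Q \<and> \<psi> \<in> Q \<and> lifts \<phi> u \<psi>" for \<phi> u \<psi>
    using Q by (auto simp: sub.lifts_def lifts_def)
  have sub_le: "le \<A> \<phi> \<psi> \<longleftrightarrow> \<phi> \<in> Q \<and> \<psi> \<in> Q \<and> le X \<phi> \<psi>" for \<phi> \<psi>
    using Q by (auto simp: le_def)
  have pull_le: "le X (sub.pull K e \<phi>) (pull K e \<phi>) \<and> le X (pull K e \<phi>) (sub.pull K e \<phi>) \<and>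
      base X (sub.pull K e \<phi>) = K"
    if "\<phi> \<in> Q" "small K" "e \<in> K \<rightarrow> base X \<phi>" for K e \<phi>
  proof -
    have P: "\<phi> \<in> Pred X" "\<phi> \<in> Pred \<A>" and e: "e \<in> K \<rightarrow> base \<A> \<phi>"
      using that Q by auto
    have b: "base X (sub.pull K e \<phi>) = K"
      using sub.base_pull[OF P(2) that(2) e] by simp
    have "le X (sub.pull K e \<phi>) (pull K e \<phi>)"
      using sub.lifts_pull[OF P(2) that(2) e] le_pull_iff[OF P(1) that(2,3)] b
          by (simp add: sub_lifts)
    moreover have "le X (pull K e \<phi>) (sub.pull K e \<phi>)"
      using sub.le_pull_iff[OF P(2) that(2) e, of "pull K e \<phi>"] lifts_pull[OF P(1) that(2,3)]
          Q_pull[OF that] that(1)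
        base_pull[OF P(1) that(2,3)]
      by (simp add: sub_lifts sub_le)
    ultimately show ?thesis
      using b by blast
  qed
  have key: "le \<A> (sub.pull K e \<phi>) (sub.pull K f \<mu>) \<longleftrightarrow> lifts (pull K e \<phi>) f \<mu>"
    if "\<phi> \<in> Q" "small K" "e \<in> K \<rightarrow> base X \<phi>" "f \<in> K \<rightarrow> I" for K e f \<phi>
  proof -
    have \<mu>': "\<mu> \<in> Pred \<A>" "f \<in> K \<rightarrow> base \<A> \<mu>" "\<phi> \<in> Pred \<A>" "e \<in> K \<rightarrow> base \<A> \<phi>"
        "base X (sub.pull K e \<phi>) = K"
      using \<mu> that pull_le[OF that(1-3)] by auto
    have "le \<A> (sub.pull K e \<phi>) (sub.pull K f \<mu>) \<longleftrightarrow> sub.lifts (sub.pull K e \<phi>) f \<mu>"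
      using sub.le_pull_iff[OF \<mu>'(1) that(2) \<mu>'(2), of "sub.pull K e \<phi>"] \<mu>'(5) by simp
    also have "\<dots> \<longleftrightarrow> lifts (sub.pull K e \<phi>) f \<mu>"
      using sub.pull_Pred[OF \<mu>'(3) that(2) \<mu>'(4)] \<mu> by (simp add: sub_lifts)
    also have "\<dots> \<longleftrightarrow> lifts (pull K e \<phi>) f \<mu>"
      using pull_le[OF that(1-3)] lifts_le by blast
    finally show ?thesis .
  qed
  show ?thesis
  proof
    assume l: ?l
    show ?r
    proof (intro allI impI, elim conjE)
      fix J K e f \<phi>
      assume a: "small J" "small K" "e \<in> K \<rightarrow> J" "e ` K = J" "f \<in> K \<rightarrow> I"
       "\<phi> \<in> Q" "base X \<phi> = J" "lifts (pull K e \<phi>) f \<mu>"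
      let ?e = "restrict e K" and ?f = "restrict f K"
      have "reindex \<A> K ?e \<phi> = sub.pull K e \<phi>" "reindex \<A> K ?f \<mu> = sub.pull K f \<mu>"
        by (simp_all add: sub.pull_def)
      then have "le \<A> (reindex \<A> K ?e \<phi>) (reindex \<A> K ?f \<mu>)"
        using key[of \<phi> K e f] a by simp
      moreover have "surjection K J ?e" "?f \<in> K \<rightarrow>\<^sub>E I" "\<phi> \<in> fiber \<A> J"
        using a by (auto simp: surjection_def fiber_def)
      ultimately obtain h where h: "h \<in> J \<rightarrow>\<^sub>E I" "compose K h ?e = ?f" "le \<A> \<phi> (reindex \<A> J h \<mu>)"
        using l a unfolding modest_def by meson
      have h': "h \<in> J \<rightarrow> base \<A> \<mu>"
        using h \<mu> by auto
      have "le \<A> \<phi> (sub.pull J h \<mu>)"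
        using h(3) sub.reindex_eq_pull[OF h(1)] by simp
      then have "sub.lifts \<phi> h \<mu>"
        using sub.le_pull_iff[OF _ a(1) h', of \<phi>] \<mu> a by simp
      moreover have "h (e x) = f x" if "x \<in> K" for x
        using fun_cong[OF h(2), of x] that by (simp add: compose_def)
      ultimately show "\<exists>h\<in>J \<rightarrow> I. (\<forall>x\<in>K. h (e x) = f x) \<and> lifts \<phi> h \<mu>"
        using h(1) by (auto simp: sub_lifts)
    qed
  next
    assume r: ?r
    show ?l
      unfolding modest_def
    proof (intro allI impI ballI, elim conjE)
      fix J K e f \<phi>
      assume a: "\<phi> \<in> fiber \<A> J" "le \<A> (reindex \<A> K e \<phi>) (reindex \<A> K f \<mu>)" "small J" "small K"
        "surjection K J e" "f \<in> K \<rightarrow>\<^sub>E I"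
      have a': "e \<in> K \<rightarrow>\<^sub>E J" "e ` K = J" "\<phi> \<in> Q" "base X \<phi> = J"
        using a by (auto simp: surjection_def fiber_def)
      have "le \<A> (sub.pull K e \<phi>) (sub.pull K f \<mu>)"
        using a(2) sub.reindex_eq_pull[OF a'(1)] sub.reindex_eq_pull[OF a(6)] by simp
      moreover have "e \<in> K \<rightarrow> J" "f \<in> K \<rightarrow> I"
        using a' a by auto
      ultimately have "lifts (pull K e \<phi>) f \<mu>" "e \<in> K \<rightarrow> J" "f \<in> K \<rightarrow> I"
        using key[of \<phi> K e f] a a' by simp_all
      with r[rule_format, of J K e f \<phi>] a(3,4) a'(2,3,4)
      have "\<exists>h\<in>J \<rightarrow> I. (\<forall>x\<in>K. h (e x) = f x) \<and> lifts \<phi> h \<mu>"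
        by (simp only: simp_thms)
      then obtain h where h: "h \<in> J \<rightarrow> I" "\<forall>x\<in>K. h (e x) = f x" "lifts \<phi> h \<mu>"
        by (elim bexE conjE)
      let ?h = "restrict h J"
      have "compose K ?h e = f"
        using h(2) a' a(6) by (auto simp: compose_def fun_eq_iff PiE_def extensional_def)
      moreover have "le \<A> \<phi> (sub.pull J h \<mu>)"
        using sub.le_pull_iff[OF _ a(3), of \<mu> h \<phi>] h \<mu> a' by (simp add: sub_lifts)
      ultimately show "\<exists>h\<in>J \<rightarrow>\<^sub>E I. compose K h e = f \<and> le \<A> \<phi> (reindex \<A> J h \<mu>)"
        using h(1) by (intro bexI[of _ ?h]) (auto simp: sub.pull_def)
    qed
  qed
qed

end

section \<open>The subfibration generated by a family of predicates\<close>

lemma generated_subfibration_eq: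
  "generated_subfibration X I A \<pi> = X\<lparr>Pred := Pred (generated_subfibration X I A \<pi>)\<rparr>"
  by (simp add: generated_subfibration_def)

lemma generated_iff:
  "\<phi> \<in> Pred (generated_subfibration X I A \<pi>) \<longleftrightarrow>
    \<phi> \<in> Pred X \<and> (\<exists>i\<in>I. \<exists>f\<in>base X \<phi> \<rightarrow> A i. iso X \<phi> (pull (base X \<phi>) f (\<pi> i)))" (is "?l \<longleftrightarrow> ?r")
proof
  assume ?l
  then obtain i f where *: "\<phi> \<in> Pred X" "i \<in> I" "f \<in> base X \<phi> \<rightarrow>\<^sub>E A i"
      "iso X \<phi> (reindex X (base X \<phi>) f (\<pi> i))"
    unfolding generated_subfibration_def by auto
  have "f \<in> base X \<phi> \<rightarrow> A i"
    using *(3) by auto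
  then show ?r
    using * reindex_eq_pull[OF *(3)] by auto
next
  assume ?r
  then obtain i f where *: "\<phi> \<in> Pred X" "i \<in> I" "f \<in> base X \<phi> \<rightarrow> A i"
      "iso X \<phi> (pull (base X \<phi>) f (\<pi> i))"
    by blast
  have "restrict f (base X \<phi>) \<in> base X \<phi> \<rightarrow>\<^sub>E A i"
    using * by auto
  moreover have "iso X \<phi> (reindex X (base X \<phi>) (restrict f (base X \<phi>)) (\<pi> i))"
    using * by (simp add: pull_def)
  ultimately show ?l
    using *(1,2) unfolding generated_subfibration_def by fastforce
qed

lemma generated_pull:
  assumes \<pi>: "\<And>i. i \<in> I \<Longrightarrow> \<pi> i \<in> fiber X (A i)"
    and \<phi>: "\<phi> \<in> Pred (generated_subfibration X I A \<pi>)" and N: "small N" and u: "u \<in> N \<rightarrow> base X \<phi>"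
  shows "pull N u \<phi> \<in> Pred (generated_subfibration X I A \<pi>)"
proof -
  obtain i f where *: "\<phi> \<in> Pred X" "i \<in> I" "f \<in> base X \<phi> \<rightarrow> A i" "iso X \<phi> (pull (base X \<phi>) f (\<pi> i))"
    using \<phi> unfolding generated_iff by blast
  have i: "\<pi> i \<in> Pred X" "f \<in> base X \<phi> \<rightarrow> base X (\<pi> i)"
    using \<pi> * by (auto simp: fiber_def)
  have "iso X (pull N u \<phi>) (pull N (\<lambda>x. f (u x)) (\<pi> i))"
    using iso_trans[OF pull_iso[OF *(4) N u] pull_pull[OF i(1) small_base[OF *(1)] i(2) N u]] .
  moreover have "(\<lambda>x. f (u x)) \<in> N \<rightarrow> A i"
    using u * by auto
  ultimately show ?thesis
    unfolding generated_iff using pull_Pred[OF *(1) N u] base_pull[OF *(1) N u] *(2) by auto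
qed

lemma generated_atom:
  assumes "\<pi> i \<in> fiber X (A i)" "i \<in> I" "small N" "f \<in> N \<rightarrow> A i"
  shows "pull N f (\<pi> i) \<in> Pred (generated_subfibration X I A \<pi>)"
proof -
  have i: "\<pi> i \<in> Pred X" "f \<in> N \<rightarrow> base X (\<pi> i)"
    using assms by (auto simp: fiber_def)
  have "iso X (pull N f (\<pi> i)) (pull N f (\<pi> i))"
    using le_refl[OF pull_Pred[OF i(1) assms(3) i(2)]] by (simp add: iso_def)
  then show ?thesis
    unfolding generated_iff using pull_Pred[OF i(1) assms(3) i(2)] base_pull[OF i(1) assms(3)
        i(2)] assms by auto
qed

end

section \<open>Fibrations of realizability predicates\<close>

text \<open>Equivalence with the hyperdoctrine in elementary form: the first two assumptions make
  \<open>\<phi> \<mapsto> (ty \<phi>, ex \<phi>)\<close> well typed, full and faithful, the third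
  makes it essentially surjective.\<close>

locale realized = posetal_fib X + pca_inclusion P S
  for X :: "('u, 'x) fibration" and P :: "'u typed_pca" and S +
  fixes ty :: "'x \<Rightarrow> 'u" and ex :: "'x \<Rightarrow> 'u \<Rightarrow> 'u set"
  assumes val_ex: "\<phi> \<in> Pred X \<Longrightarrow> val (base X \<phi>) (ty \<phi>) (ex \<phi>)"
    and lifts_iff_rl: "\<phi> \<in> Pred X \<Longrightarrow> \<psi> \<in> Pred X \<Longrightarrow> u \<in> base X \<phi> \<rightarrow> base X \<psi> \<Longrightarrow>
      lifts \<phi> u \<psi> \<longleftrightarrow> rl (base X \<phi>) (ty \<phi>) (ex \<phi>) (ty \<psi>) (\<lambda>m. ex \<psi> (u m))"
    and realize: "small M \<Longrightarrow> val M i f \<Longrightarrow> \<exists>\<phi>\<in>Pred X. base X \<phi> = M \<and>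
      rl M (ty \<phi>) (ex \<phi>) i f \<and> rl M i f (ty \<phi>) (ex \<phi>)"
begin

lemma iso_if_below_iff:
  assumes "\<sigma> \<in> fiber X M" "\<chi> \<in> fiber X M"
    and "\<forall>\<theta>\<in>fiber X M. le X \<theta> \<sigma> \<longleftrightarrow> B \<theta>" "\<forall>\<theta>\<in>fiber X M. le X \<theta> \<chi> \<longleftrightarrow> B \<theta>"
  shows "iso X \<sigma> \<chi>"
  using assms(3)[rule_format, of \<sigma>] assms(3)[rule_format, of \<chi>] assms(4)[rule_format, of \<sigma>]
    assms(4)[rule_format, of \<chi>] assms(1,2) le_refl[of \<sigma>] le_refl[of \<chi>]
  by (auto simp: iso_def fiber_def)

lemma iso_if_above_iff:
  assumes "\<sigma> \<in> fiber X M" "\<chi> \<in> fiber X M"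
    and "\<forall>\<theta>\<in>fiber X M. le X \<sigma> \<theta> \<longleftrightarrow> B \<theta>" "\<forall>\<theta>\<in>fiber X M. le X \<chi> \<theta> \<longleftrightarrow> B \<theta>"
  shows "iso X \<sigma> \<chi>"
  using assms(3)[rule_format, of \<sigma>] assms(3)[rule_format, of \<chi>] assms(4)[rule_format, of \<sigma>]
    assms(4)[rule_format, of \<chi>] assms(1,2) le_refl[of \<sigma>] le_refl[of \<chi>]
  by (auto simp: iso_def fiber_def)

text \<open>Families computed from others, such as \<open>meetv\<close>, agree with the assigned
  \<open>ex \<phi>\<close> only up to realizers in both directions. Working with every family
  equivalent to \<open>ex \<phi>\<close> avoids comparing the two each time.\<close>

definition rep :: "'x \<Rightarrow> 'u \<Rightarrow> ('u \<Rightarrow> 'u set) \<Rightarrow> bool" where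
  "rep \<phi> i f \<longleftrightarrow> \<phi> \<in> Pred X \<and> val (base X \<phi>) i f \<and>
     rl (base X \<phi>) (ty \<phi>) (ex \<phi>) i f \<and> rl (base X \<phi>) i f (ty \<phi>) (ex \<phi>)"

lemma repD: "rep \<phi> i f \<Longrightarrow> \<phi> \<in> Pred X" "rep \<phi> i f \<Longrightarrow> val (base X \<phi>) i f" "rep \<phi> i f \<Longrightarrow> i \<in> T"
  by (auto simp: rep_def val_def)

lemma rep_self: "\<phi> \<in> Pred X \<Longrightarrow> rep \<phi> (ty \<phi>) (ex \<phi>)"
  by (simp add: rep_def val_ex rl_refl)

lemma rep_ex:
  assumes "small M" "val M i f"
  obtains \<phi> where "rep \<phi> i f" "base X \<phi> = M"
  using realize[OF assms] assms(2) unfolding rep_def by blast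

lemma rep_cong:
  assumes "\<And>m. m \<in> base X \<phi> \<Longrightarrow> f m = g m"
  shows "rep \<phi> i f \<longleftrightarrow> rep \<phi> i g"
proof -
  have "val (base X \<phi>) i f \<longleftrightarrow> val (base X \<phi>) i g"
    using assms by (auto simp: val_def Pi_iff)
  then show ?thesis
    using assms rl_cong[of "base X \<phi>" "ex \<phi>" "ex \<phi>" f g] rl_cong[of "base X \<phi>" f g "ex \<phi>" "ex \<phi>"]
    by (simp add: rep_def)
qed

text \<open>The conversions between the representing families, at \<phi> and reindexed along
  \<open>u\<close> at \<psi>, are composed with a given realizer on either side.\<close>

lemma rep_lifts_iff:
  assumes f: "rep \<phi> i f" and g: "rep \<psi> j g" and u: "u \<in> base X \<phi> \<rightarrow> base X \<psi>"
  shows "lifts \<phi> u \<psi> \<longleftrightarrow> rl (base X \<phi>) i f j (\<lambda>m. g (u m))"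
proof -
  let ?M = "base X \<phi>"
  have v: "val ?M i f" "val ?M j (\<lambda>m. g (u m))" "val ?M (ty \<phi>) (ex \<phi>)"
      "val ?M (ty \<psi>) (\<lambda>m. ex \<psi> (u m))"
    using f g val_ex val_subst[OF _ u] by (auto simp: rep_def)
  then have T: "i \<in> T" "j \<in> T" "ty \<phi> \<in> T" "ty \<psi> \<in> T"
    by (auto simp: val_def)
  have r: "rl ?M (ty \<phi>) (ex \<phi>) i f" "rl ?M i f (ty \<phi>) (ex \<phi>)"
    "rl ?M (ty \<psi>) (\<lambda>m. ex \<psi> (u m)) j (\<lambda>m. g (u m))" "rl ?M j (\<lambda>m. g (u m)) (ty \<psi>) (\<lambda>m. ex \<psi> (u m))"
    using f g rl_subst[OF _ u] by (auto simp: rep_def)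
  have "lifts \<phi> u \<psi> \<longleftrightarrow> rl ?M (ty \<phi>) (ex \<phi>) (ty \<psi>) (\<lambda>m. ex \<psi> (u m))"
    using lifts_iff_rl repD f g u by blast
  also have "\<dots> \<longleftrightarrow> rl ?M i f j (\<lambda>m. g (u m))"
  proof
    assume "rl ?M (ty \<phi>) (ex \<phi>) (ty \<psi>) (\<lambda>m. ex \<psi> (u m))"
    from rl_trans[OF v(1) T(3,4) r(2) this] show "rl ?M i f j (\<lambda>m. g (u m))"
      by (rule rl_trans[OF v(1) T(4,2) _ r(3)])
  next
    assume "rl ?M i f j (\<lambda>m. g (u m))"
    from rl_trans[OF v(3) T(1,2) r(1) this] show "rl ?M (ty \<phi>) (ex \<phi>) (ty \<psi>) (\<lambda>m. ex \<psi> (u m))"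
      by (rule rl_trans[OF v(3) T(2,4) _ r(4)])
  qed
  finally show ?thesis .
qed

lemma rep_le_iff:
  assumes "rep \<phi> i f" "rep \<psi> j g" "base X \<phi> = base X \<psi>"
  shows "le X \<phi> \<psi> \<longleftrightarrow> rl (base X \<phi>) i f j g"
  using rep_lifts_iff[OF assms(1,2), of "\<lambda>x. x"] assms(3) by (simp add: le_iff_lifts)

lemma rep_unique:
  assumes "rep \<phi> i f" "rep \<psi> i f" "base X \<phi> = base X \<psi>"
  shows "iso X \<phi> \<psi>"
  using rep_le_iff[OF assms] rep_le_iff[OF assms(2,1) assms(3)[symmetric]] repD(2)[OF assms(1)]
    repD(2)[OF assms(2)] rl_refl by (simp add: iso_def)

lemma rep_iso:
  assumes f: "rep \<phi> i f" and "iso X \<phi> \<psi>"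
  shows "rep \<psi> i f"
proof -
  have b: "base X \<psi> = base X \<phi>" and \<psi>: "\<psi> \<in> Pred X" and le: "le X \<phi> \<psi>" "le X \<psi> \<phi>"
    using iso_Pred[OF assms(2)] assms(2) by (simp_all add: iso_def)
  show ?thesis
    using rep_le_iff[OF f rep_self[OF \<psi>] b[symmetric]] rep_le_iff[OF rep_self[OF \<psi>] f b] le
        repD[OF f] \<psi> b
    by (simp add: rep_def)
qed

text \<open>A family determines its predicate up to isomorphism. Hence each connective below is
  settled as soon as predicates representing the computed family have the universal property: any
  other solution is isomorphic to such a predicate.\<close>

lemma rep_iff_iso:
  assumes "rep \<phi> i f"
  shows "rep \<psi> i f \<and> base X \<psi> = base X \<phi> \<longleftrightarrow> iso X \<phi> \<psi>"
  using rep_iso[OF assms] rep_unique[OF assms] iso_Pred(3) by metis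

text \<open>Some predicate over \<open>N\<close> represents the reindexed family, by
  \<open>realize\<close>. The universal property of the chosen lifting puts it below
  \<open>pull N u \<psi>\<close>, and the realizer for the lifting \<open>u\<close> gives the
  reverse inequality.\<close>

lemma rep_pull:
  assumes f: "rep \<psi> i f" and N: "small N" and u: "u \<in> N \<rightarrow> base X \<psi>"
  shows "rep (pull N u \<psi>) i (\<lambda>n. f (u n))"
proof -
  note \<psi> = repD(1)[OF f]
  obtain \<phi> where \<phi>: "rep \<phi> i (\<lambda>n. f (u n))" "base X \<phi> = N"
    using rep_ex[OF N val_subst[OF repD(2)[OF f] u]] by blast
  have b: "base X (pull N u \<psi>) = N" and r: "pull N u \<psi> \<in> Pred X"
    using base_pull[OF \<psi> N u] pull_Pred[OF \<psi> N u] by simp_all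
  have "lifts \<phi> u \<psi>"
    using rep_lifts_iff[OF \<phi>(1) f, of u] u \<phi>(2) rl_refl repD(2)[OF \<phi>(1)] by simp
  then have 1: "le X \<phi> (pull N u \<psi>)"
    using le_pull_iff[OF \<psi> N u \<phi>(2)] by simp
  have "rl N (ty (pull N u \<psi>)) (ex (pull N u \<psi>)) i (\<lambda>n. f (u n))"
    using rep_lifts_iff[OF rep_self[OF r] f, of u] lifts_pull[OF \<psi> N u] u b by simp
  then have "le X (pull N u \<psi>) \<phi>"
    using rep_le_iff[OF rep_self[OF r] \<phi>(1)] b \<phi>(2) by simp
  with 1 show ?thesis
    using rep_iso[OF \<phi>(1)] by (simp add: iso_def)
qed

lemma is_top_iff:
  assumes M: "small M"
  shows "is_top X M \<tau> \<longleftrightarrow> base X \<tau> = M \<and> rep \<tau> unit_type (\<lambda>_. {unit_elem})"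
proof -
  have v: "val M unit_type (\<lambda>_. {unit_elem})"
    using unit_type unit_elem S_C by (auto simp: val_def)
  obtain \<sigma> where \<sigma>: "rep \<sigma> unit_type (\<lambda>_. {unit_elem})" "base X \<sigma> = M"
    using rep_ex[OF M v] by blast
  have top: "is_top X M \<tau>" if \<tau>: "rep \<tau> unit_type (\<lambda>_. {unit_elem})" "base X \<tau> = M" for \<tau>
  proof -
    have "le X \<phi> \<tau>" if "\<phi> \<in> fiber X M" for \<phi>
    proof -
      have \<phi>: "\<phi> \<in> Pred X" "base X \<phi> = base X \<tau>"
        using that \<tau> by (auto simp: fiber_def)
      have "rl (base X \<phi>) (ty \<phi>) (ex \<phi>) unit_type (\<lambda>_. {unit_elem})"
        by (rule rl_const[OF val_ex[OF \<phi>(1)] unit_type unit_elem]) simp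
      then show ?thesis
        using rep_le_iff[OF rep_self[OF \<phi>(1)] \<tau>(1) \<phi>(2)] by simp
    qed
    then show ?thesis
      using \<tau> repD(1) by (auto simp: is_top_def fiber_def)
  qed
  have "iso X \<sigma> \<tau>" if "is_top X M \<tau>"
    using that top[OF \<sigma>] by (simp add: is_top_def iso_def)
  then show ?thesis
    using top rep_iff_iso[OF \<sigma>(1)] \<sigma>(2) by metis
qed

lemma is_meet_iff:
  assumes f: "rep \<phi> i f" and g: "rep \<psi> j g" and b: "base X \<phi> = base X \<psi>"
  shows "is_meet X \<phi> \<psi> \<chi> \<longleftrightarrow> base X \<chi> = base X \<phi> \<and> rep \<chi> (i \<otimes> j) (meetv i j f g)"
proof -
  let ?M = "base X \<phi>"
  note \<phi> = repD[OF f] and \<psi> = repD[OF g]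
  have vg: "val ?M j g"
    using \<psi>(2) b by simp
  obtain \<sigma> where \<sigma>: "rep \<sigma> (i \<otimes> j) (meetv i j f g)" "base X \<sigma> = ?M"
    using rep_ex[OF small_base[OF \<phi>(1)] val_meetv[OF \<phi>(2) vg]] by blast
  have meet: "is_meet X \<phi> \<psi> \<chi>" if \<chi>: "rep \<chi> (i \<otimes> j) (meetv i j f g)" "base X \<chi> = ?M" for \<chi>
    unfolding is_meet_def
  proof (intro conjI allI impI)
    show "le X \<chi> \<phi>"
      using rep_le_iff[OF \<chi>(1) f \<chi>(2)] rl_fst[OF \<phi>(2) vg] \<chi>(2) by simp
    have b': "base X \<chi> = base X \<psi>"
      using \<chi>(2) b by simp
    show "le X \<chi> \<psi>"
      using rep_le_iff[OF \<chi>(1) g b'] rl_snd[OF \<phi>(2) vg] \<chi>(2) by simp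
    fix \<theta> assume \<theta>: "le X \<theta> \<phi> \<and> le X \<theta> \<psi>"
    then have *: "\<theta> \<in> Pred X" "base X \<theta> = ?M" "base X \<theta> = base X \<psi>" "base X \<theta> = base X \<chi>"
      using \<chi>(2) unfolding le_def by metis+
    have "rl ?M (ty \<theta>) (ex \<theta>) i f" "rl ?M (ty \<theta>) (ex \<theta>) j g" "val ?M (ty \<theta>) (ex \<theta>)"
      using rep_le_iff[OF rep_self[OF *(1)] f *(2)] rep_le_iff[OF rep_self[OF *(1)] g *(3)] \<theta>
          val_ex[OF *(1)] *(2)
      by simp_all
    then have "rl ?M (ty \<theta>) (ex \<theta>) (i \<otimes> j) (meetv i j f g)"
      using rl_meetv \<phi>(3) \<psi>(3) by blast
    then show "le X \<theta> \<chi>"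
      using rep_le_iff[OF rep_self[OF *(1)] \<chi>(1) *(4)] *(2) by simp
  qed
  have "iso X \<sigma> \<chi>" if "is_meet X \<phi> \<psi> \<chi>"
    using that meet[OF \<sigma>] unfolding is_meet_def iso_def by blast
  then show ?thesis
    using meet rep_iff_iso[OF \<sigma>(1)] \<sigma>(2) by metis
qed

lemma is_imp_iff:
  assumes f: "rep \<phi> i f" and g: "rep \<psi> j g" and b: "base X \<phi> = base X \<psi>"
  shows "is_imp X \<phi> \<psi> \<chi> \<longleftrightarrow> base X \<chi> = base X \<phi> \<and> rep \<chi> (i ~> j) (impv i j f g)"
proof -
  let ?M = "base X \<phi>"
  note \<phi> = repD[OF f] and \<psi> = repD[OF g]
  obtain \<sigma> where \<sigma>: "rep \<sigma> (i ~> j) (impv i j f g)" "base X \<sigma> = ?M"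
    using rep_ex[OF small_base[OF \<phi>(1)] val_impv[OF \<phi>(3) \<psi>(3)]] by blast
  \<comment> \<open>Meets exist and are represented by \<open>meetv\<close>, so the existential of
    \<open>is_imp\<close> becomes one realizability statement, to which the adjunction of
    \<open>meetv\<close> and \<open>impv\<close> applies.\<close>
  have key: "(\<exists>\<mu>. is_meet X \<theta> \<phi> \<mu> \<and> le X \<mu> \<psi>) \<longleftrightarrow> rl ?M (ty \<theta>) (ex \<theta>) (i ~> j) (impv i j f g)"
    if \<theta>: "\<theta> \<in> Pred X" "base X \<theta> = ?M" for \<theta>
  proof -
    have v: "val ?M (ty \<theta>) (ex \<theta>)"
      using val_ex[OF \<theta>(1)] \<theta>(2) by simp
    note m = is_meet_iff[OF rep_self[OF \<theta>(1)] f \<theta>(2)]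
    have "le X \<mu> \<psi> \<longleftrightarrow> rl ?M (ty \<theta> \<otimes> i) (meetv (ty \<theta>) i (ex \<theta>) f) j g" if "is_meet X \<theta> \<phi> \<mu>" for \<mu>
      using that m rep_le_iff[OF _ g, of \<mu> "ty \<theta> \<otimes> i" "meetv (ty \<theta>) i (ex \<theta>) f"] b \<theta>(2) by simp
    moreover obtain \<mu> where "is_meet X \<theta> \<phi> \<mu>"
      using rep_ex[OF small_base[OF \<phi>(1)] val_meetv[OF v \<phi>(2)]] m \<theta>(2) by metis
    ultimately have "(\<exists>\<mu>. is_meet X \<theta> \<phi> \<mu> \<and> le X \<mu> \<psi>) \<longleftrightarrow>
        rl ?M (ty \<theta> \<otimes> i) (meetv (ty \<theta>) i (ex \<theta>) f) j g"
      by blast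
    also have "\<dots> \<longleftrightarrow> rl ?M (ty \<theta>) (ex \<theta>) (i ~> j) (impv i j f g)"
      using rl_meetv_impv_iff[OF v \<phi>(2) \<psi>(3)] by simp
    finally show ?thesis .
  qed
  have imp: "is_imp X \<phi> \<psi> \<chi>" if \<chi>: "rep \<chi> (i ~> j) (impv i j f g)" "base X \<chi> = ?M" for \<chi>
  proof -
    have "le X \<theta> \<chi> \<longleftrightarrow> (\<exists>\<mu>. is_meet X \<theta> \<phi> \<mu> \<and> le X \<mu> \<psi>)" if "\<theta> \<in> fiber X ?M" for \<theta>
    proof -
      have \<theta>: "\<theta> \<in> Pred X" "base X \<theta> = ?M" "base X \<theta> = base X \<chi>"
        using that \<chi>(2) by (simp_all add: fiber_def)
      show ?thesis
        using rep_le_iff[OF rep_self[OF \<theta>(1)] \<chi>(1) \<theta>(3)] key[OF \<theta>(1,2)] \<theta>(2) by simp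
    qed
    then show ?thesis
      using repD(1)[OF \<chi>(1)] \<chi>(2) by (simp add: is_imp_def fiber_def)
  qed
  have "iso X \<sigma> \<chi>" if "is_imp X \<phi> \<psi> \<chi>"
    using that imp[OF \<sigma>] unfolding is_imp_def
    by (elim conjE) (rule iso_if_below_iff, assumption+)
  then show ?thesis
    using imp rep_iff_iso[OF \<sigma>(1)] \<sigma>(2) by metis
qed

definition exv :: "'u set \<Rightarrow> ('u \<Rightarrow> 'u) \<Rightarrow> ('u \<Rightarrow> 'u set) \<Rightarrow> 'u \<Rightarrow> 'u set" where
  "exv N u f m = (\<Union>n\<in>{n\<in>N. u n = m}. f n)"

text \<open>The unit type delays the evaluation: without it, quantification along a map that is not
  surjective would ask for realizers over points without preimage.\<close>

definition allv :: "'u set \<Rightarrow> ('u \<Rightarrow> 'u) \<Rightarrow> 'u \<Rightarrow> ('u \<Rightarrow> 'u set) \<Rightarrow> 'u \<Rightarrow> 'u set" where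
  "allv N u i f m = {a \<in> C (unit_type ~> i). \<forall>n\<in>N. u n = m \<longrightarrow>
    (\<exists>b\<in>f n. app P unit_type i a unit_elem = Some b)}"

lemma is_ex_iff:
  assumes M: "small M" and u: "u \<in> base X \<phi> \<rightarrow> M" and f: "rep \<phi> i f"
  shows "is_ex X (base X \<phi>) M (restrict u (base X \<phi>)) \<phi> \<chi> \<longleftrightarrow> base X \<chi> = M \<and>
      rep \<chi> i (exv (base X \<phi>) u f)"
proof -
  let ?N = "base X \<phi>"
  note \<phi> = repD[OF f]
  have v: "val M i (exv ?N u f)"
    using \<phi>(2) unfolding val_def exv_def by blast
  obtain \<sigma> where \<sigma>: "rep \<sigma> i (exv ?N u f)" "base X \<sigma> = M"
    using rep_ex[OF M v] by blast
  have ex: "is_ex X ?N M (restrict u ?N) \<phi> \<chi>" if \<chi>: "rep \<chi> i (exv ?N u f)" "base X \<chi> = M" for \<chi>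
  proof -
    have "le X \<chi> \<psi> \<longleftrightarrow> le X \<phi> (reindex X ?N (restrict u ?N) \<psi>)" if "\<psi> \<in> fiber X M" for \<psi>
    proof -
      have \<psi>: "\<psi> \<in> Pred X" "base X \<chi> = base X \<psi>" and u': "u \<in> ?N \<rightarrow> base X \<psi>"
        using that \<chi>(2) u by (auto simp: fiber_def)
      have "le X \<chi> \<psi> \<longleftrightarrow> rl M i (exv ?N u f) (ty \<psi>) (ex \<psi>)"
        using rep_le_iff[OF \<chi>(1) rep_self[OF \<psi>(1)] \<psi>(2)] \<chi>(2) by simp
      \<comment> \<open>The same realizer serves on both sides: a realizer in \<open>exv\<close> at
        \<open>m\<close> is a realizer in \<open>f n\<close> for some \<open>n\<close> over
        \<open>m\<close>.\<close>
      also have "\<dots> \<longleftrightarrow> rl ?N i f (ty \<psi>) (\<lambda>n. ex \<psi> (u n))"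
        unfolding rl_def exv_def using u by (intro bex_cong refl) blast
      also have "\<dots> \<longleftrightarrow> lifts \<phi> u \<psi>"
        using rep_lifts_iff[OF f rep_self[OF \<psi>(1)] u'] by simp
      also have "\<dots> \<longleftrightarrow> le X \<phi> (pull ?N u \<psi>)"
        using le_pull_iff[OF \<psi>(1) small_base[OF \<phi>(1)] u', of \<phi>] by simp
      finally show ?thesis
        by (simp add: pull_def)
    qed
    then show ?thesis
      using repD(1)[OF \<chi>(1)] \<chi>(2) by (simp add: is_ex_def fiber_def)
  qed
  have "iso X \<sigma> \<chi>" if "is_ex X ?N M (restrict u ?N) \<phi> \<chi>"
    using that ex[OF \<sigma>] unfolding is_ex_def
    by (elim conjE) (rule iso_if_above_iff, assumption+)
  then show ?thesis
    using ex rep_iff_iso[OF \<sigma>(1)] \<sigma>(2) by metis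
qed

text \<open>Given \<open>e\<close> over \<open>N\<close>, the composite of \<open>e\<close> with the
  first projection is curried in its unit argument. The result is defined on all of
  \<open>C j\<close>, also over points without preimage where \<open>e\<close> may be undefined.
  Conversely, applying to \<open>unit_elem\<close> forces the delayed value.\<close>

lemma rl_allv:
  assumes u: "u \<in> N \<rightarrow> M" and v: "val M j g" and f: "val N i f"
  shows "rl M j g (unit_type ~> i) (allv N u i f) \<longleftrightarrow> rl N j (\<lambda>n. g (u n)) i f"
proof
  have T: "j \<in> T" "i \<in> T"
    using v f by (simp_all add: val_def)
  assume "rl N j (\<lambda>n. g (u n)) i f"
  then obtain e where e: "e \<in> S (j ~> i)" "\<forall>n\<in>N. \<forall>a\<in>g (u n). \<exists>b\<in>f n. app P j i e a = Some b"
    unfolding rl_def by blast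
  obtain p where p: "p \<in> S (j \<otimes> unit_type ~> j)"
    "\<forall>a\<in>C j. \<forall>b\<in>C unit_type. app P (j \<otimes> unit_type) j p (tup j unit_type a b) = Some a"
    using fst_S[OF T(1) unit_type] by blast
  obtain c where c: "c \<in> S (j \<otimes> unit_type ~> i)"
    "\<forall>a\<in>C (j \<otimes> unit_type). \<forall>b c'. app P (j \<otimes> unit_type) j p a = Some b \<longrightarrow> app P j i e b = Some c' \<longrightarrow>
      app P (j \<otimes> unit_type) i c a = Some c'"
    using comp_S[OF times_T[OF T(1) unit_type] T p(1) e(1)] by blast
  obtain q where q: "q \<in> S (j ~> unit_type ~> i)"
    "\<forall>a\<in>C j. \<exists>h. app P j (unit_type ~> i) q a = Some h \<and>
      (\<forall>b\<in>C unit_type. \<forall>c'. app P (j \<otimes> unit_type) i c (tup j unit_type a b) = Some c' \<longrightarrow>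
        app P unit_type i h b = Some c')"
    using curry_S[OF T(1) unit_type T(2) c(1)] by blast
  have uC: "unit_elem \<in> C unit_type"
    using S_C unit_type unit_elem by blast
  show "rl M j g (unit_type ~> i) (allv N u i f)"
    unfolding rl_def
  proof (intro bexI[OF _ q(1)] ballI)
    fix m a assume m: "m \<in> M" "a \<in> g m"
    have a: "a \<in> C j"
      using m v by (auto simp: val_def)
    then obtain h where h: "app P j (unit_type ~> i) q a = Some h"
      "\<forall>b\<in>C unit_type. \<forall>c'. app P (j \<otimes> unit_type) i c (tup j unit_type a b) = Some c' \<longrightarrow>
        app P unit_type i h b = Some c'"
      using q(2) by blast
    have "h \<in> C (unit_type ~> i)"
      using app_C[OF T(1) _ S_C[OF _ q(1)] a h(1)] T unit_type by simp
    moreover have "\<exists>b\<in>f n. app P unit_type i h unit_elem = Some b" if n: "n \<in> N" "u n = m" for n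
    proof -
      obtain b where b: "b \<in> f n" "app P j i e a = Some b"
        using e(2) n m by blast
      have "app P (j \<otimes> unit_type) i c (tup j unit_type a unit_elem) = Some b"
        using c(2) tup_C[OF T(1) unit_type a uC] p(2) a uC b(2) by blast
      then show ?thesis
        using h(2) uC b(1) by blast
    qed
    ultimately have "h \<in> allv N u i f m"
      by (simp add: allv_def)
    then show "\<exists>b\<in>allv N u i f m. app P j (unit_type ~> i) q a = Some b"
      using h(1) by blast
  qed
next
  have T: "j \<in> T" "i \<in> T" "unit_type ~> i \<in> T"
    using v f unit_type by (simp_all add: val_def)
  assume "rl M j g (unit_type ~> i) (allv N u i f)"
  then have 1: "rl N j (\<lambda>n. g (u n)) (unit_type ~> i) (\<lambda>n. allv N u i f (u n))"
    by (rule rl_subst[OF _ u])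
  have v': "val N (unit_type ~> i) (\<lambda>n. allv N u i f (u n))"
    using T by (auto simp: val_def allv_def)
  have w: "val N unit_type (\<lambda>_. {unit_elem})"
    using S_C[OF unit_type unit_elem] unit_type by (auto simp: val_def)
  have "rl N (unit_type ~> i) (\<lambda>n. allv N u i f (u n)) (unit_type ~> i) (impv unit_type i (\<lambda>_.
      {unit_elem}) f)"
    by (rule rl_mono[OF v']) (auto simp: allv_def impv_def)
  then have "rl N ((unit_type ~> i) \<otimes> unit_type) (meetv (unit_type ~> i) unit_type (\<lambda>n. allv N u i
      f (u n)) (\<lambda>_. {unit_elem})) i f"
    using rl_meetv_impv_iff[OF v' w T(2)] by simp
  moreover have "rl N (unit_type ~> i) (\<lambda>n. allv N u i f (u n)) ((unit_type ~> i) \<otimes> unit_type)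
      (meetv (unit_type ~> i) unit_type (\<lambda>n. allv N u i f (u n)) (\<lambda>_. {unit_elem}))"
    by (rule rl_meetv[OF v' T(3) unit_type rl_refl[OF v'] rl_const[OF v' unit_type unit_elem]]) simp
  ultimately have "rl N (unit_type ~> i) (\<lambda>n. allv N u i f (u n)) i f"
    using rl_trans[OF v' _ T(2)] T(3) unit_type times_T by blast
  then show "rl N j (\<lambda>n. g (u n)) i f"
    using rl_trans[OF val_subst[OF v u] T(3,2) 1] by blast
qed

lemma is_all_iff:
  assumes M: "small M" and u: "u \<in> base X \<phi> \<rightarrow> M" and f: "rep \<phi> i f"
  shows "is_all X (base X \<phi>) M (restrict u (base X \<phi>)) \<phi> \<chi> \<longleftrightarrow>
    base X \<chi> = M \<and> rep \<chi> (unit_type ~> i) (allv (base X \<phi>) u i f)"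
proof -
  let ?N = "base X \<phi>"
  note \<phi> = repD[OF f]
  have v: "val M (unit_type ~> i) (allv ?N u i f)"
    using \<phi>(3) unit_type by (auto simp: val_def allv_def)
  obtain \<sigma> where \<sigma>: "rep \<sigma> (unit_type ~> i) (allv ?N u i f)" "base X \<sigma> = M"
    using rep_ex[OF M v] by blast
  have all: "is_all X ?N M (restrict u ?N) \<phi> \<chi>" if \<chi>: "rep \<chi> (unit_type ~> i) (allv ?N u i f)"
      "base X \<chi> = M" for \<chi>
  proof -
    have "le X \<psi> \<chi> \<longleftrightarrow> le X (reindex X ?N (restrict u ?N) \<psi>) \<phi>" if "\<psi> \<in> fiber X M" for \<psi>
    proof -
      have \<psi>: "\<psi> \<in> Pred X" "base X \<psi> = M" "base X \<psi> = base X \<chi>" and u': "u \<in> ?N \<rightarrow> base X \<psi>"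
        using that \<chi>(2) u by (auto simp: fiber_def)
      have "le X \<psi> \<chi> \<longleftrightarrow> rl M (ty \<psi>) (ex \<psi>) (unit_type ~> i) (allv ?N u i f)"
        using rep_le_iff[OF rep_self[OF \<psi>(1)] \<chi>(1) \<psi>(3)] \<psi>(2) by simp
      also have "\<dots> \<longleftrightarrow> rl ?N (ty \<psi>) (\<lambda>n. ex \<psi> (u n)) i f"
        using rl_allv[OF u _ \<phi>(2)] val_ex[OF \<psi>(1)] \<psi>(2) by simp
      also have "\<dots> \<longleftrightarrow> le X (pull ?N u \<psi>) \<phi>"
        using rep_le_iff[OF rep_pull[OF rep_self[OF \<psi>(1)] small_base[OF \<phi>(1)] u'] f]
          base_pull[OF \<psi>(1) small_base[OF \<phi>(1)] u'] by simp
      finally show ?thesis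
        by (simp add: pull_def)
    qed
    then show ?thesis
      using repD(1)[OF \<chi>(1)] \<chi>(2) by (simp add: is_all_def fiber_def)
  qed
  have "iso X \<sigma> \<chi>" if "is_all X ?N M (restrict u ?N) \<phi> \<chi>"
    using that all[OF \<sigma>] unfolding is_all_def
    by (elim conjE) (rule iso_if_below_iff, assumption+)
  then show ?thesis
    using all rep_iff_iso[OF \<sigma>(1)] \<sigma>(2) by metis
qed

end

section \<open>Soundness of the connectives and quantifiers in a realized fibration\<close>

context realized
begin

lemma rep_reindex:
  assumes "rep \<psi> i f" "small N" "u \<in> N \<rightarrow>\<^sub>E base X \<psi>"
  shows "rep (reindex X N u \<psi>) i (\<lambda>n. f (u n))" "base X (reindex X N u \<psi>) = N"
    "reindex X N u \<psi> \<in> Pred X"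
proof -
  have u: "u \<in> N \<rightarrow> base X \<psi>"
    using assms(3) by auto
  show "rep (reindex X N u \<psi>) i (\<lambda>n. f (u n))" "base X (reindex X N u \<psi>) = N"
    "reindex X N u \<psi> \<in> Pred X"
    using rep_pull[OF assms(1,2) u] base_pull[OF repD(1)[OF assms(1)] assms(2) u] pull_Pred[OF
        repD(1)[OF assms(1)] assms(2) u]
    unfolding reindex_eq_pull[OF assms(3)] by auto
qed

lemma models_top: "models_top X"
  unfolding models_top_def
proof (intro conjI allI impI ballI; (elim conjE)?)
  fix M :: "'u set"
  assume M: "small M"
  have "val M unit_type (\<lambda>_. {unit_elem})"
    using unit_type unit_elem S_C by (auto simp: val_def)
  then show "\<exists>\<tau>. is_top X M \<tau>"
    using rep_ex[OF M] is_top_iff[OF M] by metis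
next
  fix N M :: "'u set" and u \<tau>
  assume a: "small N" "small M" "u \<in> N \<rightarrow>\<^sub>E M" "is_top X M \<tau>"
  then have \<tau>: "rep \<tau> unit_type (\<lambda>_. {unit_elem})" "base X \<tau> = M"
    using is_top_iff[OF a(2)] by auto
  then show "is_top X N (reindex X N u \<tau>)"
    using is_top_iff[OF a(1)] rep_reindex[OF \<tau>(1) a(1)] a(3) by simp
qed

lemma models_meet: "models_meet X"
  unfolding models_meet_def
proof (intro conjI allI impI ballI; (elim conjE)?)
  fix M :: "'u set" and \<phi> \<psi>
  assume "small M" "\<phi> \<in> fiber X M" "\<psi> \<in> fiber X M"
  then have *: "\<phi> \<in> Pred X" "\<psi> \<in> Pred X" "base X \<phi> = base X \<psi>"
    by (auto simp: fiber_def)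
  have "val (base X \<phi>) (ty \<phi> \<otimes> ty \<psi>) (meetv (ty \<phi>) (ty \<psi>) (ex \<phi>) (ex \<psi>))"
    using val_meetv[OF val_ex[OF *(1)], of "ty \<psi>" "ex \<psi>"] val_ex[OF *(2)] *(3) by simp
  then show "\<exists>\<chi>. is_meet X \<phi> \<psi> \<chi>"
    using rep_ex[OF small_base[OF *(1)]] is_meet_iff[OF rep_self[OF *(1)] rep_self[OF *(2)] *(3)]
        by metis
next
  fix N M :: "'u set" and u \<phi> \<psi> \<chi>
  assume a: "small N" "small M" "u \<in> N \<rightarrow>\<^sub>E M" "\<phi> \<in> fiber X M" "\<psi> \<in> fiber X M" "is_meet X \<phi> \<psi> \<chi>"
  then have P: "\<phi> \<in> Pred X" "\<psi> \<in> Pred X" "base X \<phi> = M" "base X \<psi> = M" "base X \<phi> = base X \<psi>"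
    by (auto simp: fiber_def)
  note m = is_meet_iff[OF rep_self[OF P(1)] rep_self[OF P(2)] P(5)]
  then have \<chi>: "base X \<chi> = M" "rep \<chi> (ty \<phi> \<otimes> ty \<psi>) (meetv (ty \<phi>) (ty \<psi>) (ex \<phi>) (ex \<psi>))"
    using a(6) P(3) by simp_all
  note r = rep_reindex[OF _ a(1), of _ _ _ u]
  have u: "u \<in> N \<rightarrow>\<^sub>E base X \<phi>" "u \<in> N \<rightarrow>\<^sub>E base X \<psi>" "u \<in> N \<rightarrow>\<^sub>E base X \<chi>"
    using a(3) P \<chi> by simp_all
  note r1 = r[OF rep_self[OF P(1)] u(1)] and r2 = r[OF rep_self[OF P(2)] u(2)]
      and r3 = r[OF \<chi>(2) u(3)]
  have "(\<lambda>n. meetv (ty \<phi>) (ty \<psi>) (ex \<phi>) (ex \<psi>) (u n)) =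
      meetv (ty \<phi>) (ty \<psi>) (\<lambda>n. ex \<phi> (u n)) (\<lambda>n. ex \<psi> (u n))"
    by (simp add: meetv_def fun_eq_iff)
  then show "is_meet X (reindex X N u \<phi>) (reindex X N u \<psi>) (reindex X N u \<chi>)"
    using is_meet_iff[OF r1(1) r2(1), of "reindex X N u \<chi>"] r1(2) r2(2) r3 by simp
qed

lemma models_imp: "models_imp X"
  unfolding models_imp_def
proof (intro conjI allI impI ballI; (elim conjE)?)
  fix M :: "'u set" and \<phi> \<psi>
  assume "small M" "\<phi> \<in> fiber X M" "\<psi> \<in> fiber X M"
  then have *: "\<phi> \<in> Pred X" "\<psi> \<in> Pred X" "base X \<phi> = base X \<psi>"
    by (auto simp: fiber_def)
  have "val (base X \<phi>) (ty \<phi> ~> ty \<psi>) (impv (ty \<phi>) (ty \<psi>) (ex \<phi>) (ex \<psi>))"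
    using val_impv repD(3) rep_self *(1,2) by blast
  then show "\<exists>\<chi>. is_imp X \<phi> \<psi> \<chi>"
    using rep_ex[OF small_base[OF *(1)]] is_imp_iff[OF rep_self[OF *(1)] rep_self[OF *(2)] *(3)]
        by metis
next
  fix N M :: "'u set" and u \<phi> \<psi> \<chi>
  assume a: "small N" "small M" "u \<in> N \<rightarrow>\<^sub>E M" "\<phi> \<in> fiber X M" "\<psi> \<in> fiber X M" "is_imp X \<phi> \<psi> \<chi>"
  then have P: "\<phi> \<in> Pred X" "\<psi> \<in> Pred X" "base X \<phi> = M" "base X \<psi> = M" "base X \<phi> = base X \<psi>"
    by (auto simp: fiber_def)
  note m = is_imp_iff[OF rep_self[OF P(1)] rep_self[OF P(2)] P(5)]
  then have \<chi>: "base X \<chi> = M" "rep \<chi> (ty \<phi> ~> ty \<psi>) (impv (ty \<phi>) (ty \<psi>) (ex \<phi>) (ex \<psi>))"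
    using a(6) P(3) by simp_all
  note r = rep_reindex[OF _ a(1), of _ _ _ u]
  have u: "u \<in> N \<rightarrow>\<^sub>E base X \<phi>" "u \<in> N \<rightarrow>\<^sub>E base X \<psi>" "u \<in> N \<rightarrow>\<^sub>E base X \<chi>"
    using a(3) P \<chi> by simp_all
  note r1 = r[OF rep_self[OF P(1)] u(1)] and r2 = r[OF rep_self[OF P(2)] u(2)]
      and r3 = r[OF \<chi>(2) u(3)]
  have "(\<lambda>n. impv (ty \<phi>) (ty \<psi>) (ex \<phi>) (ex \<psi>) (u n)) =
      impv (ty \<phi>) (ty \<psi>) (\<lambda>n. ex \<phi> (u n)) (\<lambda>n. ex \<psi> (u n))"
    by (simp add: impv_def fun_eq_iff)
  then show "is_imp X (reindex X N u \<phi>) (reindex X N u \<psi>) (reindex X N u \<chi>)"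
    using is_imp_iff[OF r1(1) r2(1), of "reindex X N u \<chi>"] r1(2) r2(2) r3 by simp
qed

lemma ex_along:
  assumes M: "small M" and u: "u \<in> base X \<phi> \<rightarrow>\<^sub>E M" and f: "rep \<phi> i f"
  shows "\<exists>\<chi>. is_ex X (base X \<phi>) M u \<phi> \<chi>" "base X (ex_along X (base X \<phi>) M u \<phi>) = M"
    "rep (ex_along X (base X \<phi>) M u \<phi>) i (exv (base X \<phi>) u f)"
proof -
  have u': "u \<in> base X \<phi> \<rightarrow> M" "restrict u (base X \<phi>) = u"
    using u by (auto simp: PiE_restrict)
  note e = is_ex_iff[OF M u'(1) f, unfolded u'(2)]
  have "val M i (exv (base X \<phi>) u f)"
    using repD(2)[OF f] unfolding val_def exv_def by blast
  then show *: "\<exists>\<chi>. is_ex X (base X \<phi>) M u \<phi> \<chi>"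
    using rep_ex[OF M] e by metis
  then have "is_ex X (base X \<phi>) M u \<phi> (ex_along X (base X \<phi>) M u \<phi>)"
    unfolding ex_along_def by (rule someI_ex)
  then show "base X (ex_along X (base X \<phi>) M u \<phi>) = M"
    "rep (ex_along X (base X \<phi>) M u \<phi>) i (exv (base X \<phi>) u f)"
    using e by simp_all
qed

lemma all_along:
  assumes M: "small M" and u: "u \<in> base X \<phi> \<rightarrow>\<^sub>E M" and f: "rep \<phi> i f"
  shows "\<exists>\<chi>. is_all X (base X \<phi>) M u \<phi> \<chi>" "base X (all_along X (base X \<phi>) M u \<phi>) = M"
    "rep (all_along X (base X \<phi>) M u \<phi>) (unit_type ~> i) (allv (base X \<phi>) u i f)"
proof -
  have u': "u \<in> base X \<phi> \<rightarrow> M" "restrict u (base X \<phi>) = u"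
    using u by (auto simp: PiE_restrict)
  note e = is_all_iff[OF M u'(1) f, unfolded u'(2)]
  have "val M (unit_type ~> i) (allv (base X \<phi>) u i f)"
    using repD(3)[OF f] unit_type unfolding val_def allv_def by auto
  then show *: "\<exists>\<chi>. is_all X (base X \<phi>) M u \<phi> \<chi>"
    using rep_ex[OF M] e by metis
  then have "is_all X (base X \<phi>) M u \<phi> (all_along X (base X \<phi>) M u \<phi>)"
    unfolding all_along_def by (rule someI_ex)
  then show "base X (all_along X (base X \<phi>) M u \<phi>) = M"
    "rep (all_along X (base X \<phi>) M u \<phi>) (unit_type ~> i) (allv (base X \<phi>) u i f)"
    using e by simp_all
qed

text \<open>Both quantifiers are computed from the fibres of a map. Beck-Chevalley thus rests on the
  last fact: \<open>v'\<close> carries the fibre of \<open>u'\<close> over \<open>k\<close> onto the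
  fibre of \<open>u\<close> over \<open>v k\<close>.\<close>

lemma pullback_squareD:
  assumes "pullback_square L K N M u' v' u v"
  shows "small L" "small K" "small N" "small M" "u' \<in> L \<rightarrow>\<^sub>E K" "v' \<in> L \<rightarrow>\<^sub>E N" "u \<in> N \<rightarrow>\<^sub>E M"
      "v \<in> K \<rightarrow>\<^sub>E M"
    and "k \<in> K \<Longrightarrow> v' ` {l \<in> L. u' l = k} = {n \<in> N. u n = v k}"
proof -
  show "small L" "small K" "small N" "small M" "u' \<in> L \<rightarrow>\<^sub>E K" "v' \<in> L \<rightarrow>\<^sub>E N" "u \<in> N \<rightarrow>\<^sub>E M"
      "v \<in> K \<rightarrow>\<^sub>E M"
    using assms by (simp_all add: pullback_square_def)
  have *: "(\<lambda>l. (u' l, v' l)) ` L = {(k, n). k \<in> K \<and> n \<in> N \<and> v k = u n}"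
    using assms by (simp add: pullback_square_def bij_betw_def)
  show "v' ` {l \<in> L. u' l = k} = {n \<in> N. u n = v k}" if k: "k \<in> K"
  proof (intro equalityI subsetI)
    fix n assume "n \<in> v' ` {l \<in> L. u' l = k}"
    then have "(k, n) \<in> (\<lambda>l. (u' l, v' l)) ` L"
      by auto
    then show "n \<in> {n \<in> N. u n = v k}"
      unfolding * by simp
  next
    fix n assume "n \<in> {n \<in> N. u n = v k}"
    then have "(k, n) \<in> (\<lambda>l. (u' l, v' l)) ` L"
      unfolding * using k by simp
    then show "n \<in> v' ` {l \<in> L. u' l = k}"
      by auto
  qed
qed

lemma models_ex: "models_ex X"
  unfolding models_ex_def
proof (intro conjI allI impI ballI; (elim conjE)?)
  fix N M :: "'u set" and u \<phi>
  assume "small N" "small M" "u \<in> N \<rightarrow>\<^sub>E M" "\<phi> \<in> fiber X N"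
  then show "\<exists>\<chi>. is_ex X N M u \<phi> \<chi>"
    using ex_along(1)[of M u \<phi>] rep_self[of \<phi>] by (auto simp: fiber_def)
next
  fix L K N M :: "'u set" and u' v' u v \<phi>
  assume pb: "pullback_square L K N M u' v' u v" and "\<phi> \<in> fiber X N"
  then have \<phi>: "\<phi> \<in> Pred X" "base X \<phi> = N"
    by (auto simp: fiber_def)
  note p = pullback_squareD[OF pb]
  note f = rep_self[OF \<phi>(1)]
  have "u \<in> base X \<phi> \<rightarrow>\<^sub>E M"
    using p(7) \<phi>(2) by simp
  note E1 = ex_along[OF p(4) this f, unfolded \<phi>(2)]
  have "v \<in> K \<rightarrow>\<^sub>E base X (ex_along X N M u \<phi>)"
    using p(8) E1(2) by simp
  note R1 = rep_reindex[OF E1(3) p(2) this]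
  have "v' \<in> L \<rightarrow>\<^sub>E base X \<phi>"
    using p(6) \<phi>(2) by simp
  note R2 = rep_reindex[OF f p(1) this]
  have "u' \<in> base X (reindex X L v' \<phi>) \<rightarrow>\<^sub>E K"
    using p(5) R2(2) by simp
  note E2 = ex_along[OF p(2) this R2(1), unfolded R2(2)]
  have "exv L u' (\<lambda>n. ex \<phi> (v' n)) k = exv N u (ex \<phi>) (v k)" if k: "k \<in> K" for k
  proof -
    have "exv L u' (\<lambda>n. ex \<phi> (v' n)) k = \<Union> (ex \<phi> ` (v' ` {l \<in> L. u' l = k}))"
      by (simp add: exv_def image_image)
    also have "\<dots> = exv N u (ex \<phi>) (v k)"
      unfolding exv_def p(9)[OF k] ..
    finally show ?thesis .
  qed
  then have "rep (ex_along X L K u' (reindex X L v' \<phi>)) (ty \<phi>) (\<lambda>k. exv N u (ex \<phi>) (v k))"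
    by (intro rep_cong[THEN iffD1, OF _ E2(3)]) (simp only: E2(2))
  then show "iso X (reindex X K v (ex_along X N M u \<phi>)) (ex_along X L K u' (reindex X L v' \<phi>))"
    by (rule rep_unique[OF R1(1)]) (simp add: R1(2) E2(2))
qed

lemma models_all: "models_all X"
  unfolding models_all_def
proof (intro conjI allI impI ballI; (elim conjE)?)
  fix N M :: "'u set" and u \<phi>
  assume "small N" "small M" "u \<in> N \<rightarrow>\<^sub>E M" "\<phi> \<in> fiber X N"
  then show "\<exists>\<chi>. is_all X N M u \<phi> \<chi>"
    using all_along(1)[of M u \<phi>] rep_self[of \<phi>] by (auto simp: fiber_def)
next
  fix L K N M :: "'u set" and u' v' u v \<phi>
  assume pb: "pullback_square L K N M u' v' u v" and "\<phi> \<in> fiber X N"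
  then have \<phi>: "\<phi> \<in> Pred X" "base X \<phi> = N"
    by (auto simp: fiber_def)
  note p = pullback_squareD[OF pb]
  note f = rep_self[OF \<phi>(1)]
  have "u \<in> base X \<phi> \<rightarrow>\<^sub>E M"
    using p(7) \<phi>(2) by simp
  note E1 = all_along[OF p(4) this f, unfolded \<phi>(2)]
  have "v \<in> K \<rightarrow>\<^sub>E base X (all_along X N M u \<phi>)"
    using p(8) E1(2) by simp
  note R1 = rep_reindex[OF E1(3) p(2) this]
  have "v' \<in> L \<rightarrow>\<^sub>E base X \<phi>"
    using p(6) \<phi>(2) by simp
  note R2 = rep_reindex[OF f p(1) this]
  have "u' \<in> base X (reindex X L v' \<phi>) \<rightarrow>\<^sub>E K"
    using p(5) R2(2) by simp
  note E2 = all_along[OF p(2) this R2(1), unfolded R2(2)]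
  have "allv L u' (ty \<phi>) (\<lambda>n. ex \<phi> (v' n)) k = allv N u (ty \<phi>) (ex \<phi>) (v k)" if k: "k \<in> K" for k
  proof -
    have *: "(\<forall>l\<in>L. u' l = k \<longrightarrow> B (v' l)) \<longleftrightarrow> (\<forall>n\<in>N. u n = v k \<longrightarrow> B n)" for B
    proof -
      have "(\<forall>l\<in>L. u' l = k \<longrightarrow> B (v' l)) \<longleftrightarrow> (\<forall>n\<in>v' ` {l \<in> L. u' l = k}. B n)"
        by auto
      then show ?thesis
        unfolding p(9)[OF k] by auto
    qed
    show ?thesis
      unfolding allv_def
      by (rule Collect_cong, rule conj_cong[OF refl],
          rule *[of "\<lambda>n. \<exists>b\<in>ex \<phi> n. app P unit_type (ty \<phi>) a unit_elem = Some b" for a])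
  qed
  then have "rep (all_along X L K u' (reindex X L v' \<phi>)) (unit_type ~> ty \<phi>) (\<lambda>k. allv N u (ty \<phi>)
      (ex \<phi>) (v k))"
    by (intro rep_cong[THEN iffD1, OF _ E2(3)]) (simp only: E2(2))
  then show "iso X (reindex X K v (all_along X N M u \<phi>)) (all_along X L K u' (reindex X L v' \<phi>))"
    by (rule rep_unique[OF R1(1)]) (simp add: R1(2) E2(2))
qed


section \<open>The singleton predicates as a generating family\<close>

definition gen :: "'u \<Rightarrow> 'x" where
  "gen i = (SOME \<phi>. rep \<phi> i (\<lambda>a. {a}) \<and> base X \<phi> = C i)"

lemma gen:
  assumes "i \<in> T"
  shows "rep (gen i) i (\<lambda>a. {a})" "base X (gen i) = C i" "gen i \<in> Pred X" "gen i \<in> fiber X (C i)"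
proof -
  have "val (C i) i (\<lambda>a. {a})"
    using assms by (simp add: val_def)
  then have "\<exists>\<phi>. rep \<phi> i (\<lambda>a. {a}) \<and> base X \<phi> = C i"
    using rep_ex[OF small_C[OF assms]] by metis
  then have "rep (gen i) i (\<lambda>a. {a}) \<and> base X (gen i) = C i"
    unfolding gen_def by (rule someI_ex)
  then show "rep (gen i) i (\<lambda>a. {a})" "base X (gen i) = C i" "gen i \<in> Pred X"
      "gen i \<in> fiber X (C i)"
    by (auto simp: rep_def fiber_def)
qed

lemma rep_atom:
  assumes "i \<in> T" "small M" "f \<in> M \<rightarrow> C i"
  shows "rep (pull M f (gen i)) i (\<lambda>m. {f m})" "base X (pull M f (gen i)) = M"
    "pull M f (gen i) \<in> Pred X"
  using rep_pull[OF gen(1)[OF assms(1)] assms(2), of f] base_pull[OF gen(3)[OF assms(1)] assms(2),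
      of f]
    pull_Pred[OF gen(3)[OF assms(1)] assms(2), of f] gen(2)[OF assms(1)] assms(3) by auto

abbreviation "\<G> \<equiv> generated_subfibration X T C gen"

lemma atomic_iff:
  "\<phi> \<in> Pred \<G> \<longleftrightarrow> (\<exists>i f. f \<in> base X \<phi> \<rightarrow> C i \<and> rep \<phi> i (\<lambda>m. {f m}))"
proof -
  have "iso X \<phi> (pull (base X \<phi>) f (gen i)) \<longleftrightarrow> rep \<phi> i (\<lambda>m. {f m})"
    if "\<phi> \<in> Pred X" "i \<in> T" "f \<in> base X \<phi> \<rightarrow> C i" for i f
    using rep_iff_iso[OF rep_atom(1)[OF that(2) small_base[OF that(1)] that(3)], of \<phi>]
      rep_atom(2)[OF that(2) small_base[OF that(1)] that(3)] iso_sym by metis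
  then show ?thesis
    unfolding generated_iff by (meson repD(1,3))
qed

text \<open>A meet of singletons is the singleton of their pair. Truth is a family of singletons
  too, because it is represented by \<open>{unit_elem}\<close> and not by a whole carrier.\<close>

lemma closed_under_finite_meets: "closed_under_finite_meets X \<G>"
  unfolding closed_under_finite_meets_def
proof (intro conjI allI impI ballI; (elim conjE)?)
  fix M :: "'u set" and \<tau>
  assume "small M" "is_top X M \<tau>"
  then have "rep \<tau> unit_type (\<lambda>_. {unit_elem})"
    by (simp add: is_top_iff)
  then show "\<tau> \<in> Pred \<G>"
    unfolding atomic_iff using S_C[OF unit_type unit_elem]
    by (intro exI[of _ unit_type] exI[of _ "\<lambda>_. unit_elem"]) simp
next
  fix \<phi> \<psi> \<chi>
  assume "\<phi> \<in> Pred \<G>" "\<psi> \<in> Pred \<G>" and m: "is_meet X \<phi> \<psi> \<chi>"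
  then obtain i f j g where f: "f \<in> base X \<phi> \<rightarrow> C i" "rep \<phi> i (\<lambda>m. {f m})"
    and g: "g \<in> base X \<psi> \<rightarrow> C j" "rep \<psi> j (\<lambda>m. {g m})"
    unfolding atomic_iff by blast
  have b: "base X \<phi> = base X \<psi>"
    using m by (auto simp: is_meet_def le_def)
  have "meetv i j (\<lambda>m. {f m}) (\<lambda>m. {g m}) = (\<lambda>m. {tup i j (f m) (g m)})"
    by (auto simp: meetv_def)
  then have "rep \<chi> (i \<otimes> j) (\<lambda>m. {tup i j (f m) (g m)})" "base X \<chi> = base X \<phi>"
    using is_meet_iff[OF f(2) g(2) b] m by simp_all
  moreover have "(\<lambda>m. tup i j (f m) (g m)) \<in> base X \<phi> \<rightarrow> C (i \<otimes> j)"
    using f(1) g(1) b repD(3)[OF f(2)] repD(3)[OF g(2)] by (auto intro!: tup_C)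
  ultimately show "\<chi> \<in> Pred \<G>"
    unfolding atomic_iff by (intro exI[of _ "i \<otimes> j"] exI[of _ "\<lambda>m. tup i j (f m) (g m)"]) simp
qed

text \<open>\<open>N\<close> is the total space of the family, the set of codes of pairs of a point
  and one of its realizers. Projecting the realizers, seen as singletons, back to the points
  collects them into \<open>ex \<phi>\<close> again.\<close>

lemma generates: "generates_under_ex X \<G>"
  unfolding generates_under_ex_def
proof (intro allI impI ballI)
  fix M :: "'u set" and \<phi>
  assume M: "small M" and "\<phi> \<in> fiber X M"
  then have \<phi>: "\<phi> \<in> Pred X" "base X \<phi> = M"
    by (auto simp: fiber_def)
  let ?i = "ty \<phi>"
  have v: "val M ?i (ex \<phi>)" and i: "?i \<in> T"
    using val_ex[OF \<phi>(1)] \<phi>(2) by (auto simp: val_def)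
  have C: "m \<in> M \<Longrightarrow> a \<in> ex \<phi> m \<Longrightarrow> a \<in> C ?i" for m a
    using v unfolding val_def by blast
  define N where "N = {upair m a |m a. m \<in> M \<and> a \<in> ex \<phi> m}"
  have N: "small N"
    by (rule small_upair[OF M small_C[OF i]]) (use C in \<open>auto simp: N_def\<close>)
  have g: "usnd \<in> N \<rightarrow> C ?i" and u: "restrict ufst N \<in> N \<rightarrow>\<^sub>E M"
    using C by (auto simp: N_def)
  let ?\<psi> = "pull N usnd (gen ?i)"
  note \<psi> = rep_atom[OF i N g]
  have "restrict ufst N \<in> base X ?\<psi> \<rightarrow>\<^sub>E M"
    using u \<psi>(2) by simp
  note E = ex_along[OF M this \<psi>(1), unfolded \<psi>(2)]
  have "exv N (restrict ufst N) (\<lambda>m. {usnd m}) m = ex \<phi> m" if "m \<in> M" for m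
    using that by (force simp: exv_def N_def)
  then have "rep (ex_along X N M (restrict ufst N) ?\<psi>) ?i (ex \<phi>)"
    by (intro rep_cong[THEN iffD1, OF _ E(3)]) (simp only: E(2))
  then have "iso X \<phi> (ex_along X N M (restrict ufst N) ?\<psi>)"
    by (rule rep_unique[OF rep_self[OF \<phi>(1)]]) (simp add: E(2) \<phi>(2))
  moreover have "?\<psi> \<in> fiber \<G> N"
    using \<psi> generated_atom[of gen ?i C T N usnd] gen(4)[OF i] i N g
    by (simp add: fiber_def) (simp add: generated_subfibration_def)
  ultimately show "\<exists>N. small N \<and> (\<exists>u\<in>N \<rightarrow>\<^sub>E M. \<exists>\<psi>\<in>fiber \<G> N. iso X \<phi> (ex_along X N M u \<psi>))"
    using N u by blast
qed

text \<open>At \<open>m\<close> the only input is \<open>u m\<close>; the realizer sends it to a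
  realizer of \<theta> at some point over \<open>m\<close>. Choosing such a point for each
  \<open>m\<close> gives \<open>w\<close>, a section of \<open>v\<close> over \<open>J\<close>, so
  the identity of \<open>J\<close> serves as the surjection.\<close>

lemma ex_prime:
  assumes i: "i \<in> T"
  shows "ex_prime X (C i) (gen i)"
  unfolding ex_prime_def
proof (intro allI impI ballI; (elim conjE)?)
  fix J K :: "'u set" and u v \<theta>
  assume J: "small J" and K: "small K" and u: "u \<in> J \<rightarrow>\<^sub>E C i" and v: "v \<in> K \<rightarrow>\<^sub>E J" and
      "\<theta> \<in> fiber X K"
    and le: "le X (reindex X J u (gen i)) (ex_along X K J v \<theta>)"
  then have \<theta>: "\<theta> \<in> Pred X" "base X \<theta> = K"
    by (auto simp: fiber_def)
  let ?j = "ty \<theta>"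
  have u': "u \<in> J \<rightarrow> C i"
    using u by auto
  have "v \<in> base X \<theta> \<rightarrow>\<^sub>E J"
    using v \<theta>(2) by simp
  note E = ex_along[OF J this rep_self[OF \<theta>(1)], unfolded \<theta>(2)]
  note A = rep_atom[OF i J u']
  have "rl J i (\<lambda>m. {u m}) ?j (exv K v (ex \<theta>))"
    using rep_le_iff[OF A(1) E(3)] A(2) E(2) le reindex_eq_pull[OF u] by simp
  then obtain e where e: "e \<in> S (i ~> ?j)" "\<forall>m\<in>J. \<exists>b\<in>exv K v (ex \<theta>) m. app P i ?j e (u m) = Some b"
    unfolding rl_def by blast
  have "\<forall>m\<in>J. \<exists>k\<in>K. v k = m \<and> (\<exists>b\<in>ex \<theta> k. app P i ?j e (u m) = Some b)"
    using e(2) unfolding exv_def by blast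
  then obtain w where w: "\<And>m. m \<in> J \<Longrightarrow> w m \<in> K \<and> v (w m) = m \<and>
      (\<exists>b\<in>ex \<theta> (w m). app P i ?j e (u m) = Some b)"
    by metis
  let ?e = "\<lambda>m\<in>J. m" and ?w = "restrict w J"
  have W: "?w \<in> J \<rightarrow>\<^sub>E K" "?w \<in> J \<rightarrow>\<^sub>E base X \<theta>"
    using w \<theta>(2) by auto
  have "rl J i (\<lambda>m. {u m}) ?j (\<lambda>m. ex \<theta> (?w m))"
    unfolding rl_def using e(1) w by auto
  then have "le X (pull J u (gen i)) (reindex X J ?w \<theta>)"
    using rep_le_iff[OF A(1) rep_reindex(1)[OF rep_self[OF \<theta>(1)] J W(2)]] A(2)
      rep_reindex(2)[OF rep_self[OF \<theta>(1)] J W(2)] by simp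
  moreover have "compose J u ?e = u"
    using u by (auto simp: compose_def fun_eq_iff PiE_def extensional_def)
  moreover have "surjection J J ?e" "compose J v ?w = ?e"
    using w by (auto simp: surjection_def compose_def fun_eq_iff)
  ultimately show "\<exists>L e w. small L \<and> surjection L J e \<and> w \<in> L \<rightarrow>\<^sub>E K \<and> compose L v w = e \<and>
      le X (reindex X L (compose L u e) (gen i)) (reindex X L w \<theta>)"
    using J W(1) reindex_eq_pull[OF u] by metis
qed

text \<open>The predicate \<phi> has a single realizer \<open>g y\<close> at each \<open>y\<close>,
  so \<open>r\<close> gives the same output at all preimages of \<open>y\<close>. Hence
  \<open>f\<close> is constant on the fibres of \<open>e\<close>, and \<open>h\<close> may be
  defined through an arbitrary preimage.\<close>

lemma modest:
  assumes i: "i \<in> T"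
  shows "modest \<G> (C i) (gen i)"
proof -
  have sub: "Pred \<G> \<subseteq> Pred X"
    unfolding generated_iff by (auto simp: generated_iff)
  have pull: "pull N u \<phi> \<in> Pred \<G>" if "\<phi> \<in> Pred \<G>" "small N" "u \<in> N \<rightarrow> base X \<phi>" for N u \<phi>
    by (rule generated_pull[OF gen(4) that])
  have G: "gen i \<in> Pred \<G>"
    unfolding atomic_iff using gen(1,2)[OF i] by (intro exI[of _ i] exI[of _ "\<lambda>a. a"]) simp
  have "modest (X\<lparr>Pred := Pred \<G>\<rparr>) (C i) (gen i)"
  proof (rule modest_sub_iff[OF sub _ G gen(2)[OF i], THEN iffD2], erule (2) pull,
      intro allI impI, elim conjE)
    fix J K :: "'u set" and e f \<phi>
    assume J: "small J" and K: "small K" and e: "e \<in> K \<rightarrow> J" "e ` K = J" and f: "f \<in> K \<rightarrow> C i"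
      and "\<phi> \<in> Pred \<G>" and b: "base X \<phi> = J" and lifts: "lifts (pull K e \<phi>) f (gen i)"
    then obtain j g where g: "g \<in> J \<rightarrow> C j" "rep \<phi> j (\<lambda>m. {g m})"
      unfolding atomic_iff by blast
    have e': "e \<in> K \<rightarrow> base X \<phi>"
      using e b by simp
    have bK: "base X (pull K e \<phi>) = K"
      using base_pull[OF repD(1)[OF g(2)] K e'] .
    have "rl K j (\<lambda>x. {g (e x)}) i (\<lambda>x. {f x})"
      using rep_lifts_iff[OF rep_pull[OF g(2) K e'] gen(1)[OF i], of f] bK f gen(2)[OF i] lifts
          by simp
    then obtain r where r: "r \<in> S (j ~> i)" "\<forall>x\<in>K. app P j i r (g (e x)) = Some (f x)"
      unfolding rl_def by auto
    define h where "h = (\<lambda>y. f (SOME x. x \<in> K \<and> e x = y))"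
    have he: "h (e x) = f x" if "x \<in> K" for x
    proof -
      have "(SOME x'. x' \<in> K \<and> e x' = e x) \<in> K \<and> e (SOME x'. x' \<in> K \<and> e x' = e x) = e x"
        using that by (intro someI[where P = "\<lambda>x'. x' \<in> K \<and> e x' = e x"]) simp
      then have "Some (f (SOME x'. x' \<in> K \<and> e x' = e x)) = Some (f x)"
        using r(2) that by metis
      then show ?thesis
        by (simp add: h_def)
    qed
    then have h: "h \<in> J \<rightarrow> C i"
      using e f by (auto simp: Pi_iff)
    have "\<forall>y\<in>J. app P j i r (g y) = Some (h y)"
      using r(2) he e(2) by auto
    then have "rl J j (\<lambda>m. {g m}) i (\<lambda>m. {h m})"
      unfolding rl_def using r(1) by auto
    then have "lifts \<phi> h (gen i)"
      using rep_lifts_iff[OF g(2) gen(1)[OF i], of h] b h gen(2)[OF i] by simp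
    then show "\<exists>h\<in>J \<rightarrow> C i. (\<forall>x\<in>K. h (e x) = f x) \<and> lifts \<phi> h (gen i)"
      using h he by blast
  qed
  then show ?thesis
    using generated_subfibration_eq by metis
qed

end

section \<open>Comparison of a realized fibration with the hyperdoctrine\<close>

context pca_inclusion
begin

abbreviation "H \<equiv> realizability_hyperdoctrine P S"

lemma lift_H: "lift H (M, i, f) u (N, j, g) \<longleftrightarrow> rl M i f j (\<lambda>m. g (u m))"
  by (simp add: realizability_hyperdoctrine_def rl_def)

lemma base_H: "base H (M, i, f) = M"
  by (simp add: realizability_hyperdoctrine_def)

lemma Pred_H: "(M, i, f) \<in> Pred H \<longleftrightarrow> small M \<and> val M i f \<and> f \<in> extensional M"
  by (auto simp: realizability_hyperdoctrine_def val_def PiE_def)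

end

context realized
begin

text \<open>A correspondence between objects of the two fibrations that preserves and reflects
  liftings. It is total on both sides, so the facts about both functors follow from facts about this
  one relation.\<close>

definition names :: "'x \<Rightarrow> 'u set \<times> 'u \<times> ('u \<Rightarrow> 'u set) \<Rightarrow> bool" where
  "names \<phi> y \<longleftrightarrow> y \<in> Pred H \<and> base H y = base X \<phi> \<and> rep \<phi> (fst (snd y)) (snd (snd y))"

lemma lift_iff_H:
  assumes "names \<phi> y" "names \<psi> z" "u \<in> base X \<phi> \<rightarrow>\<^sub>E base X \<psi>"
  shows "lift X \<phi> u \<psi> \<longleftrightarrow> lift H y u z"
proof -
  obtain M i f where y: "y = (M, i, f)"
    by (cases y) auto
  obtain N j g where z: "z = (N, j, g)"
    by (cases z) auto
  have M: "M = base X \<phi>" and f: "rep \<phi> i f" and g: "rep \<psi> j g"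
    using assms(1,2) by (auto simp: names_def y z base_H)
  have u: "u \<in> base X \<phi> \<rightarrow> base X \<psi>" "restrict u (base X \<phi>) = u"
    using assms(3) by (auto simp: PiE_restrict)
  have "lift X \<phi> u \<psi> \<longleftrightarrow> lifts \<phi> u \<psi>"
    using u repD(1)[OF f] repD(1)[OF g] by (simp add: lifts_def)
  then show ?thesis
    using rep_lifts_iff[OF f g u(1)] by (simp add: y z lift_H M)
qed

text \<open>Families in \<open>H\<close> are extensional functions, hence the restriction of
  \<open>ex \<phi>\<close> to the base.\<close>

definition code :: "'x \<Rightarrow> 'u set \<times> 'u \<times> ('u \<Rightarrow> 'u set)" where
  "code \<phi> = (base X \<phi>, ty \<phi>, restrict (ex \<phi>) (base X \<phi>))"

definition decode :: "'u set \<times> 'u \<times> ('u \<Rightarrow> 'u set) \<Rightarrow> 'x" where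
  "decode y = (SOME \<phi>. names \<phi> y)"

lemma names_code:
  assumes "\<phi> \<in> Pred X"
  shows "names \<phi> (code \<phi>)"
proof -
  have "rep \<phi> (ty \<phi>) (restrict (ex \<phi>) (base X \<phi>))"
    by (rule rep_cong[THEN iffD1, OF _ rep_self[OF assms]]) simp
  then show ?thesis
    using small_base[OF assms] by (auto simp: names_def code_def Pred_H base_H rep_def)
qed

lemma names_decode:
  assumes "y \<in> Pred H"
  shows "names (decode y) y"
proof -
  obtain M i f where y: "y = (M, i, f)"
    by (cases y) auto
  have "small M" "val M i f"
    using assms by (auto simp: y Pred_H)
  then obtain \<phi> where "rep \<phi> i f" "base X \<phi> = M"
    by (rule rep_ex)
  then have "names \<phi> y"
    using assms by (simp add: names_def y base_H)
  then show ?thesis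
    unfolding decode_def by (rule someI)
qed

lemma namesD: "names \<phi> y \<Longrightarrow> \<phi> \<in> Pred X" "names \<phi> y \<Longrightarrow> y \<in> Pred H" "names \<phi> y \<Longrightarrow> base H y = base X \<phi>"
  by (auto simp: names_def rep_def)

text \<open>Test objects are transported by \<open>decode\<close> in one direction and by
  \<open>code\<close> in the other; liftings out of them agree by \<open>lift_iff_H\<close>.\<close>

lemma cartesian_iff_H:
  assumes y: "names \<phi> y" and z: "names \<psi> z" and u: "u \<in> base X \<phi> \<rightarrow>\<^sub>E base X \<psi>"
  shows "cartesian X \<phi> u \<psi> \<longleftrightarrow> cartesian H y u z"
proof -
  note b = namesD(3)[OF y] namesD(3)[OF z]
  have comp: "compose (base X \<chi>) u v \<in> base X \<chi> \<rightarrow>\<^sub>E base X \<psi>"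
    if "v \<in> base X \<chi> \<rightarrow>\<^sub>E base X \<phi>" for \<chi> v
    using that u by (auto simp: compose_def)
  have "(\<forall>\<chi>\<in>Pred X. \<forall>v\<in>base X \<chi> \<rightarrow>\<^sub>E base X \<phi>. lift X \<chi> (compose (base X \<chi>) u v) \<psi> \<longrightarrow> lift X \<chi> v \<phi>)
    \<longleftrightarrow> (\<forall>x\<in>Pred H. \<forall>v\<in>base H x \<rightarrow>\<^sub>E base H y. lift H x (compose (base H x) u v) z \<longrightarrow> lift H x v y)"
    (is "?l \<longleftrightarrow> ?r")
  proof
    assume l: ?l
    show ?r
    proof (intro ballI impI)
      fix x v assume x: "x \<in> Pred H" and v: "v \<in> base H x \<rightarrow>\<^sub>E base H y"
        and *: "lift H x (compose (base H x) u v) z"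
      note n = names_decode[OF x]
      note bx = namesD(3)[OF n]
      have v': "v \<in> base X (decode x) \<rightarrow>\<^sub>E base X \<phi>"
        using v bx b by simp
      have "lift X (decode x) (compose (base X (decode x)) u v) \<psi>"
        using lift_iff_H[OF n z comp[OF v']] * bx by simp
      then have "lift X (decode x) v \<phi>"
        using l[rule_format, OF namesD(1)[OF n] v'] by simp
      then show "lift H x v y"
        using lift_iff_H[OF n y v'] by simp
    qed
  next
    assume r: ?r
    show ?l
    proof (intro ballI impI)
      fix \<chi> v assume \<chi>: "\<chi> \<in> Pred X" and v: "v \<in> base X \<chi> \<rightarrow>\<^sub>E base X \<phi>"
        and *: "lift X \<chi> (compose (base X \<chi>) u v) \<psi>"
      note n = names_code[OF \<chi>]
      note bx = namesD(3)[OF n]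
      have v': "v \<in> base H (code \<chi>) \<rightarrow>\<^sub>E base H y"
        using v bx b by simp
      have "lift H (code \<chi>) (compose (base H (code \<chi>)) u v) z"
        using lift_iff_H[OF n z comp[OF v]] * bx by simp
      then have "lift H (code \<chi>) v y"
        using r[rule_format, OF namesD(2)[OF n] v'] by simp
      then show "lift X \<chi> v \<phi>"
        using lift_iff_H[OF n y v] by simp
    qed
  qed
  then show ?thesis
    unfolding cartesian_def using lift_iff_H[OF y z u] namesD[OF y] namesD[OF z] u by auto
qed

text \<open>A predicate \<phi> and \<open>decode (code \<phi>)\<close> are both named by
  \<open>code \<phi>\<close>, hence isomorphic by \<open>rep_unique\<close>. On the other side
  \<open>y\<close> and \<open>code (decode y)\<close> name the same predicate, so its identity lifts
  both ways.\<close>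

lemma fibered_equivalent: "fibered_equivalent X H"
  unfolding fibered_equivalent_def
proof (intro exI conjI ballI)
  show "fibered_functor X H code"
    unfolding fibered_functor_def
  proof (intro conjI ballI)
    fix \<phi> assume \<phi>: "\<phi> \<in> Pred X"
    show "code \<phi> \<in> Pred H" "base H (code \<phi>) = base X \<phi>"
      using namesD[OF names_code[OF \<phi>]] by simp_all
    fix \<psi> u assume \<psi>: "\<psi> \<in> Pred X" and u: "u \<in> base X \<phi> \<rightarrow>\<^sub>E base X \<psi>"
    show "lift X \<phi> u \<psi> \<longrightarrow> lift H (code \<phi>) u (code \<psi>)"
      using lift_iff_H[OF names_code[OF \<phi>] names_code[OF \<psi>] u] by simp
    show "cartesian X \<phi> u \<psi> \<longrightarrow> cartesian H (code \<phi>) u (code \<psi>)"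
      using cartesian_iff_H[OF names_code[OF \<phi>] names_code[OF \<psi>] u] by simp
  qed
  show "fibered_functor H X decode"
    unfolding fibered_functor_def
  proof (intro conjI ballI)
    fix y assume y: "y \<in> Pred H"
    note n = namesD[OF names_decode[OF y]]
    show "decode y \<in> Pred X" "base X (decode y) = base H y"
      using n by simp_all
    fix z u assume z: "z \<in> Pred H" and u: "u \<in> base H y \<rightarrow>\<^sub>E base H z"
    then have u': "u \<in> base X (decode y) \<rightarrow>\<^sub>E base X (decode z)"
      using n(3) namesD(3)[OF names_decode[OF z]] by simp
    show "lift H y u z \<longrightarrow> lift X (decode y) u (decode z)"
      using lift_iff_H[OF names_decode[OF y] names_decode[OF z] u'] by simp
    show "cartesian H y u z \<longrightarrow> cartesian X (decode y) u (decode z)"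
      using cartesian_iff_H[OF names_decode[OF y] names_decode[OF z] u'] by simp
  qed
next
  fix \<phi> assume \<phi>: "\<phi> \<in> Pred X"
  note n = names_code[OF \<phi>] and n' = names_decode[OF namesD(2)[OF names_code[OF \<phi>]]]
  show "iso X \<phi> (decode (code \<phi>))"
    by (rule rep_unique) (use n n' in \<open>auto simp: names_def\<close>)
next
  fix y assume y: "y \<in> Pred H"
  let ?\<phi> = "decode y"
  note n = names_decode[OF y]
  note n' = names_code[OF namesD(1)[OF n]]
  have i: "(\<lambda>m\<in>base X ?\<phi>. m) \<in> base X ?\<phi> \<rightarrow>\<^sub>E base X ?\<phi>"
    by auto
  have "lift X ?\<phi> (\<lambda>m\<in>base X ?\<phi>. m) ?\<phi>"
    using lifts_id[OF namesD(1)[OF n]] by (simp add: lifts_def)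
  then show "iso H (code ?\<phi>) y"
    using lift_iff_H[OF n n' i] lift_iff_H[OF n' n i] namesD[OF n] namesD[OF n']
    by (simp add: iso_def le_def)
qed

end

text \<open>Types and realizer sets are read off \<open>F\<close>. That \<open>F\<close> reflects
  liftings follows by applying \<open>G\<close> and cancelling the unit; a given family is realized
  by its image under \<open>G\<close>, compared with it through the counit.\<close>

lemma (in posetal_fib) realized_if_fibered_equivalent:
  assumes incl: "typed_pca_inclusion P S" and eq: "fibered_equivalent X
      (realizability_hyperdoctrine P S)"
  obtains ty ex where "realized X P S ty ex"
proof -
  interpret pca_inclusion P S
    by standard (rule incl)
  obtain F G where F: "fibered_functor X H F" and G: "fibered_functor H X G"
    and GF: "\<And>\<phi>. \<phi> \<in> Pred X \<Longrightarrow> iso X \<phi> (G (F \<phi>))" and FG: "\<And>y. y \<in> Pred H \<Longrightarrow> iso H (F (G y)) y"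
    using eq unfolding fibered_equivalent_def by blast
  define ty where "ty \<phi> = fst (snd (F \<phi>))" for \<phi>
  define ex where "ex \<phi> = snd (snd (F \<phi>))" for \<phi>
  have FP: "F \<phi> \<in> Pred H" "base H (F \<phi>) = base X \<phi>" if "\<phi> \<in> Pred X" for \<phi>
    using F that unfolding fibered_functor_def by blast+
  have GP: "G y \<in> Pred X" "base X (G y) = base H y" if "y \<in> Pred H" for y
    using G that unfolding fibered_functor_def by blast+
  have F_eq: "F \<phi> = (base X \<phi>, ty \<phi>, ex \<phi>)" if "\<phi> \<in> Pred X" for \<phi>
    using FP(2)[OF that] base_H[of "fst (F \<phi>)" "ty \<phi>" "ex \<phi>"]
        by (simp add: ty_def ex_def prod_eq_iff)
  have "realized X P S ty ex"
  proof
    show "val (base X \<phi>) (ty \<phi>) (ex \<phi>)" if "\<phi> \<in> Pred X" for \<phi>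
      using FP(1)[OF that] unfolding F_eq[OF that] Pred_H by blast
  next
    fix \<phi> \<psi> u
    assume \<phi>: "\<phi> \<in> Pred X" and \<psi>: "\<psi> \<in> Pred X" and u: "u \<in> base X \<phi> \<rightarrow> base X \<psi>"
    let ?u = "restrict u (base X \<phi>)"
    have u': "?u \<in> base X \<phi> \<rightarrow>\<^sub>E base X \<psi>"
      using u by auto
    have H: "lift H (F \<phi>) ?u (F \<psi>) \<longleftrightarrow> rl (base X \<phi>) (ty \<phi>) (ex \<phi>) (ty \<psi>) (\<lambda>m. ex \<psi> (u m))"
      unfolding F_eq[OF \<phi>] F_eq[OF \<psi>] lift_H by (rule rl_cong) simp_all
    show "lifts \<phi> u \<psi> \<longleftrightarrow> rl (base X \<phi>) (ty \<phi>) (ex \<phi>) (ty \<psi>) (\<lambda>m. ex \<psi> (u m))"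
    proof
      assume "lifts \<phi> u \<psi>"
      then have "lift X \<phi> ?u \<psi>"
        by (simp add: lifts_def)
      then have "lift H (F \<phi>) ?u (F \<psi>)"
        using F \<phi> \<psi> u' unfolding fibered_functor_def by blast
      then show "rl (base X \<phi>) (ty \<phi>) (ex \<phi>) (ty \<psi>) (\<lambda>m. ex \<psi> (u m))"
        using H by simp
    next
      assume "rl (base X \<phi>) (ty \<phi>) (ex \<phi>) (ty \<psi>) (\<lambda>m. ex \<psi> (u m))"
      then have "lift H (F \<phi>) ?u (F \<psi>)"
        using H by simp
      moreover have "?u \<in> base H (F \<phi>) \<rightarrow>\<^sub>E base H (F \<psi>)"
        using u' FP \<phi> \<psi> by simp
      ultimately have "lift X (G (F \<phi>)) ?u (G (F \<psi>))"
        using G FP(1) \<phi> \<psi> unfolding fibered_functor_def by blast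
      then have "lifts (G (F \<phi>)) u (G (F \<psi>))"
        using GP FP \<phi> \<psi> u by (simp add: lifts_def)
      then show "lifts \<phi> u \<psi>"
        using GF[OF \<phi>] GF[OF \<psi>] lifts_le le_lifts unfolding iso_def by blast
    qed
  next
    fix M :: "'u set" and i f
    assume M: "small M" and v: "val M i f"
    let ?y = "(M, i, restrict f M)"
    have y: "?y \<in> Pred H"
      using M v by (auto simp: Pred_H val_def)
    have b: "base X (G ?y) = M" and \<phi>: "G ?y \<in> Pred X"
      using GP[OF y] by (simp_all add: base_H)
    have "lift H (F (G ?y)) (\<lambda>m\<in>M. m) ?y" "lift H ?y (\<lambda>m\<in>M. m) (F (G ?y))"
      using FG[OF y] FP(2)[OF \<phi>] b by (auto simp: iso_def le_def base_H)
    then have *: "rl M (ty (G ?y)) (ex (G ?y)) i (\<lambda>m. restrict f M (restrict (\<lambda>m. m) M m))"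
      "rl M i (restrict f M) (ty (G ?y)) (\<lambda>m. ex (G ?y) (restrict (\<lambda>m. m) M m))"
      unfolding F_eq[OF \<phi>] lift_H b by simp_all
    have "rl M (ty (G ?y)) (ex (G ?y)) i f"
      by (rule rl_cong[THEN iffD1, OF _ _ *(1)]) simp_all
    moreover have "rl M i f (ty (G ?y)) (ex (G ?y))"
      by (rule rl_cong[THEN iffD1, OF _ _ *(2)]) simp_all
    ultimately show "\<exists>\<phi>\<in>Pred X. base X \<phi> = M \<and> rl M (ty \<phi>) (ex \<phi>) i f \<and> rl M i f (ty \<phi>) (ex \<phi>)"
      using \<phi> b by blast
  qed
  then show ?thesis
    by (rule that)
qed

section \<open>Forcing semantics of the connectives\<close>

context posetal_fib
begin

text \<open>Stability under reindexing turns the universal property inside one fiber into one at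
  every stage: the meet is pulled back along \<open>t\<close> and compared with \<chi> over its own
  base.\<close>

lemma meet_lifts_iff:
  assumes m: "models_meet X" and \<mu>: "is_meet X \<phi> \<psi> \<mu>"
  shows "lifts \<chi> t \<mu> \<longleftrightarrow> lifts \<chi> t \<phi> \<and> lifts \<chi> t \<psi>"
proof
  assume "lifts \<chi> t \<mu>"
  then show "lifts \<chi> t \<phi> \<and> lifts \<chi> t \<psi>"
    using \<mu> le_lifts unfolding is_meet_def by blast
next
  assume *: "lifts \<chi> t \<phi> \<and> lifts \<chi> t \<psi>"
  let ?B = "base X \<chi>" and ?M = "base X \<phi>"
  have P: "\<phi> \<in> Pred X" "\<psi> \<in> Pred X" "\<mu> \<in> Pred X" and b: "base X \<mu> = ?M" "base X \<psi> = ?M"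
    using \<mu> unfolding is_meet_def le_def by metis+
  have \<chi>: "small ?B" and t: "t \<in> ?B \<rightarrow> ?M"
    using * small_base by (auto simp: lifts_def)
  have "restrict t ?B \<in> ?B \<rightarrow>\<^sub>E ?M"
    using t by auto
  then have "is_meet X (pull ?B t \<phi>) (pull ?B t \<psi>) (pull ?B t \<mu>)"
    using m \<chi> small_base[OF P(1)] P b \<mu> unfolding models_meet_def pull_def fiber_def by blast
  moreover have "le X \<chi> (pull ?B t \<phi>)" "le X \<chi> (pull ?B t \<psi>)"
    using le_pull_iff[OF P(1) \<chi> t] le_pull_iff[OF P(2) \<chi>, of t] * t b by auto
  ultimately have "le X \<chi> (pull ?B t \<mu>)"
    unfolding is_meet_def by blast
  then show "lifts \<chi> t \<mu>"
    using le_pull_iff[OF P(3) \<chi>, of t] t b by simp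
qed

text \<open>The Kripke-Joyal clause for implication. The meet of \<theta> with the reindexed \<phi>
  is the generic stage at which both hold, so testing all stages amounts to testing this
  one.\<close>

lemma imp_lifts_iff:
  assumes m: "models_meet X" "models_imp X" and \<sigma>: "is_imp X \<phi> \<psi> \<sigma>"
    and P: "\<phi> \<in> Pred X" "\<psi> \<in> Pred X" "base X \<psi> = base X \<phi>"
    and \<theta>: "\<theta> \<in> Pred X" "v \<in> base X \<theta> \<rightarrow> base X \<phi>"
  shows "lifts \<theta> v \<sigma> \<longleftrightarrow>
    (\<forall>\<chi> t. lifts \<chi> t \<theta> \<and> lifts \<chi> (\<lambda>x. v (t x)) \<phi> \<longrightarrow> lifts \<chi> (\<lambda>x. v (t x)) \<psi>)" (is "_ \<longleftrightarrow> ?r")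
proof -
  let ?B = "base X \<theta>"
  have \<sigma>': "\<sigma> \<in> Pred X" "base X \<sigma> = base X \<phi>"
    using \<sigma> by (auto simp: is_imp_def fiber_def)
  note B = small_base[OF \<theta>(1)]
  have v: "v \<in> ?B \<rightarrow> base X \<psi>" "v \<in> ?B \<rightarrow> base X \<sigma>" "restrict v ?B \<in> ?B \<rightarrow>\<^sub>E base X \<phi>"
    using \<theta>(2) P \<sigma>' by auto
  note r\<phi> = base_pull[OF P(1) B \<theta>(2)] pull_Pred[OF P(1) B \<theta>(2)]
  have "is_imp X (pull ?B v \<phi>) (pull ?B v \<psi>) (pull ?B v \<sigma>)"
    using m(2) B small_base[OF P(1)] P \<sigma> v(3) unfolding models_imp_def pull_def fiber_def by blast
  then have "le X \<theta> (pull ?B v \<sigma>) \<longleftrightarrow> (\<exists>\<mu>. is_meet X \<theta> (pull ?B v \<phi>) \<mu> \<and> le X \<mu> (pull ?B v \<psi>))"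
    using \<theta>(1) r\<phi> unfolding is_imp_def fiber_def by blast
  then have "lifts \<theta> v \<sigma> \<longleftrightarrow> (\<exists>\<mu>. is_meet X \<theta> (pull ?B v \<phi>) \<mu> \<and> le X \<mu> (pull ?B v \<psi>))"
    using le_pull_iff[OF \<sigma>'(1) B v(2)] by simp
  also have "\<dots> \<longleftrightarrow> ?r"
  proof
    assume "\<exists>\<mu>. is_meet X \<theta> (pull ?B v \<phi>) \<mu> \<and> le X \<mu> (pull ?B v \<psi>)"
    then obtain \<mu> where \<mu>: "is_meet X \<theta> (pull ?B v \<phi>) \<mu>" "le X \<mu> (pull ?B v \<psi>)"
      by blast
    show ?r
    proof (intro allI impI, elim conjE)
      fix \<chi> t assume t: "lifts \<chi> t \<theta>" "lifts \<chi> (\<lambda>x. v (t x)) \<phi>"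
      have t': "t \<in> base X \<chi> \<rightarrow> ?B"
        using t by (auto simp: lifts_def)
      have "lifts \<chi> t (pull ?B v \<phi>)"
        using lifts_pull_iff[OF P(1) B \<theta>(2) t'] t by simp
      then have "lifts \<chi> t (pull ?B v \<psi>)"
        using meet_lifts_iff[OF m(1) \<mu>(1)] t(1) le_lifts[OF \<mu>(2)] by blast
      then show "lifts \<chi> (\<lambda>x. v (t x)) \<psi>"
        using lifts_pull_iff[OF P(2) B v(1) t'] by simp
    qed
  next
    assume r: ?r
    have "\<exists>\<mu>. is_meet X \<theta> (pull ?B v \<phi>) \<mu>"
      using m(1) B \<theta>(1) r\<phi> unfolding models_meet_def fiber_def by blast
    then obtain \<mu> where \<mu>: "is_meet X \<theta> (pull ?B v \<phi>) \<mu>"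
      by blast
    have b: "base X \<mu> = ?B" and l: "lifts \<mu> (\<lambda>x. x) \<theta>" "lifts \<mu> (\<lambda>x. x) (pull ?B v \<phi>)"
      using \<mu> by (simp_all add: is_meet_def le_iff_lifts)
    have "lifts \<mu> v \<phi>"
      using lifts_pull_iff[OF P(1) B \<theta>(2), of "\<lambda>x. x" \<mu>] l(2) b by simp
    then have "lifts \<mu> v \<psi>"
      using r l(1) by blast
    then show "\<exists>\<mu>. is_meet X \<theta> (pull ?B v \<phi>) \<mu> \<and> le X \<mu> (pull ?B v \<psi>)"
      using \<mu> le_pull_iff[OF P(2) B v(1) b] by blast
  qed
  finally show ?thesis .
qed

section \<open>Beck-Chevalley at the canonical fibre product\<close>

definition pb :: "'u set \<Rightarrow> 'u set \<Rightarrow> ('u \<Rightarrow> 'u) \<Rightarrow> ('u \<Rightarrow> 'u) \<Rightarrow> 'u set" where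
  "pb K N v u = {upair k n |k n. k \<in> K \<and> n \<in> N \<and> v k = u n}"

lemma pullback_square_pb:
  assumes "small K" "small N" "small M" "u \<in> N \<rightarrow>\<^sub>E M" "v \<in> K \<rightarrow>\<^sub>E M"
  shows "pullback_square (pb K N v u) K N M (restrict ufst (pb K N v u)) (restrict usnd (pb K N v
      u)) u v"
proof -
  have "small (pb K N v u)"
    by (rule small_upair[OF assms(1,2)]) (auto simp: pb_def)
  moreover have "bij_betw (\<lambda>l. (restrict ufst (pb K N v u) l, restrict usnd (pb K N v u) l)) (pb K
      N v u)
      {(k, n). k \<in> K \<and> n \<in> N \<and> v k = u n}"
    by (rule bij_betwI[where g = "\<lambda>(k, n). upair k n"]) (auto simp: pb_def)
  ultimately show ?thesis
    using assms by (auto simp: pullback_square_def pb_def)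
qed

lemma is_all_unique: "is_all X N M u \<phi> \<chi> \<Longrightarrow> is_all X N M u \<phi> \<chi>' \<Longrightarrow> le X \<chi> \<chi>'"
  by (auto simp: is_all_def le_refl fiber_def)

lemma is_ex_unique: "is_ex X N M u \<phi> \<chi> \<Longrightarrow> is_ex X N M u \<phi> \<chi>' \<Longrightarrow> le X \<chi> \<chi>'"
  by (auto simp: is_ex_def le_refl fiber_def)

lemma is_all_all_along: "models_all X \<Longrightarrow> small N \<Longrightarrow> small M \<Longrightarrow> u \<in> N \<rightarrow>\<^sub>E M \<Longrightarrow> \<phi> \<in> fiber X N \<Longrightarrow>
    is_all X N M u \<phi> (all_along X N M u \<phi>)"
  unfolding all_along_def models_all_def by (metis someI_ex)

lemma is_ex_ex_along: "models_ex X \<Longrightarrow> small N \<Longrightarrow> small M \<Longrightarrow> u \<in> N \<rightarrow>\<^sub>E M \<Longrightarrow> \<phi> \<in> fiber X N \<Longrightarrow>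
    is_ex X N M u \<phi> (ex_along X N M u \<phi>)"
  unfolding ex_along_def models_ex_def by (metis someI_ex)

context
  fixes N M K :: "'u set" and u v :: "'u \<Rightarrow> 'u" and \<phi> \<chi> :: 'x
  assumes small: "small N" "small M" "small K" and u: "u \<in> N \<rightarrow>\<^sub>E M" and v: "v \<in> K \<rightarrow> M" and \<phi>:
      "\<phi> \<in> fiber X N"
begin

abbreviation "L0 \<equiv> pb K N (restrict v K) u"

lemma pb_props: "small L0" "ufst \<in> L0 \<rightarrow> K" "usnd \<in> L0 \<rightarrow> N" "\<And>l. l \<in> L0 \<Longrightarrow> v (ufst l) = u (usnd l)"
proof -
  show "small L0"
    by (rule small_upair[OF small(3,1)]) (auto simp: pb_def)
qed (auto simp: pb_def)

lemma pb_map: "restrict v K \<in> K \<rightarrow>\<^sub>E M"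
  using v by auto

lemma pb_Pred: "\<phi> \<in> Pred X" "base X \<phi> = N"
  using \<phi> by (auto simp: fiber_def)

lemma pb_reindex: "reindex X L0 (restrict usnd L0) \<phi> = pull L0 usnd \<phi>" "pull L0 usnd \<phi> \<in> fiber X L0"
  using pull_fiber[OF pb_Pred(1) pb_props(1), of usnd] pb_props(3) pb_Pred(2)
      by (simp_all add: pull_def)

lemma ufst_pb: "restrict ufst L0 \<in> L0 \<rightarrow>\<^sub>E K"
  using pb_props(2) by auto

text \<open>The condition in \<open>models_all\<close> concerns values picked by
  \<open>all_along\<close>. Adjoint values are unique up to isomorphism, so it passes to every
  \<chi>; in the form \<open>is_all\<close> it can be used directly as an adjunction over the fibre
  product.\<close>

lemma BC_all:
  assumes m: "models_all X" and \<chi>: "is_all X N M u \<phi> \<chi>"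
  shows "is_all X L0 K (restrict ufst L0) (pull L0 usnd \<phi>) (pull K v \<chi>)"
proof -
  let ?A = "all_along X N M u \<phi>" and ?A' = "all_along X L0 K (restrict ufst L0) (pull L0 usnd \<phi>)"
  have A: "is_all X N M u \<phi> ?A"
    by (rule is_all_all_along[OF m small(1,2) u \<phi>])
  have A': "is_all X L0 K (restrict ufst L0) (pull L0 usnd \<phi>) ?A'"
    by (rule is_all_all_along[OF m pb_props(1) small(3) ufst_pb pb_reindex(2)])
  have iso1: "iso X (pull K v ?A) ?A'"
    using m[unfolded models_all_def, THEN conjunct2, rule_format,
      OF pullback_square_pb[OF small(3,1,2) u pb_map] \<phi>] by (simp only: pull_def)
  have b: "base X \<chi> = M"
    using \<chi> by (simp add: is_all_def fiber_def)
  have "iso X \<chi> ?A"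
    unfolding iso_def using is_all_unique \<chi> A by blast
  then have "iso X (pull K v \<chi>) (pull K v ?A)"
    using pull_iso[OF _ small(3)] v b by blast
  then have i: "iso X (pull K v \<chi>) ?A'"
    using iso1 iso_trans by blast
  then have "le X \<psi> ?A' \<longleftrightarrow> le X \<psi> (pull K v \<chi>)" for \<psi>
    unfolding iso_def using le_trans by blast
  then show ?thesis
    using A' iso_Pred[OF i] unfolding is_all_def fiber_def by auto
qed

lemma BC_ex:
  assumes m: "models_ex X" and \<chi>: "is_ex X N M u \<phi> \<chi>"
  shows "iso X (pull K v \<chi>) (ex_along X L0 K (restrict ufst L0) (pull L0 usnd \<phi>))"
proof -
  let ?A = "ex_along X N M u \<phi>" and ?A' = "ex_along X L0 K (restrict ufst L0) (pull L0 usnd \<phi>)"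
  have A: "is_ex X N M u \<phi> ?A"
    by (rule is_ex_ex_along[OF m small(1,2) u \<phi>])
  have iso1: "iso X (pull K v ?A) ?A'"
    using m[unfolded models_ex_def, THEN conjunct2, rule_format,
      OF pullback_square_pb[OF small(3,1,2) u pb_map] \<phi>] by (simp only: pull_def)
  have b: "base X \<chi> = M"
    using \<chi> by (simp add: is_ex_def fiber_def)
  have "iso X \<chi> ?A"
    unfolding iso_def using is_ex_unique \<chi> A by blast
  then have "iso X (pull K v \<chi>) (pull K v ?A)"
    using pull_iso[OF _ small(3)] v b by blast
  then show ?thesis
    using iso1 iso_trans by blast
qed

end

text \<open>The Kripke-Joyal clause for \<forall>. A later stage with an element of the fibre is a
  map into the fibre product, so the generic instance is \<theta> reindexed to that product, with
  the second projection as \<open>n\<close>.\<close>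

lemma all_lifts_iff:
  assumes m: "models_all X" and small: "small N" "small M" and u: "u \<in> N \<rightarrow>\<^sub>E M" and \<phi>:
      "\<phi> \<in> fiber X N"
    and \<chi>: "is_all X N M u \<phi> \<chi>" and \<theta>: "\<theta> \<in> Pred X" "v \<in> base X \<theta> \<rightarrow> M"
  shows "lifts \<theta> v \<chi> \<longleftrightarrow> (\<forall>\<zeta> t n. lifts \<zeta> t \<theta> \<and> n \<in> base X \<zeta> \<rightarrow> N \<and> (\<forall>x\<in>base X \<zeta>. u (n x) = v (t x)) \<longrightarrow>
      lifts \<zeta> n \<phi>)"
    (is "_ \<longleftrightarrow> ?r")
proof -
  let ?B = "base X \<theta>"
  let ?L = "pb ?B N (restrict v ?B) u"
  note B = small_base[OF \<theta>(1)]
  note pbp = pb_props[OF small B u \<theta>(2) \<phi>]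
  have \<phi>': "\<phi> \<in> Pred X" "base X \<phi> = N" and \<chi>': "\<chi> \<in> Pred X" "base X \<chi> = M"
    using \<phi> \<chi> by (auto simp: fiber_def is_all_def)
  have v: "v \<in> ?B \<rightarrow> base X \<chi>"
    using \<theta>(2) \<chi>' by simp
  have un: "usnd \<in> ?L \<rightarrow> base X \<phi>"
    using pbp(3) \<phi>' by simp
  have "lifts \<theta> v \<chi> \<longleftrightarrow> le X \<theta> (pull ?B v \<chi>)"
    using le_pull_iff[OF \<chi>'(1) B v] by simp
  also have "\<dots> \<longleftrightarrow> le X (pull ?L ufst \<theta>) (pull ?L usnd \<phi>)"
    using BC_all[OF small B u \<theta>(2) \<phi> m \<chi>] \<theta>(1) unfolding is_all_def fiber_def pull_def by blast
  also have "\<dots> \<longleftrightarrow> lifts (pull ?L ufst \<theta>) usnd \<phi>"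
    using le_pull_iff[OF \<phi>'(1) pbp(1) un] base_pull[OF \<theta>(1) pbp(1,2)] by simp
  also have "\<dots> \<longleftrightarrow> ?r"
  proof
    assume l: "lifts (pull ?L ufst \<theta>) usnd \<phi>"
    show ?r
    proof (intro allI impI, elim conjE)
      fix \<zeta> t n assume t: "lifts \<zeta> t \<theta>" and n: "n \<in> base X \<zeta> \<rightarrow> N" "\<forall>x\<in>base X \<zeta>. u (n x) = v (t x)"
      have p: "(\<lambda>x. upair (t x) (n x)) \<in> base X \<zeta> \<rightarrow> ?L"
        using n liftsD(3)[OF t] unfolding pb_def by fastforce
      have "lifts \<zeta> (\<lambda>x. upair (t x) (n x)) (pull ?L ufst \<theta>)"
        using lifts_pull_iff[OF \<theta>(1) pbp(1,2) p] t by simp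
      from lifts_comp[OF this l] show "lifts \<zeta> n \<phi>"
        by simp
    qed
  next
    assume r: ?r
    have "lifts (pull ?L ufst \<theta>) ufst \<theta>"
      by (rule lifts_pull[OF \<theta>(1) pbp(1,2)])
    then show "lifts (pull ?L ufst \<theta>) usnd \<phi>"
      by (intro r[rule_format, of _ ufst]) (simp add: pbp(3) pbp(4)[symmetric] base_pull[OF \<theta>(1)
          pbp(1,2)])
  qed
  finally show ?thesis .
qed

lemma ex_unit:
  assumes "is_ex X N M u \<phi> \<chi>" "small N" "u \<in> N \<rightarrow>\<^sub>E M" "\<phi> \<in> fiber X N"
  shows "lifts \<phi> u \<chi>"
proof -
  have \<chi>: "\<chi> \<in> Pred X" "base X \<chi> = M" "base X \<phi> = N"
    using assms by (auto simp: is_ex_def fiber_def)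
  then have "le X \<phi> (reindex X N u \<chi>)"
    using assms(1) le_refl[OF \<chi>(1)] unfolding is_ex_def by blast
  moreover have "u \<in> N \<rightarrow> base X \<chi>"
    using assms(3) \<chi> by auto
  ultimately show ?thesis
    using le_pull_iff[OF \<chi>(1) assms(2)] \<chi>(3) reindex_eq_pull[OF assms(3)] by simp
qed

text \<open>Reindexing \<psi> along \<open>t\<close> turns the claim into an inequality over
  \<open>M\<close>, where the adjunction applies.\<close>

lemma ex_elim:
  assumes "is_ex X N M u \<phi> \<chi>" "small N" "small M" "u \<in> N \<rightarrow>\<^sub>E M" "\<phi> \<in> fiber X N"
    and \<psi>: "\<psi> \<in> Pred X" and t: "t \<in> M \<rightarrow> base X \<psi>" and lifts: "lifts \<phi> (\<lambda>x. t (u x)) \<psi>"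
  shows "lifts \<chi> t \<psi>"
proof -
  have \<chi>: "\<chi> \<in> Pred X" "base X \<chi> = M" "base X \<phi> = N"
    using assms by (auto simp: is_ex_def fiber_def)
  have R: "pull M t \<psi> \<in> Pred X" "base X (pull M t \<psi>) = M"
    using pull_Pred[OF \<psi> assms(3) t] base_pull[OF \<psi> assms(3) t] by simp_all
  have u: "u \<in> N \<rightarrow> M"
    using assms(4) by auto
  have "lifts \<phi> u (pull M t \<psi>)"
    using lifts_pull_iff[OF \<psi> assms(3) t, of u \<phi>] u \<chi>(3) lifts by simp
  then have "le X \<phi> (reindex X N u (pull M t \<psi>))"
    using le_pull_iff[OF R(1) assms(2), of u \<phi>] u R(2) \<chi>(3) reindex_eq_pull[OF assms(4)] by simp
  then have "le X \<chi> (pull M t \<psi>)"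
    using assms(1) R by (simp add: is_ex_def fiber_def)
  then show ?thesis
    using le_pull_iff[OF \<psi> assms(3) t \<chi>(2)] by simp
qed

lemma is_ex_iso:
  assumes "is_ex X N M u \<phi> \<chi>" "iso X \<phi> \<phi>'" "iso X \<chi> \<chi>'"
  shows "is_ex X N M u \<phi>' \<chi>'"
proof -
  have "le X \<chi>' \<psi> \<longleftrightarrow> le X \<chi> \<psi>" "le X \<phi>' \<psi> \<longleftrightarrow> le X \<phi> \<psi>" for \<psi>
    using assms(2,3) le_trans unfolding iso_def by blast+
  then show ?thesis
    using assms iso_Pred[OF assms(3)] by (simp add: is_ex_def fiber_def)
qed

end

section \<open>The typed pca of a presented fibration\<close>

locale presented = posetal_fib X for X :: "('u, 'x) fibration" +
  fixes I :: "'u set" and A :: "'u \<Rightarrow> 'u set" and \<pi> :: "'u \<Rightarrow> 'x"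
  assumes models: "models_top X" "models_meet X" "models_imp X" "models_ex X" "models_all X"
    and small_I: "small I" and small_A: "i \<in> I \<Longrightarrow> small (A i)"
    and \<pi>_fiber: "i \<in> I \<Longrightarrow> \<pi> i \<in> fiber X (A i)"
    and \<pi>_prime: "i \<in> I \<Longrightarrow> ex_prime X (A i) (\<pi> i)"
    and closed: "closed_under_finite_meets X (generated_subfibration X I A \<pi>)"
    and \<pi>_modest: "i \<in> I \<Longrightarrow> modest (generated_subfibration X I A \<pi>) (A i) (\<pi> i)"
    and generates: "generates_under_ex X (generated_subfibration X I A \<pi>)"
begin

abbreviation "\<G> \<equiv> generated_subfibration X I A \<pi>"

lemma \<pi>: "i \<in> I \<Longrightarrow> \<pi> i \<in> Pred X" "i \<in> I \<Longrightarrow> base X (\<pi> i) = A i"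
  using \<pi>_fiber by (auto simp: fiber_def)

lemma \<G>_pull: "\<phi> \<in> Pred \<G> \<Longrightarrow> small N \<Longrightarrow> u \<in> N \<rightarrow> base X \<phi> \<Longrightarrow> pull N u \<phi> \<in> Pred \<G>"
  by (rule generated_pull[of I \<pi> A]) (rule \<pi>_fiber)

definition atom :: "'u set \<Rightarrow> 'u \<Rightarrow> ('u \<Rightarrow> 'u) \<Rightarrow> 'x" where
  "atom M i f = pull M f (\<pi> i)"

lemma atom:
  assumes "i \<in> I" "small M" "f \<in> M \<rightarrow> A i"
  shows "atom M i f \<in> Pred X" "base X (atom M i f) = M" "lifts (atom M i f) f (\<pi> i)"
      "atom M i f \<in> Pred \<G>"
    "v \<in> base X \<chi> \<rightarrow> M \<Longrightarrow> lifts \<chi> v (atom M i f) \<longleftrightarrow> lifts \<chi> (\<lambda>x. f (v x)) (\<pi> i)"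
proof -
  have f: "f \<in> M \<rightarrow> base X (\<pi> i)"
    using assms \<pi> by simp
  show "atom M i f \<in> Pred X" "base X (atom M i f) = M" "lifts (atom M i f) f (\<pi> i)"
      "atom M i f \<in> Pred \<G>"
    "v \<in> base X \<chi> \<rightarrow> M \<Longrightarrow> lifts \<chi> v (atom M i f) \<longleftrightarrow> lifts \<chi> (\<lambda>x. f (v x)) (\<pi> i)"
    unfolding atom_def
    using pull_Pred[OF \<pi>(1)[OF assms(1)] assms(2) f] base_pull[OF \<pi>(1)[OF assms(1)] assms(2) f]
      lifts_pull[OF \<pi>(1)[OF assms(1)] assms(2) f] lifts_pull_iff[OF \<pi>(1)[OF assms(1)] assms(2) f]
      generated_atom[of \<pi> i A I M f, OF \<pi>_fiber[OF assms(1)] assms] by simp_all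
qed

lemma \<G>_atom:
  assumes "\<phi> \<in> Pred \<G>"
  obtains i f where "i \<in> I" "f \<in> base X \<phi> \<rightarrow> A i" "iso X \<phi> (atom (base X \<phi>) i f)"
  using assms unfolding generated_iff atom_def by blast

text \<open>A descent principle: a value \<open>f\<close> on \<open>K\<close>, entailed by data that
  depend only on the image under the surjection \<open>e\<close>, is itself a function of that
  image, and the entailment holds already over \<open>J\<close>.\<close>

lemma modest_lifts:
  assumes i: "i \<in> I" and k: "k \<in> I" and small: "small J" "small K"
    and e: "e \<in> K \<rightarrow> J" "e ` K = J" and f: "f \<in> K \<rightarrow> A i" and q: "q \<in> J \<rightarrow> A k"
    and lifts: "lifts (atom K k (\<lambda>x. q (e x))) f (\<pi> i)"
  obtains h where "h \<in> J \<rightarrow> A i" "\<forall>x\<in>K. h (e x) = f x" "lifts (atom J k q) h (\<pi> i)"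
proof -
  have sub: "Pred \<G> \<subseteq> Pred X"
    by (auto simp: generated_subfibration_def)
  have G: "\<pi> i \<in> Pred \<G>"
  proof -
    have "iso X (\<pi> i) (pull (A i) (\<lambda>x. x) (\<pi> i))"
      using le_refl[OF \<pi>(1)[OF i]] lifts_pull[OF \<pi>(1)[OF i] small_A[OF i], of "\<lambda>x. x"]
        le_pull_iff[OF \<pi>(1)[OF i] small_A[OF i], of "\<lambda>x. x" "\<pi> i"] \<pi>[OF i]
        base_pull[OF \<pi>(1)[OF i] small_A[OF i], of "\<lambda>x. x"] lifts_id[OF \<pi>(1)[OF i]]
      by (simp add: iso_def le_iff_lifts)
    then show ?thesis
      unfolding generated_iff using \<pi>[OF i] i by (auto intro!: bexI[of _ i] bexI[of _ "\<lambda>x. x"])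
  qed
  have qe: "(\<lambda>x. q (e x)) \<in> K \<rightarrow> A k"
    using q e by auto
  note J = atom[OF k small(1) q] and K = atom[OF k small(2) qe]
  have eJ: "e \<in> K \<rightarrow> base X (atom J k q)"
    using e J by simp
  have "lifts (pull K e (atom J k q)) f (\<pi> i)"
  proof (rule lifts_le[OF _ lifts])
    have *: "base X (pull K e (atom J k q)) = K"
      using base_pull[OF J(1) small(2) eJ] .
    have "lifts (pull K e (atom J k q)) (\<lambda>x. x) (atom K k (\<lambda>x. q (e x)))"
      using atom(5)[OF k small(2) qe, of "\<lambda>x. x" "pull K e (atom J k q)"] * lifts_comp[OF
          lifts_pull[OF J(1) small(2) eJ] J(3)]
      by simp
    then show "le X (pull K e (atom J k q)) (atom K k (\<lambda>x. q (e x)))"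
      by (simp add: le_iff_lifts * K(2))
  qed
  have "modest (X\<lparr>Pred := Pred \<G>\<rparr>) (A i) (\<pi> i)"
    using \<pi>_modest[OF i] generated_subfibration_eq by metis
  then have "(\<forall>J K e f \<phi>. small J \<and> small K \<and> e \<in> K \<rightarrow> J \<and> e ` K = J \<and> f \<in> K \<rightarrow> A i \<and>
       \<phi> \<in> Pred \<G> \<and> base X \<phi> = J \<and> lifts (pull K e \<phi>) f (\<pi> i) \<longrightarrow>
       (\<exists>h\<in>J \<rightarrow> A i. (\<forall>x\<in>K. h (e x) = f x) \<and> lifts \<phi> h (\<pi> i)))"
    by (rule modest_sub_iff[OF sub _ G \<pi>(2)[OF i], THEN iffD1, rotated]) (erule (2) \<G>_pull)
  from this[rule_format, of J K e f "atom J k q"] small e f J \<open>lifts (pull K e (atom J k q)) f (\<pi>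
      i)\<close>
  have "\<exists>h\<in>J \<rightarrow> A i. (\<forall>x\<in>K. h (e x) = f x) \<and> lifts (atom J k q) h (\<pi> i)"
    by blast
  then show ?thesis
    using that by blast
qed

text \<open>Primality concerns quantification along a map into \<open>J\<close> itself. Therefore
  \<chi> is pulled back along \<open>v\<close>; by Beck-Chevalley this is quantification along the
  projection from the fibre product of \<open>J\<close> and \<open>N\<close>. The second component
  of the resulting map is \<open>w\<close>.\<close>

lemma ex_prime_lifts:
  assumes i: "i \<in> I" and small: "small J" "small N" "small M" and f: "f \<in> J \<rightarrow> A i"
    and u: "u \<in> N \<rightarrow>\<^sub>E M" and \<phi>: "\<phi> \<in> fiber X N" and \<chi>: "is_ex X N M u \<phi> \<chi>" and v: "v \<in> J \<rightarrow> M"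
    and lifts: "lifts (atom J i f) v \<chi>"
  obtains L e w where "small L" "e \<in> L \<rightarrow> J" "e ` L = J" "w \<in> L \<rightarrow> N" "\<forall>x\<in>L. u (w x) = v (e x)"
    "lifts (atom L i (\<lambda>x. f (e x))) w \<phi>"
proof -
  note J = atom[OF i small(1) f]
  let ?L = "pb J N (restrict v J) u"
  note p = pb_props[OF small(2,3,1) u v \<phi>]
  have \<chi>': "\<chi> \<in> Pred X" "base X \<chi> = M" and \<phi>': "\<phi> \<in> Pred X" "base X \<phi> = N"
    using \<chi> \<phi> by (auto simp: is_ex_def fiber_def)
  have un: "usnd \<in> ?L \<rightarrow> base X \<phi>"
    using p(3) \<phi>' by simp
  let ?\<theta> = "pull ?L usnd \<phi>"
  have \<theta>: "?\<theta> \<in> Pred X" "base X ?\<theta> = ?L" "?\<theta> \<in> fiber X ?L"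
    using pull_Pred[OF \<phi>'(1) p(1) un] base_pull[OF \<phi>'(1) p(1) un] by (simp_all add: fiber_def)
  have "le X (atom J i f) (pull J v \<chi>)"
    using le_pull_iff[OF \<chi>'(1) small(1), of v "atom J i f"] J(2) v \<chi>'(2) lifts by simp
  then have le: "le X (reindex X J (restrict f J) (\<pi> i)) (ex_along X ?L J (restrict ufst ?L) ?\<theta>)"
    using BC_ex[OF small(2,3,1) u v \<phi> models(4) \<chi>] le_trans unfolding iso_def atom_def pull_def
        by blast
  have "restrict f J \<in> J \<rightarrow>\<^sub>E A i" "restrict ufst ?L \<in> ?L \<rightarrow>\<^sub>E J"
    using f p(2) by auto
  then obtain L e w where L: "small L" "surjection L J e" "w \<in> L \<rightarrow>\<^sub>E ?L"
      "compose L (restrict ufst ?L) w = e"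
    and le': "le X (reindex X L (compose L (restrict f J) e) (\<pi> i)) (reindex X L w ?\<theta>)"
    using \<pi>_prime[OF i] small(1) p(1) \<theta>(3) le unfolding ex_prime_def by meson
  have e: "e \<in> L \<rightarrow> J" "e ` L = J" "restrict e L = e"
    using L(2) by (auto simp: surjection_def PiE_restrict)
  have w: "w \<in> L \<rightarrow> ?L"
    using L(3) by auto
  have ew: "e x = ufst (w x)" if "x \<in> L" for x
  proof -
    have "w x \<in> ?L"
      using that w by blast
    then show ?thesis
      using fun_cong[OF L(4), of x] that by (simp add: compose_def)
  qed
  have fe: "(\<lambda>x. f (e x)) \<in> L \<rightarrow> A i"
    using e f by auto
  note LA = atom[OF i L(1) fe]
  have "compose L (restrict f J) e = restrict (\<lambda>x. f (e x)) L"
    using compose_restrict[OF e(1), of f] e(3) by simp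
  then have "reindex X L (compose L (restrict f J) e) (\<pi> i) = atom L i (\<lambda>x. f (e x))"
    by (simp add: atom_def pull_def)
  then have "le X (atom L i (\<lambda>x. f (e x))) (pull L w ?\<theta>)"
    using le' reindex_eq_pull[OF L(3)] by simp
  then have "lifts (atom L i (\<lambda>x. f (e x))) w ?\<theta>"
    using le_pull_iff[OF \<theta>(1) L(1), of w] w \<theta>(2) LA(2) by simp
  then have "lifts (atom L i (\<lambda>x. f (e x))) (\<lambda>x. usnd (w x)) \<phi>"
    using lifts_pull_iff[OF \<phi>'(1) p(1) un, of w] w LA(2) by simp
  moreover have "\<forall>x\<in>L. u (usnd (w x)) = v (e x)"
  proof
    fix x assume x: "x \<in> L"
    then have "w x \<in> ?L"
      using w by blast
    then show "u (usnd (w x)) = v (e x)"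
      using p(4) ew[OF x] by simp
  qed
  moreover have "(\<lambda>x. usnd (w x)) \<in> L \<rightarrow> N"
    using w p(3) by auto
  ultimately show ?thesis
    using that L(1) e(1,2) by blast
qed

section \<open>Products, truth and arrow objects among the generators\<close>

definition is_prod :: "'u \<Rightarrow> 'u \<Rightarrow> 'u \<Rightarrow> ('u \<Rightarrow> 'u \<Rightarrow> 'u) \<Rightarrow> bool" where
  "is_prod i j k pf \<longleftrightarrow> k \<in> I \<and> (\<forall>a\<in>A i. \<forall>b\<in>A j. pf a b \<in> A k) \<and>
     (\<forall>\<chi> u v. \<chi> \<in> Pred X \<and> u \<in> base X \<chi> \<rightarrow> A i \<and> v \<in> base X \<chi> \<rightarrow> A j \<longrightarrow>
        lifts \<chi> (\<lambda>x. pf (u x) (v x)) (\<pi> k) = (lifts \<chi> u (\<pi> i) \<and> lifts \<chi> v (\<pi> j)))"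

text \<open>\<open>A k\<close> need not be the cartesian product: \<open>pf\<close> is merely a map
  into it along which \<open>\<pi> k\<close> becomes the meet. That this meet is a reindexing of one
  of the generators is closure under finite meets.\<close>

lemma ex_prod:
  assumes i: "i \<in> I" and j: "j \<in> I"
  shows "\<exists>k pf. is_prod i j k pf"
proof -
  define M where "M = {upair a b |a b. a \<in> A i \<and> b \<in> A j}"
  have M: "small M"
    by (rule small_upair[OF small_A[OF i] small_A[OF j]]) (auto simp: M_def)
  have p: "ufst \<in> M \<rightarrow> A i" "usnd \<in> M \<rightarrow> A j"
    by (auto simp: M_def)
  note P1 = atom[OF i M p(1)] and P2 = atom[OF j M p(2)]
  obtain \<chi>0 where \<chi>0: "is_meet X (atom M i ufst) (atom M j usnd) \<chi>0"
    using models(2) M P1 P2 unfolding models_meet_def fiber_def by blast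
  then have G: "\<chi>0 \<in> Pred \<G>"
    using closed[unfolded closed_under_finite_meets_def, THEN conjunct2] P1(4) P2(4) by blast
  have b: "base X \<chi>0 = M"
    using \<chi>0 P1(2) by (simp add: is_meet_def le_iff_lifts)
  with G obtain k f where k: "k \<in> I" and f: "f \<in> M \<rightarrow> A k" and iso: "iso X \<chi>0 (atom M k f)"
    using \<G>_atom by metis
  have "is_prod i j k (\<lambda>a b. f (upair a b))"
    unfolding is_prod_def
  proof (intro conjI ballI allI impI k, goal_cases)
    case (1 a b)
    then show ?case
      using f by (auto simp: M_def)
  next
    case (2 \<chi> u v)
    then have uv: "(\<lambda>x. upair (u x) (v x)) \<in> base X \<chi> \<rightarrow> M"
      unfolding M_def by blast
    have "lifts \<chi> (\<lambda>x. f (upair (u x) (v x))) (\<pi> k) \<longleftrightarrow> lifts \<chi> (\<lambda>x. upair (u x) (v x)) (atom M k f)"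
      using atom(5)[OF k M f uv] by simp
    also have "\<dots> \<longleftrightarrow> lifts \<chi> (\<lambda>x. upair (u x) (v x)) \<chi>0"
      using iso_lifts_right[OF iso] by simp
    also have "\<dots> \<longleftrightarrow> lifts \<chi> (\<lambda>x. upair (u x) (v x)) (atom M i ufst) \<and>
        lifts \<chi> (\<lambda>x. upair (u x) (v x)) (atom M j usnd)"
      by (rule meet_lifts_iff[OF models(2) \<chi>0])
    also have "\<dots> \<longleftrightarrow> lifts \<chi> u (\<pi> i) \<and> lifts \<chi> v (\<pi> j)"
      using P1(5)[OF uv] P2(5)[OF uv] by simp
    finally show ?case .
  qed
  then show ?thesis
    by blast
qed

text \<open>Truth over a one-element set lies in the generated subfibration, so it is a reindexing
  of some \<open>\<pi> l\<close>. The image of the point is an element \<open>t\<close> at which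
  \<open>\<pi> l\<close> always holds; it will serve as a parameter without content.\<close>

lemma ex_terminal: "\<exists>l t. l \<in> I \<and> t \<in> A l \<and> (\<forall>\<chi>\<in>Pred X. lifts \<chi> (\<lambda>_. t) (\<pi> l))"
proof -
  fix x :: 'u
  have x: "small {x}"
    by (simp add: small_finite)
  obtain \<tau> where \<tau>: "is_top X {x} \<tau>"
    using models(1) x unfolding models_top_def by blast
  then have \<tau>': "\<tau> \<in> Pred X" "base X \<tau> = {x}" "\<tau> \<in> Pred \<G>"
    using closed[unfolded closed_under_finite_meets_def, THEN conjunct1] x
        by (auto simp: is_top_def fiber_def)
  then obtain l f where l: "l \<in> I" and f: "f \<in> {x} \<rightarrow> A l" and iso: "iso X \<tau> (atom {x} l f)"
    using \<G>_atom by metis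
  have "lifts \<chi> (\<lambda>_. f x) (\<pi> l)" if \<chi>: "\<chi> \<in> Pred X" for \<chi>
  proof -
    let ?u = "restrict (\<lambda>_. x) (base X \<chi>)"
    have u: "?u \<in> base X \<chi> \<rightarrow>\<^sub>E {x}" and u': "(\<lambda>_. x) \<in> base X \<chi> \<rightarrow> base X \<tau>"
      using \<tau>' by auto
    have "is_top X (base X \<chi>) (reindex X (base X \<chi>) ?u \<tau>)"
      using models(1) x small_base[OF \<chi>] u \<tau> unfolding models_top_def by blast
    then have "le X \<chi> (pull (base X \<chi>) (\<lambda>_. x) \<tau>)"
      using \<chi> by (simp add: is_top_def fiber_def pull_def)
    then have "lifts \<chi> (\<lambda>_. x) \<tau>"
      using le_pull_iff[OF \<tau>'(1) small_base[OF \<chi>] u'] by simp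
    then have "lifts \<chi> (\<lambda>_. x) (atom {x} l f)"
      using iso_lifts_right[OF iso] by simp
    then show ?thesis
      using atom(5)[OF l x f, of "\<lambda>_. x" \<chi>] by simp
  qed
  then show ?thesis
    using l f by blast
qed

text \<open>\<open>is_exp i j k R\<close>: the ternary relation \<open>R a b c\<close> is the graph of a partial application
  \<open>A k \<times> A i \<rightharpoonup> A j\<close> that is sound for \<open>\<pi>\<close>, and currying is possible with parameters in any \<open>A l\<close>.\<close>

definition is_exp :: "'u \<Rightarrow> 'u \<Rightarrow> 'u \<Rightarrow> ('u \<Rightarrow> 'u \<Rightarrow> 'u \<Rightarrow> bool) \<Rightarrow> bool" where
  "is_exp i j k R \<longleftrightarrow> k \<in> I \<and>
     (\<forall>a b c. R a b c \<longrightarrow> a \<in> A k \<and> b \<in> A i \<and> c \<in> A j) \<and>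
     (\<forall>a b c c'. R a b c \<longrightarrow> R a b c' \<longrightarrow> c = c') \<and>
     (\<forall>\<chi> a b c. (\<forall>x\<in>base X \<chi>. R (a x) (b x) (c x)) \<longrightarrow> lifts \<chi> a (\<pi> k) \<longrightarrow> lifts \<chi> b (\<pi> i) \<longrightarrow>
       lifts \<chi> c (\<pi> j)) \<and>
     (\<forall>l B (J :: 'u set) r p g f. l \<in> I \<longrightarrow> small B \<longrightarrow> small J \<longrightarrow> r \<in> B \<rightarrow> A l \<longrightarrow> p \<in> J \<rightarrow> B \<longrightarrow>
       g \<in> J \<rightarrow> A i \<longrightarrow> f \<in> J \<rightarrow> A j \<longrightarrow>
        (\<forall>\<chi> t. t \<in> base X \<chi> \<rightarrow> J \<longrightarrow> lifts \<chi> (\<lambda>x. r (p (t x))) (\<pi> l) \<longrightarrow> lifts \<chi> (\<lambda>x. g (t x)) (\<pi> i) \<longrightarrow>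
          lifts \<chi> (\<lambda>x. f (t x)) (\<pi> j)) \<longrightarrow>
        (\<exists>c\<in>B \<rightarrow> A k. lifts (atom B l r) c (\<pi> k) \<and> (\<forall>x\<in>J. R (c (p x)) (g x) (f x))))"

text \<open>\<open>U\<close> is the membership relation between codes and pairs. Over it stands the
  implication \<sigma> between the two components of a pair, and \<rho> quantifies \<sigma>
  universally along the projection to codes. The clause merges the forcing clauses of \<forall> and
  implication, with one later stage in place of two nested ones.\<close>

lemma implication_object:
  assumes i: "i \<in> I" and j: "j \<in> I" and F: "small F" and dec: "\<And>r. r \<in> F \<Longrightarrow>
      dec r \<subseteq> {upair a b |a b. a \<in> A i \<and> b \<in> A j}"
  obtains \<rho> where "\<rho> \<in> fiber X F"
    "\<forall>\<theta> r. \<theta> \<in> Pred X \<longrightarrow> r \<in> base X \<theta> \<rightarrow> F \<longrightarrow> lifts \<theta> r \<rho> =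
      (\<forall>\<zeta> t b c. lifts \<zeta> t \<theta> \<and> (\<forall>x\<in>base X \<zeta>. upair (b x) (c x) \<in> dec (r (t x))) \<and> lifts \<zeta> b (\<pi> i) \<longrightarrow>
        lifts \<zeta> c (\<pi> j))"
proof -
  define U where "U = {upair r p |r p. r \<in> F \<and> p \<in> dec r}"
  have dec': "\<exists>a\<in>A i. \<exists>b\<in>A j. p = upair a b" if "r \<in> F" "p \<in> dec r" for r p
    using dec that by blast
  have U_iff: "upair r p \<in> U \<longleftrightarrow> r \<in> F \<and> p \<in> dec r" for r p
    by (auto simp: U_def)
  have UE: "\<exists>r\<in>F. \<exists>a\<in>A i. \<exists>b\<in>A j. upair a b \<in> dec r \<and> z = upair r (upair a b)" if "z \<in> U" for z
    using that dec' unfolding U_def by blast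
  have W: "small {upair a b |a b. a \<in> A i \<and> b \<in> A j}"
    by (rule small_upair[OF small_A[OF i] small_A[OF j]]) auto
  have U: "small U"
  proof (rule small_upair[OF F W])
    fix z assume "z \<in> U"
    then obtain r p where z: "z = upair r p" and r: "r \<in> F" and p: "p \<in> dec r"
      unfolding U_def by blast
    show "\<exists>r\<in>F. \<exists>p\<in>{upair a b |a b. a \<in> A i \<and> b \<in> A j}. z = upair r p"
      by (rule bexI[OF _ r], rule bexI[OF _ subsetD[OF dec[OF r] p]], rule z)
  qed
  have p: "(\<lambda>z. ufst (usnd z)) \<in> U \<rightarrow> A i" "(\<lambda>z. usnd (usnd z)) \<in> U \<rightarrow> A j" "ufst \<in> U \<rightarrow> F"
    using UE by fastforce+
  note P1 = atom[OF i U p(1)] and P2 = atom[OF j U p(2)]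
  let ?u = "restrict ufst U"
  have u: "?u \<in> U \<rightarrow>\<^sub>E F"
    using p(3) by auto
  obtain \<sigma> where \<sigma>: "is_imp X (atom U i (\<lambda>z. ufst (usnd z))) (atom U j (\<lambda>z. usnd (usnd z))) \<sigma>"
    using models(3) U P1 P2 unfolding models_imp_def fiber_def by blast
  then have \<sigma>': "\<sigma> \<in> fiber X U"
    using P1 by (simp add: is_imp_def)
  obtain \<rho> where \<rho>: "is_all X U F ?u \<sigma> \<rho>"
    using models(5) U F u \<sigma>' unfolding models_all_def by blast
  have \<sigma>_iff: "lifts \<theta> v \<sigma> \<longleftrightarrow> (\<forall>\<chi> t. lifts \<chi> t \<theta> \<and> lifts \<chi> (\<lambda>x. ufst (usnd (v (t x)))) (\<pi> i) \<longrightarrow>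
      lifts \<chi> (\<lambda>x. usnd (usnd (v (t x)))) (\<pi> j))"
    if \<theta>: "\<theta> \<in> Pred X" and v: "v \<in> base X \<theta> \<rightarrow> U" for \<theta> v
  proof -
    have "lifts \<theta> v \<sigma> \<longleftrightarrow> (\<forall>\<chi> t. lifts \<chi> t \<theta> \<and> lifts \<chi> (\<lambda>x. v (t x)) (atom U i (\<lambda>z. ufst (usnd z))) \<longrightarrow>
        lifts \<chi> (\<lambda>x. v (t x)) (atom U j (\<lambda>z. usnd (usnd z))))"
      by (rule imp_lifts_iff[OF models(2,3) \<sigma> P1(1) P2(1) _ \<theta>]) (use P1(2) P2(2) v in simp_all)
    also have "\<dots> \<longleftrightarrow> (\<forall>\<chi> t. lifts \<chi> t \<theta> \<and> lifts \<chi> (\<lambda>x. ufst (usnd (v (t x)))) (\<pi> i) \<longrightarrow>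
        lifts \<chi> (\<lambda>x. usnd (usnd (v (t x)))) (\<pi> j))"
    proof (intro all_cong1 imp_cong conj_cong refl)
      fix \<chi> t assume "lifts \<chi> t \<theta> \<and> lifts \<chi> (\<lambda>x. ufst (usnd (v (t x)))) (\<pi> i)"
      then have "(\<lambda>x. v (t x)) \<in> base X \<chi> \<rightarrow> U"
        using v by (auto simp: lifts_def)
      then show "lifts \<chi> (\<lambda>x. v (t x)) (atom U j (\<lambda>z. usnd (usnd z))) = lifts \<chi> (\<lambda>x. usnd (usnd (v
          (t x)))) (\<pi> j)"
        by (rule P2(5))
    next
      fix \<chi> t assume "lifts \<chi> t \<theta>"
      then have "(\<lambda>x. v (t x)) \<in> base X \<chi> \<rightarrow> U"
        using v by (auto simp: lifts_def)
      then show "lifts \<chi> (\<lambda>x. v (t x)) (atom U i (\<lambda>z. ufst (usnd z))) = lifts \<chi> (\<lambda>x. ufst (usnd (v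
          (t x)))) (\<pi> i)"
        by (rule P1(5))
    qed
    finally show ?thesis .
  qed
  have "lifts \<theta> r \<rho> =
      (\<forall>\<zeta> t b c. lifts \<zeta> t \<theta> \<and> (\<forall>x\<in>base X \<zeta>. upair (b x) (c x) \<in> dec (r (t x))) \<and> lifts \<zeta> b (\<pi> i) \<longrightarrow>
        lifts \<zeta> c (\<pi> j))"
    if \<theta>: "\<theta> \<in> Pred X" and r: "r \<in> base X \<theta> \<rightarrow> F" for \<theta> r
  proof -
    note all = all_lifts_iff[OF models(5) U F u \<sigma>' \<rho> \<theta> r]
    show ?thesis
    proof
      assume l: "lifts \<theta> r \<rho>"
      show "\<forall>\<zeta> t b c. lifts \<zeta> t \<theta> \<and> (\<forall>x\<in>base X \<zeta>. upair (b x) (c x) \<in> dec (r (t x))) \<and>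
          lifts \<zeta> b (\<pi> i) \<longrightarrow> lifts \<zeta> c (\<pi> j)"
      proof (intro allI impI, elim conjE)
        fix \<zeta> t b c
        assume t: "lifts \<zeta> t \<theta>" and bc: "\<forall>x\<in>base X \<zeta>. upair (b x) (c x) \<in> dec (r (t x))" and b:
            "lifts \<zeta> b (\<pi> i)"
        let ?n = "\<lambda>x. upair (r (t x)) (upair (b x) (c x))"
        have rt: "r (t x) \<in> F" if "x \<in> base X \<zeta>" for x
          using r liftsD(3)[OF t that] by blast
        have n: "?n \<in> base X \<zeta> \<rightarrow> U"
          using bc rt by (simp add: U_iff)
        have "\<forall>x\<in>base X \<zeta>. ?u (?n x) = r (t x)"
          using n by (auto simp: Pi_iff)
        then have "lifts \<zeta> ?n \<sigma>"
          using all l t n by blast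
        \<comment> \<open>The implication is instantiated at the stage itself, with the identity as
          further lifting.\<close>
        then have "lifts \<zeta> (\<lambda>x. x) \<zeta> \<and> lifts \<zeta> (\<lambda>x. ufst (usnd (?n x))) (\<pi> i) \<longrightarrow>
            lifts \<zeta> (\<lambda>x. usnd (usnd (?n x))) (\<pi> j)"
          using \<sigma>_iff[OF liftsD(1)[OF t] n] by blast
        then show "lifts \<zeta> c (\<pi> j)"
          using lifts_id[OF liftsD(1)[OF t]] b by simp
      qed
    next
      assume R: "\<forall>\<zeta> t b c. lifts \<zeta> t \<theta> \<and> (\<forall>x\<in>base X \<zeta>. upair (b x) (c x) \<in> dec (r (t x))) \<and>
          lifts \<zeta> b (\<pi> i) \<longrightarrow> lifts \<zeta> c (\<pi> j)"
      show "lifts \<theta> r \<rho>"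
        unfolding all
      proof (intro allI impI, elim conjE)
        fix \<zeta> t n
        assume t: "lifts \<zeta> t \<theta>" and n: "n \<in> base X \<zeta> \<rightarrow> U" and nt: "\<forall>x\<in>base X \<zeta>. ?u (n x) = r (t x)"
        show "lifts \<zeta> n \<sigma>"
          unfolding \<sigma>_iff[OF liftsD(1)[OF t] n]
        proof (intro allI impI, elim conjE)
          fix \<zeta>' t' assume t': "lifts \<zeta>' t' \<zeta>" and b: "lifts \<zeta>' (\<lambda>x. ufst (usnd (n (t' x)))) (\<pi> i)"
          have "upair (ufst (usnd (n (t' x)))) (usnd (usnd (n (t' x)))) \<in> dec (r (t (t' x)))" if
              "x \<in> base X \<zeta>'" for x
          proof -
            have x: "t' x \<in> base X \<zeta>"
              using liftsD(3)[OF t' that] .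
            then have nU: "n (t' x) \<in> U"
              using n by blast
            then have "ufst (n (t' x)) = r (t (t' x))"
              using nt x by auto
            then show ?thesis
              using UE[OF nU] by auto
          qed
          then show "lifts \<zeta>' (\<lambda>x. usnd (usnd (n (t' x)))) (\<pi> j)"
            by (intro R[rule_format, of \<zeta>' "\<lambda>x. t (t' x)"
                "\<lambda>x. ufst (usnd (n (t' x)))"] conjI lifts_comp[OF t' t] b ballI)
        qed
      qed
    qed
  qed
  moreover have "\<rho> \<in> fiber X F"
    using \<rho> by (simp add: is_all_def)
  ultimately show ?thesis
    by (intro that) blast+
qed

lemma ex_exp:
  assumes i: "i \<in> I" and j: "j \<in> I"
  shows "\<exists>k R. is_exp i j k R"
proof -
  define W where "W = {upair a b |a b. a \<in> A i \<and> b \<in> A j}"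
  have "small W"
    by (rule small_upair[OF small_A[OF i] small_A[OF j]]) (auto simp: W_def)
  then obtain F :: "'u set" and dec where F: "small F" and dec: "dec ` F = Pow W"
    by (rule small_Pow_code)
  obtain \<rho> where \<rho>: "\<rho> \<in> fiber X F" and \<rho>_iff: "\<forall>\<theta> r. \<theta> \<in> Pred X \<longrightarrow> r \<in> base X \<theta> \<rightarrow> F \<longrightarrow> lifts \<theta> r \<rho> =
      (\<forall>\<zeta> t b c. lifts \<zeta> t \<theta> \<and> (\<forall>x\<in>base X \<zeta>. upair (b x) (c x) \<in> dec (r (t x))) \<and> lifts \<zeta> b (\<pi> i) \<longrightarrow>
        lifts \<zeta> c (\<pi> j))"
    by (rule implication_object[OF i j F, of dec]) (use dec W_def in blast)+
  have \<rho>P: "\<rho> \<in> Pred X" "base X \<rho> = F"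
    using \<rho> by (auto simp: fiber_def)
  obtain N u \<psi> where N: "small N" and u: "u \<in> N \<rightarrow>\<^sub>E F" and \<psi>: "\<psi> \<in> fiber \<G> N" and iso:
      "iso X \<rho> (ex_along X N F u \<psi>)"
    using generates F \<rho> unfolding generates_under_ex_def by blast
  have \<psi>G: "\<psi> \<in> Pred \<G>" and \<psi>b: "base X \<psi> = N" and \<psi>X: "\<psi> \<in> fiber X N"
    using \<psi> by (auto simp: fiber_def generated_subfibration_def)
  obtain k g where k: "k \<in> I" and "g \<in> base X \<psi> \<rightarrow> A k" and iso': "iso X \<psi> (atom (base X \<psi>) k g)"
    using \<G>_atom[OF \<psi>G] by blast
  then have g: "g \<in> N \<rightarrow> A k"
    using \<psi>b by simp
  note NA = atom[OF k N g]
  have NAf: "atom N k g \<in> fiber X N"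
    using NA by (simp add: fiber_def)
  have ex: "is_ex X N F u (atom N k g) \<rho>"
    using is_ex_iso[OF is_ex_ex_along[OF models(4) N F u \<psi>X] iso' iso_sym[OF iso]] \<psi>b by simp
  have uF: "u n \<in> F" if "n \<in> N" for n
    using u that by auto
  have unit: "lifts (atom N k g) u \<rho>"
    by (rule ex_unit[OF ex N u NAf])
  \<comment> \<open>Application is sound when the stage carries the index \<open>n\<close> in
    \<open>N\<close>, of which \<open>g n\<close> is the image: at \<open>n\<close> the predicate
    \<rho> holds of the relation \<open>u n\<close>.\<close>
  have counit: "lifts \<zeta> c (\<pi> j)"
    if n: "n \<in> base X \<zeta> \<rightarrow> N" and gn: "lifts \<zeta> (\<lambda>x. g (n x)) (\<pi> k)" and b: "lifts \<zeta> b (\<pi> i)"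
      and bc: "\<forall>x\<in>base X \<zeta>. upair (b x) (c x) \<in> dec (u (n x))" for \<zeta> n b c
  proof -
    have \<zeta>: "\<zeta> \<in> Pred X"
      using liftsD(1)[OF b] .
    have "lifts \<zeta> n (atom N k g)"
      using NA(5)[OF n] gn by simp
    from lifts_comp[OF this unit] have "lifts \<zeta> (\<lambda>x. u (n x)) \<rho>" .
    moreover have "(\<lambda>x. u (n x)) \<in> base X \<zeta> \<rightarrow> F"
      using n uF by blast
    ultimately have *: "\<forall>\<zeta>' t b c. lifts \<zeta>' t \<zeta> \<and> (\<forall>x\<in>base X \<zeta>'. upair (b x) (c x) \<in> dec (u (n (t
        x)))) \<and> lifts \<zeta>' b (\<pi> i) \<longrightarrow> lifts \<zeta>' c (\<pi> j)"
      using \<rho>_iff[rule_format, OF \<zeta>] by simp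
    show ?thesis
      by (intro *[rule_format, of \<zeta> "\<lambda>x. x" b] conjI lifts_id[OF \<zeta>] bc b)
  qed
  define R where "R a b c \<longleftrightarrow> (\<exists>n\<in>N. g n = a \<and> upair b c \<in> dec (u n))" for a b c
  have decsub: "dec r \<subseteq> W" if "r \<in> F" for r
    using dec that by blast
  have decW: "b \<in> A i \<and> c \<in> A j" if "r \<in> F" "upair b c \<in> dec r" for r b c
  proof -
    have "upair b c \<in> W"
      using decsub that by blast
    then show ?thesis
      by (simp add: W_def)
  qed
  have decWE: "\<exists>b\<in>A i. \<exists>c\<in>A j. z = upair b c" if "r \<in> F" "z \<in> dec r" for r z
  proof -
    have "z \<in> W"
      using decsub that by blast
    then show ?thesis
      unfolding W_def by blast
  qed
  have R_A: "R a b c \<longrightarrow> a \<in> A k \<and> b \<in> A i \<and> c \<in> A j" for a b c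
  proof
    assume "R a b c"
    then obtain n where "n \<in> N" "g n = a" "upair b c \<in> dec (u n)"
      unfolding R_def by blast
    then show "a \<in> A k \<and> b \<in> A i \<and> c \<in> A j"
      using decW uF g by blast
  qed
  define K where "K = {upair n z |n z. n \<in> N \<and> z \<in> dec (u n)}"
  have KE: "\<exists>n\<in>N. \<exists>b\<in>A i. \<exists>c\<in>A j. upair b c \<in> dec (u n) \<and> x = upair n (upair b c)" if "x \<in> K" for x
  proof -
    obtain n z where n: "x = upair n z" "n \<in> N" "z \<in> dec (u n)"
      using \<open>x \<in> K\<close> unfolding K_def by blast
    moreover obtain b c where "b \<in> A i" "c \<in> A j" "z = upair b c"
      using decWE[OF uF[OF n(2)] n(3)] by blast
    ultimately show ?thesis
      by blast
  qed
  have KI: "upair n (upair b c) \<in> K" if "n \<in> N" "upair b c \<in> dec (u n)" for n b c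
    using that unfolding K_def by blast
  have K: "small K"
  proof (rule small_upair[OF N \<open>small W\<close>])
    fix x assume "x \<in> K"
    then obtain n z where "x = upair n z" "n \<in> N" "z \<in> dec (u n)"
      unfolding K_def by blast
    moreover from this have "z \<in> W"
      using uF decsub by blast
    ultimately show "\<exists>n\<in>N. \<exists>z\<in>W. x = upair n z"
      by blast
  qed
  obtain m pf where "is_prod k i m pf"
    using ex_prod[OF k i] by blast
  then have m: "m \<in> I" and pf: "\<forall>a\<in>A k. \<forall>b\<in>A i. pf a b \<in> A m" and pf_iff: "\<forall>\<chi> u v. \<chi> \<in> Pred X \<and>
      u \<in> base X \<chi> \<rightarrow> A k \<and> v \<in> base X \<chi> \<rightarrow> A i \<longrightarrow>
        lifts \<chi> (\<lambda>x. pf (u x) (v x)) (\<pi> m) = (lifts \<chi> u (\<pi> k) \<and> lifts \<chi> v (\<pi> i))"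
    unfolding is_prod_def by simp_all
  \<comment> \<open>An element of \<open>K\<close> is an index \<open>n\<close> with a pair
    \<open>(b, c)\<close> of its relation; \<open>?e\<close> keeps \<open>(g n, b)\<close> and
    \<open>?f\<close> keeps \<open>c\<close>. So \<open>R a b c\<close> holds iff some element of
    \<open>K\<close> goes to \<open>(a, b)\<close> and to \<open>c\<close>.\<close>
  let ?e = "\<lambda>x. upair (g (ufst x)) (ufst (usnd x))" and ?f = "\<lambda>x. usnd (usnd x)"
  define J where "J = ?e ` K"
  have J: "small J"
    unfolding J_def using K by (rule small_image)
  have f: "?f \<in> K \<rightarrow> A j" and q1: "(\<lambda>x. g (ufst x)) \<in> K \<rightarrow> A k" "(\<lambda>x. ufst (usnd x)) \<in> K \<rightarrow> A i"
      and n: "ufst \<in> K \<rightarrow> N"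
    using KE g by fastforce+
  have q0: "ufst \<in> J \<rightarrow> A k" "usnd \<in> J \<rightarrow> A i"
    using q1 unfolding J_def by auto
  let ?q = "\<lambda>y. pf (ufst y) (usnd y)"
  have q: "?q \<in> J \<rightarrow> A m"
    using q0 pf by blast
  have qe: "(\<lambda>x. ?q (?e x)) \<in> K \<rightarrow> A m"
    using q1 pf by auto
  note KA = atom[OF m K qe]
  have "lifts (atom K m (\<lambda>x. ?q (?e x))) (\<lambda>x. pf (g (ufst x)) (ufst (usnd x))) (\<pi> m)"
    using KA(3) by simp
  then have "lifts (atom K m (\<lambda>x. ?q (?e x))) (\<lambda>x. g (ufst x)) (\<pi> k) \<and>
      lifts (atom K m (\<lambda>x. ?q (?e x))) (\<lambda>x. ufst (usnd x)) (\<pi> i)"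
    using pf_iff[rule_format, of "atom K m (\<lambda>x. ?q (?e x))" "\<lambda>x. g (ufst x)"
        "\<lambda>x. ufst (usnd x)"] KA(1,2) q1 by simp
  moreover have "\<forall>x\<in>K. upair (ufst (usnd x)) (?f x) \<in> dec (u (ufst x))"
    using KE by fastforce
  ultimately have lifts: "lifts (atom K m (\<lambda>x. ?q (?e x))) ?f (\<pi> j)"
    using counit[of ufst "atom K m (\<lambda>x. ?q (?e x))" "\<lambda>x. ufst (usnd x)" ?f] KA(2) n by simp
  have eJ: "?e \<in> K \<rightarrow> J" "?e ` K = J"
    by (auto simp: J_def)
  \<comment> \<open>Over \<open>K\<close> the value \<open>c\<close> is entailed by data depending
    only on \<open>(g n, b)\<close>. By modesty of \<open>\<pi> j\<close> it therefore descends to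
    \<open>J\<close>: whatever \<open>n\<close> and \<open>c\<close> were, \<open>c\<close> is a
    function \<open>h\<close> of \<open>(g n, b)\<close>.\<close>
  obtain h where h: "h \<in> J \<rightarrow> A j" "\<forall>x\<in>K. h (?e x) = ?f x" "lifts (atom J m ?q) h (\<pi> j)"
    by (rule modest_lifts[OF j m J K eJ f q lifts])
  have Rh: "upair a b \<in> J \<and> h (upair a b) = c" if R: "R a b c" for a b c
  proof -
    obtain n where n: "n \<in> N" "g n = a" "upair b c \<in> dec (u n)"
      using R unfolding R_def by blast
    have x: "upair n (upair b c) \<in> K"
      using KI n by blast
    have "?e (upair n (upair b c)) \<in> J"
      using x eJ(1) by blast
    then show ?thesis
      using h(2)[rule_format, OF x] n(2) by simp
  qed
  \<comment> \<open>The descended \<open>h\<close> is itself a lifting, from the pairs at which both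
    predicates hold to \<open>\<pi> j\<close>; soundness is composition with it.\<close>
  have sound: "lifts \<chi> c (\<pi> j)" if R: "\<forall>x\<in>base X \<chi>. R (a x) (b x) (c x)" and a: "lifts \<chi> a (\<pi> k)"
      and b: "lifts \<chi> b (\<pi> i)" for \<chi> a b c
  proof -
    have ab: "(\<lambda>x. upair (a x) (b x)) \<in> base X \<chi> \<rightarrow> J"
      using R Rh by blast
    have "a \<in> base X \<chi> \<rightarrow> A k" "b \<in> base X \<chi> \<rightarrow> A i"
      using R R_A by blast+
    then have "lifts \<chi> (\<lambda>x. ?q (upair (a x) (b x))) (\<pi> m)"
      using pf_iff[rule_format, of \<chi> a b] a b liftsD(1)[OF a] by simp
    then have "lifts \<chi> (\<lambda>x. upair (a x) (b x)) (atom J m ?q)"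
      using atom(5)[OF m J q ab] by simp
    from lifts_comp[OF this h(3)] have "lifts \<chi> (\<lambda>x. h (upair (a x) (b x))) (\<pi> j)" .
    moreover have "h (upair (a x) (b x)) = c x" if "x \<in> base X \<chi>" for x
      using R Rh that by blast
    ultimately show ?thesis
      using lifts_cong[of \<chi> "\<lambda>x. h (upair (a x) (b x))" c] by simp
  qed
  have curry: "\<exists>c\<in>B \<rightarrow> A k. lifts (atom B l r) c (\<pi> k) \<and> (\<forall>x\<in>J. R (c (p x)) (g' x) (f' x))"
    if l: "l \<in> I" and B: "small B" and J: "small J" and r: "r \<in> B \<rightarrow> A l" and p: "p \<in> J \<rightarrow> B"
      and g': "g' \<in> J \<rightarrow> A i" and f': "f' \<in> J \<rightarrow> A j"
      and hyp: "\<forall>\<chi> t. t \<in> base X \<chi> \<rightarrow> J \<longrightarrow> lifts \<chi> (\<lambda>x. r (p (t x))) (\<pi> l) \<longrightarrow>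
          lifts \<chi> (\<lambda>x. g' (t x)) (\<pi> i) \<longrightarrow>
          lifts \<chi> (\<lambda>x. f' (t x)) (\<pi> j)"
    for l and B J :: "'u set" and r p g' f'
  proof -
    \<comment> \<open>The parameter \<open>b\<close> is sent to a code of the relation collecting
      all pairs (argument, value) required over it. Such a code exists because \<open>F\<close>
      codes every subset of \<open>W\<close>.\<close>
    have "\<exists>s\<in>F. dec s = {upair (g' x) (f' x) |x. x \<in> J \<and> p x = b}" for b
    proof -
      have "{upair (g' x) (f' x) |x. x \<in> J \<and> p x = b} \<in> Pow W"
        using g' f' unfolding W_def by blast
      then show ?thesis
        unfolding dec[symmetric] by (metis (no_types, lifting) imageE)
    qed
    then obtain hB where hB: "\<And>b. hB b \<in> F" "\<And>b. dec (hB b) = {upair (g' x) (f' x) |x. x \<in> J \<and>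
        p x = b}"
      by metis
    note BA = atom[OF l B r]
    have hBF: "hB \<in> base X (atom B l r) \<rightarrow> F"
      using hB(1) by blast
    have "lifts (atom B l r) hB \<rho>"
      unfolding \<rho>_iff[rule_format, OF BA(1) hBF]
    proof (intro allI impI, elim conjE)
      fix \<zeta> t b c
      assume t: "lifts \<zeta> t (atom B l r)" and bc: "\<forall>x\<in>base X \<zeta>. upair (b x) (c x) \<in> dec (hB (t x))"
          and b: "lifts \<zeta> b (\<pi> i)"
      \<comment> \<open>A stage of pairs in these relations factors through \<open>J\<close> by
        choice, so the hypothesis on \<open>J\<close> applies to it.\<close>
      have "\<forall>x\<in>base X \<zeta>. \<exists>y\<in>J. p y = t x \<and> g' y = b x \<and> f' y = c x"
      proof
        fix x assume "x \<in> base X \<zeta>"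
        then have "upair (b x) (c x) \<in> {upair (g' y) (f' y) |y. y \<in> J \<and> p y = t x}"
          using bc unfolding hB(2) by blast
        then obtain y where "upair (b x) (c x) = upair (g' y) (f' y)" "y \<in> J" "p y = t x"
          by blast
        then show "\<exists>y\<in>J. p y = t x \<and> g' y = b x \<and> f' y = c x"
          by auto
      qed
      then obtain s where s: "\<And>x. x \<in> base X \<zeta> \<Longrightarrow> s x \<in> J \<and> p (s x) = t x \<and> g' (s x) = b x \<and>
          f' (s x) = c x"
        by metis
      have "lifts \<zeta> (\<lambda>x. r (t x)) (\<pi> l)"
        using lifts_comp[OF t BA(3)] .
      then have "lifts \<zeta> (\<lambda>x. r (p (s x))) (\<pi> l)"
        using lifts_cong[of \<zeta> "\<lambda>x. r (p (s x))" "\<lambda>x. r (t x)"] s by simp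
      moreover have "lifts \<zeta> (\<lambda>x. g' (s x)) (\<pi> i)"
        using lifts_cong[of \<zeta> "\<lambda>x. g' (s x)" b] s b by simp
      ultimately have "lifts \<zeta> (\<lambda>x. f' (s x)) (\<pi> j)"
        using hyp[rule_format, of s \<zeta>] s by blast
      then show "lifts \<zeta> c (\<pi> j)"
        using lifts_cong[of \<zeta> "\<lambda>x. f' (s x)" c] s by simp
    qed
    moreover have "hB \<in> B \<rightarrow> F"
      using hB(1) by blast
    ultimately obtain L e w where L: "small L" "e \<in> L \<rightarrow> B" "e ` L = B" "w \<in> L \<rightarrow> N"
        "\<forall>x\<in>L. u (w x) = hB (e x)"
      and lw: "lifts (atom L l (\<lambda>x. r (e x))) w (atom N k g)"
      using ex_prime_lifts[OF l B N F r u NAf ex] by metis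
    have gw: "(\<lambda>x. g (w x)) \<in> L \<rightarrow> A k"
      using L(4) g by blast
    \<comment> \<open>Primality supplied indices in \<open>N\<close> only over a cover
      \<open>L\<close> of \<open>B\<close>. Modesty of \<open>\<pi> k\<close> makes their images
      under \<open>g\<close> a function on \<open>B\<close> itself.\<close>
    obtain c where c: "c \<in> B \<rightarrow> A k" "\<forall>x\<in>L. c (e x) = g (w x)" "lifts (atom B l r) c (\<pi> k)"
      by (rule modest_lifts[OF k l B L(1) L(2,3) gw r lifts_comp[OF lw NA(3)]])
    have "R (c (p x)) (g' x) (f' x)" if x: "x \<in> J" for x
    proof -
      have "p x \<in> e ` L"
        using p x L(3) by blast
      then obtain y where y: "y \<in> L" "p x = e y"
        by blast
      have "upair (g' x) (f' x) \<in> dec (u (w y))"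
        using x y L(5) unfolding hB(2)[of "p x"] by (auto simp: hB(2))
      moreover have "w y \<in> N" "g (w y) = c (p x)"
        using y L(4) c(2) by auto
      ultimately show ?thesis
        unfolding R_def by blast
    qed
    then show ?thesis
      using c by blast
  qed
  have "is_exp i j k R"
    unfolding is_exp_def
  proof (intro conjI k)
    show "\<forall>a b c. R a b c \<longrightarrow> a \<in> A k \<and> b \<in> A i \<and> c \<in> A j"
      using R_A by blast
    show "\<forall>a b c c'. R a b c \<longrightarrow> R a b c' \<longrightarrow> c = c'"
      using Rh by blast
    show "\<forall>\<chi> a b c. (\<forall>x\<in>base X \<chi>. R (a x) (b x) (c x)) \<longrightarrow> lifts \<chi> a (\<pi> k) \<longrightarrow> lifts \<chi> b (\<pi> i) \<longrightarrow>
        lifts \<chi> c (\<pi> j)"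
      by (intro allI impI) (rule sound)
  qed (intro allI impI, rule curry)
  then show ?thesis
    by blast
qed

end

section \<open>The typed pca and its sub-pca, with operations on types fixed by choice\<close>

locale presented_pca = presented X I A \<pi>
  for X :: "('u, 'x) fibration" and I A \<pi> +
  fixes pr :: "'u \<Rightarrow> 'u \<Rightarrow> 'u" and pf :: "'u \<Rightarrow> 'u \<Rightarrow> 'u \<Rightarrow> 'u \<Rightarrow> 'u"
    and ar :: "'u \<Rightarrow> 'u \<Rightarrow> 'u" and R :: "'u \<Rightarrow> 'u \<Rightarrow> 'u \<Rightarrow> 'u \<Rightarrow> 'u \<Rightarrow> bool"
    and l0 t0 :: 'u
  assumes prod: "i \<in> I \<Longrightarrow> j \<in> I \<Longrightarrow> is_prod i j (pr i j) (pf i j)"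
    and exp: "i \<in> I \<Longrightarrow> j \<in> I \<Longrightarrow> is_exp i j (ar i j) (R i j)"
    and l0: "l0 \<in> I" and t0: "t0 \<in> A l0" "\<chi> \<in> Pred X \<Longrightarrow> lifts \<chi> (\<lambda>_. t0) (\<pi> l0)"
begin

lemma pr_I [simp]: "i \<in> I \<Longrightarrow> j \<in> I \<Longrightarrow> pr i j \<in> I"
  and ar_I [simp]: "i \<in> I \<Longrightarrow> j \<in> I \<Longrightarrow> ar i j \<in> I"
  using prod exp by (auto simp: is_prod_def is_exp_def)

lemma pf_A: "i \<in> I \<Longrightarrow> j \<in> I \<Longrightarrow> a \<in> A i \<Longrightarrow> b \<in> A j \<Longrightarrow> pf i j a b \<in> A (pr i j)"
  using prod by (simp add: is_prod_def)

lemma pf_lifts: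
  assumes "i \<in> I" "j \<in> I" "\<chi> \<in> Pred X" "u \<in> base X \<chi> \<rightarrow> A i" "v \<in> base X \<chi> \<rightarrow> A j"
  shows "lifts \<chi> (\<lambda>x. pf i j (u x) (v x)) (\<pi> (pr i j)) \<longleftrightarrow> lifts \<chi> u (\<pi> i) \<and> lifts \<chi> v (\<pi> j)"
  using prod[OF assms(1,2)] assms(3-5) unfolding is_prod_def by blast

lemma R_A:
  assumes "i \<in> I" "j \<in> I" "R i j a b c"
  shows "a \<in> A (ar i j) \<and> b \<in> A i \<and> c \<in> A j"
proof -
  have "\<forall>a b c. R i j a b c \<longrightarrow> a \<in> A (ar i j) \<and> b \<in> A i \<and> c \<in> A j"
    using exp[OF assms(1,2)] unfolding is_exp_def by (elim conjE)
  then show ?thesis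
    using assms(3) by blast
qed

lemma R_functional:
  assumes "i \<in> I" "j \<in> I" "R i j a b c" "R i j a b c'"
  shows "c = c'"
proof -
  have "\<forall>a b c c'. R i j a b c \<longrightarrow> R i j a b c' \<longrightarrow> c = c'"
    using exp[OF assms(1,2)] unfolding is_exp_def by (elim conjE)
  then show ?thesis
    using assms(3,4) by blast
qed

lemma R_sound:
  assumes "i \<in> I" "j \<in> I" "\<And>x. x \<in> base X \<chi> \<Longrightarrow> R i j (a x) (b x) (c x)"
    and "lifts \<chi> a (\<pi> (ar i j))" "lifts \<chi> b (\<pi> i)"
  shows "lifts \<chi> c (\<pi> j)"
proof -
  have "\<forall>\<chi> a b c. (\<forall>x\<in>base X \<chi>. R i j (a x) (b x) (c x)) \<longrightarrow> lifts \<chi> a (\<pi> (ar i j)) \<longrightarrow>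
      lifts \<chi> b (\<pi> i) \<longrightarrow> lifts \<chi> c (\<pi> j)"
    using exp[OF assms(1,2)] unfolding is_exp_def by (elim conjE)
  from this[rule_format, OF assms(3-5)] show ?thesis .
qed

lemma R_curry:
  assumes "i \<in> I" "j \<in> I" "l \<in> I" "small (B :: 'u set)" "small (J :: 'u set)" "r \<in> B \<rightarrow> A l"
      "p \<in> J \<rightarrow> B" "g \<in> J \<rightarrow> A i" "f \<in> J \<rightarrow> A j"
    and "\<And>\<chi> t. t \<in> base X \<chi> \<rightarrow> J \<Longrightarrow> lifts \<chi> (\<lambda>x. r (p (t x))) (\<pi> l) \<Longrightarrow> lifts \<chi> (\<lambda>x. g (t x)) (\<pi> i) \<Longrightarrow>
      lifts \<chi> (\<lambda>x. f (t x)) (\<pi> j)"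
  shows "\<exists>c\<in>B \<rightarrow> A (ar i j). lifts (atom B l r) c (\<pi> (ar i j)) \<and> (\<forall>x\<in>J. R i j (c (p x)) (g x) (f x))"
proof -
  have "\<forall>l B (J :: 'u set) r p g f. l \<in> I \<longrightarrow> small B \<longrightarrow> small J \<longrightarrow> r \<in> B \<rightarrow> A l \<longrightarrow> p \<in> J \<rightarrow> B \<longrightarrow>
      g \<in> J \<rightarrow> A i \<longrightarrow> f \<in> J \<rightarrow> A j \<longrightarrow>
        (\<forall>\<chi> t. t \<in> base X \<chi> \<rightarrow> J \<longrightarrow> lifts \<chi> (\<lambda>x. r (p (t x))) (\<pi> l) \<longrightarrow> lifts \<chi> (\<lambda>x. g (t x)) (\<pi> i) \<longrightarrow>
          lifts \<chi> (\<lambda>x. f (t x)) (\<pi> j)) \<longrightarrow>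
        (\<exists>c\<in>B \<rightarrow> A (ar i j). lifts (atom B l r) c (\<pi> (ar i j)) \<and>
          (\<forall>x\<in>J. R i j (c (p x)) (g x) (f x)))"
    using exp[OF assms(1,2)] unfolding is_exp_def by (elim conjE)
  from this[rule_format, OF assms(3-9)] assms(10) show ?thesis
    by blast
qed

definition P :: "'u typed_pca" where
  "P = \<lparr>Ty = I, prd = pr, imp = ar, carr = A,
     app = (\<lambda>i j a b. if \<exists>c. R i j a b c then Some (SOME c. R i j a b c) else None)\<rparr>"

definition S :: "'u \<Rightarrow> 'u set" where
  "S i = {a \<in> A i. \<forall>\<chi>\<in>Pred X. lifts \<chi> (\<lambda>_. a) (\<pi> i)}"

lemma P_simps [simp]: "Ty P = I" "prd P = pr" "imp P = ar" "carr P = A"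
  by (simp_all add: P_def)

lemma app_iff:
  assumes "i \<in> I" "j \<in> I"
  shows "app P i j a b = Some c \<longleftrightarrow> R i j a b c"
proof -
  have "app P i j a b = (if \<exists>c. R i j a b c then Some (SOME c. R i j a b c) else None)"
    by (simp add: P_def)
  moreover have "(SOME c. R i j a b c) = c" if "R i j a b c" for c
    using R_functional[OF assms _ that] someI[of "R i j a b", OF that] by blast
  ultimately show ?thesis
    by auto
qed

text \<open>An entailment is curried over a one-element set, with the always true \<open>t0\<close>
  as its parameter. The resulting element therefore holds at every stage, which is membership in
  \<open>S\<close>.\<close>

lemma realizer:
  assumes "i \<in> I" "j \<in> I" "small J" "f \<in> J \<rightarrow> A i" "g \<in> J \<rightarrow> A j" "lifts (atom J i f) g (\<pi> j)"
  shows "\<exists>r\<in>S (ar i j). \<forall>x\<in>J. R i j r (f x) (g x)"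
proof -
  fix b :: 'u
  have b: "small {b}"
    by (simp add: small_finite)
  note J = atom[OF assms(1,3,4)]
  have "\<exists>c\<in>{b} \<rightarrow> A (ar i j). lifts (atom {b} l0 (\<lambda>_. t0)) c (\<pi> (ar i j)) \<and>
      (\<forall>x\<in>J. R i j (c b) (f x) (g x))"
  proof (rule R_curry[OF assms(1,2) l0 b assms(3) _ _ assms(4,5)])
    fix \<chi> t
    assume t: "t \<in> base X \<chi> \<rightarrow> J" and f: "lifts \<chi> (\<lambda>x. f (t x)) (\<pi> i)"
    then have "lifts \<chi> t (atom J i f)"
      using J(5)[OF t] by simp
    from lifts_comp[OF this assms(6)] show "lifts \<chi> (\<lambda>x. g (t x)) (\<pi> j)" .
  qed (use t0(1) in auto)
  then obtain c where c: "c \<in> {b} \<rightarrow> A (ar i j)" "lifts (atom {b} l0 (\<lambda>_. t0)) c (\<pi> (ar i j))"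
    "\<forall>x\<in>J. R i j (c b) (f x) (g x)"
    by blast
  have tb: "(\<lambda>_. t0) \<in> {b} \<rightarrow> A l0"
    using t0 by simp
  have "lifts \<chi> (\<lambda>_. c b) (\<pi> (ar i j))" if \<chi>: "\<chi> \<in> Pred X" for \<chi>
  proof -
    have "lifts \<chi> (\<lambda>_. b) (atom {b} l0 (\<lambda>_. t0))"
      using atom(5)[OF l0 b tb, of "\<lambda>_. b" \<chi>] t0(2)[OF \<chi>] by simp
    from lifts_comp[OF this c(2)] show ?thesis .
  qed
  then have "c b \<in> S (ar i j)"
    using c(1) by (simp add: S_def)
  then show ?thesis
    using c(3) by blast
qed

text \<open>\<open>R_curry\<close> turns the values over each \<open>b\<close> into an element
  \<open>c b\<close> of the arrow type. The map \<open>c\<close> is again an entailment, so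
  \<open>realizer\<close> represents it by a single \<open>q\<close> in the sub-pca.\<close>

lemma curry_realizer:
  assumes "i \<in> I" "j \<in> I" "l \<in> I" "small (B :: 'u set)" "small (J :: 'u set)" "r \<in> B \<rightarrow> A l"
      "p \<in> J \<rightarrow> B" "g \<in> J \<rightarrow> A i" "f \<in> J \<rightarrow> A j"
    and "\<And>\<chi> t. t \<in> base X \<chi> \<rightarrow> J \<Longrightarrow> lifts \<chi> (\<lambda>x. r (p (t x))) (\<pi> l) \<Longrightarrow> lifts \<chi> (\<lambda>x. g (t x)) (\<pi> i) \<Longrightarrow>
      lifts \<chi> (\<lambda>x. f (t x)) (\<pi> j)"
  shows "\<exists>q\<in>S (ar l (ar i j)). \<forall>b\<in>B. \<exists>c. R l (ar i j) q (r b) c \<and> (\<forall>x\<in>J. p x = b \<longrightarrow>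
      R i j c (g x) (f x))"
proof -
  obtain c where c: "c \<in> B \<rightarrow> A (ar i j)" "lifts (atom B l r) c (\<pi> (ar i j))"
      "\<forall>x\<in>J. R i j (c (p x)) (g x) (f x)"
    using R_curry[OF assms(1-9)] assms(10) by blast
  obtain q where "q \<in> S (ar l (ar i j))" "\<forall>b\<in>B. R l (ar i j) q (r b) (c b)"
    using realizer[OF assms(3) ar_I[OF assms(1,2)] assms(4,6) c(1,2)] by blast
  then show ?thesis
    using c(3) by blast
qed

section \<open>Construction of the combinators\<close>

definition pairs :: "'u set \<Rightarrow> 'u set \<Rightarrow> 'u set" where
  "pairs B D = {upair b d |b d. b \<in> B \<and> d \<in> D}"

lemma small_pairs: "small B \<Longrightarrow> small D \<Longrightarrow> small (pairs B D)"
  by (erule (1) small_upair) (auto simp: pairs_def)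

lemma pairs_iff: "upair b d \<in> pairs B D \<longleftrightarrow> b \<in> B \<and> d \<in> D"
  and pairs_proj: "ufst \<in> pairs B D \<rightarrow> B" "usnd \<in> pairs B D \<rightarrow> D"
  by (auto simp: pairs_def)

text \<open>The first projection is curried, with the first component as the parameter and the
  second as the argument.\<close>

lemma ex_k:
  assumes "i \<in> I" "j \<in> I"
  shows "\<exists>k\<in>S (ar i (ar j i)). is_k P i j k"
proof -
  note s = small_A[OF assms(1)] small_A[OF assms(2)]
  have "\<exists>q\<in>S (ar i (ar j i)). \<forall>b\<in>A i. \<exists>c. R i (ar j i) q b c \<and>
      (\<forall>x\<in>pairs (A i) (A j). ufst x = b \<longrightarrow> R j i c (usnd x) (ufst x))"
    by (rule curry_realizer[OF assms(2,1,1) s(1) small_pairs[OF s] _ pairs_proj(1,2,1)]) simp_all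
  then obtain q where q: "q \<in> S (ar i (ar j i))" "\<forall>b\<in>A i. \<exists>c. R i (ar j i) q b c \<and>
      (\<forall>x\<in>pairs (A i) (A j). ufst x = b \<longrightarrow> R j i c (usnd x) (ufst x))"
    by blast
  have "is_k P i j q"
    unfolding is_k_def
  proof
    fix x assume "x \<in> carr P i"
    then obtain c where c: "R i (ar j i) q x c" "\<forall>z\<in>pairs (A i) (A j). ufst z = x \<longrightarrow>
        R j i c (usnd z) (ufst z)"
      using q(2) by auto
    have "R j i c y x" if "y \<in> A j" for y
      using c(2)[rule_format, of "upair x y"] that \<open>x \<in> carr P i\<close> by (simp add: pairs_iff)
    then show "\<exists>kx. app P i (imp P j i) q x = Some kx \<and> (\<forall>y\<in>carr P j. app P j i kx y = Some x)"
      using c(1) assms by (intro exI[of _ c]) (simp add: app_iff)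
  qed
  then show ?thesis
    using q(1) by blast
qed

lemma ex_pairing:
  assumes "i \<in> I" "j \<in> I"
  shows "\<exists>q\<in>S (ar i (ar j (pr i j))). \<exists>p1\<in>S (ar (pr i j) i). \<exists>p2\<in>S (ar (pr i j) j). is_pairing P i
      j q p1 p2"
proof -
  note s = small_A[OF assms(1)] small_A[OF assms(2)]
  let ?J = "pairs (A i) (A j)" and ?f = "\<lambda>x. pf i j (ufst x) (usnd x)"
  have f: "?f \<in> ?J \<rightarrow> A (pr i j)"
    using pf_A[OF assms] by (auto simp: pairs_def)
  note J = small_pairs[OF s] and p = pr_I[OF assms]
  have "\<exists>q\<in>S (ar i (ar j (pr i j))). \<forall>b\<in>A i. \<exists>c. R i (ar j (pr i j)) q b c \<and>
      (\<forall>x\<in>?J. ufst x = b \<longrightarrow> R j (pr i j) c (usnd x) (?f x))"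
  proof (rule curry_realizer[OF assms(2) p assms(1) s(1) J _ pairs_proj(1,2) f])
    fix \<chi> t assume t: "t \<in> base X \<chi> \<rightarrow> ?J" and *: "lifts \<chi> (\<lambda>x. ufst (t x)) (\<pi> i)"
        "lifts \<chi> (\<lambda>x. usnd (t x)) (\<pi> j)"
    have "(\<lambda>x. ufst (t x)) \<in> base X \<chi> \<rightarrow> A i" "(\<lambda>x. usnd (t x)) \<in> base X \<chi> \<rightarrow> A j"
      using liftsD(3)[OF *(1)] liftsD(3)[OF *(2)] \<pi>(2) assms by auto
    then show "lifts \<chi> (\<lambda>x. ?f (t x)) (\<pi> (pr i j))"
      using pf_lifts[OF assms liftsD(1)[OF *(1)]] * by simp
  qed simp
  then obtain q where q: "q \<in> S (ar i (ar j (pr i j)))" "\<forall>b\<in>A i. \<exists>c. R i (ar j (pr i j)) q b c \<and>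
      (\<forall>x\<in>?J. ufst x = b \<longrightarrow> R j (pr i j) c (usnd x) (?f x))"
    by blast
  note JA = atom[OF p J f]
  \<comment> \<open>The atom satisfies \<open>\<pi> (pr i j)\<close> at its own pairs, hence by
    \<open>pf_lifts\<close> both components; \<open>realizer\<close> turns the two entailments into
    projections.\<close>
  have "lifts (atom ?J (pr i j) ?f) ufst (\<pi> i) \<and> lifts (atom ?J (pr i j) ?f) usnd (\<pi> j)"
    using pf_lifts[OF assms JA(1), of ufst usnd] JA(2,3) pairs_proj by simp
  then obtain p1 p2 where p1: "p1 \<in> S (ar (pr i j) i)" "\<forall>x\<in>?J. R (pr i j) i p1 (?f x) (ufst x)"
    and p2: "p2 \<in> S (ar (pr i j) j)" "\<forall>x\<in>?J. R (pr i j) j p2 (?f x) (usnd x)"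
    using realizer[OF p assms(1) J f pairs_proj(1)] realizer[OF p assms(2) J f pairs_proj(2)]
        by blast
  have "is_pairing P i j q p1 p2"
    unfolding is_pairing_def
  proof
    fix x assume x: "x \<in> carr P i"
    then obtain c where c: "R i (ar j (pr i j)) q x c" "\<forall>z\<in>?J. ufst z = x \<longrightarrow>
        R j (pr i j) c (usnd z) (?f z)"
      using q(2) by auto
    have "R j (pr i j) c y (pf i j x y) \<and> R (pr i j) i p1 (pf i j x y) x \<and>
        R (pr i j) j p2 (pf i j x y) y"
      if "y \<in> A j" for y
      using c(2)[rule_format, of "upair x y"] p1(2)[rule_format, of
          "upair x y"] p2(2)[rule_format, of "upair x y"] that x
      by (simp add: pairs_iff)
    then show "\<exists>px. app P i (imp P j (prd P i j)) q x = Some px \<and>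
        (\<forall>y\<in>carr P j. \<exists>xy. app P j (prd P i j) px y = Some xy \<and>
           app P (prd P i j) i p1 xy = Some x \<and> app P (prd P i j) j p2 xy = Some y)"
      using c(1) assms by (intro exI[of _ c]) (auto simp: app_iff)
  qed
  then show ?thesis
    using q(1) p1(1) p2(1) by blast
qed

text \<open>Currying takes a single parameter, so \<open>x\<close> and \<open>y\<close> are combined
  by \<open>pf\<close> to obtain \<open>c\<close>, with \<open>c (x, y)\<close> representing
  \<open>z \<mapsto> x z (y z)\<close>; then \<open>c\<close> is curried in turn. As
  \<open>c\<close> is a total function on the pairs, \<open>s x y\<close> is defined whether or not
  any \<open>x z (y z)\<close> is.\<close>

lemma ex_s:
  assumes T: "i \<in> I" "j \<in> I" "k \<in> I"
  shows "\<exists>s\<in>S (ar (ar i (ar j k)) (ar (ar i j) (ar i k))). is_s P i j k s"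
proof -
  let ?x = "ar i (ar j k)" and ?y = "ar i j" and ?z = "ar i k"
  let ?B = "pairs (A ?x) (A ?y)" and ?l = "pr ?x ?y"
  have T': "?x \<in> I" "?y \<in> I" "?z \<in> I" "ar j k \<in> I"
    using T by simp_all
  note B = small_pairs[OF small_A[OF T'(1)] small_A[OF T'(2)]]
  let ?r = "\<lambda>b. pf ?x ?y (ufst b) (usnd b)"
  have r: "?r \<in> ?B \<rightarrow> A ?l"
    using pf_A[OF T'(1,2)] by (auto simp: pairs_def)
  note l = pr_I[OF T'(1,2)]
  have r_lifts: "lifts \<chi> (\<lambda>x. ?r (t x)) (\<pi> ?l) \<longleftrightarrow> lifts \<chi> (\<lambda>x. ufst (t x)) (\<pi> ?x) \<and>
      lifts \<chi> (\<lambda>x. usnd (t x)) (\<pi> ?y)"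
    if t: "t \<in> base X \<chi> \<rightarrow> ?B" and \<chi>: "\<chi> \<in> Pred X" for \<chi> t
  proof -
    have "(\<lambda>x. ufst (t x)) \<in> base X \<chi> \<rightarrow> A ?x" "(\<lambda>x. usnd (t x)) \<in> base X \<chi> \<rightarrow> A ?y"
      using t pairs_proj by (auto simp: Pi_iff)
    then show ?thesis
      using pf_lifts[OF T'(1,2) \<chi>] by simp
  qed
  define D where "D b z w \<longleftrightarrow> (\<exists>xz yz. R i (ar j k) (ufst b) z xz \<and> R i j (usnd b) z yz \<and>
      R j k xz yz w)" for b z w
  \<comment> \<open>Only those \<open>((x, y), (z, w))\<close> are kept for which
    \<open>x z (y z)\<close> is defined with value \<open>w\<close>, so that partial definedness of
    the result is accommodated.\<close>
  let ?J = "{v \<in> pairs ?B (pairs (A i) (A k)). D (ufst v) (ufst (usnd v)) (usnd (usnd v))}"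
  have J: "small ?J"
    by (rule small_subset[OF small_pairs[OF B small_pairs[OF small_A[OF T(1)] small_A[OF T(3)]]]])
        auto
  have "\<exists>c\<in>?B \<rightarrow> A ?z. lifts (atom ?B ?l ?r) c (\<pi> ?z) \<and>
      (\<forall>v\<in>?J. R i k (c (ufst v)) (ufst (usnd v)) (usnd (usnd v)))"
  proof (rule R_curry[OF T(1,3) l B J r])
    show "ufst \<in> ?J \<rightarrow> ?B" "(\<lambda>v. ufst (usnd v)) \<in> ?J \<rightarrow> A i" "(\<lambda>v. usnd (usnd v)) \<in> ?J \<rightarrow> A k"
      by (auto simp: pairs_def)
    fix \<chi> t
    assume t: "t \<in> base X \<chi> \<rightarrow> ?J" and f: "lifts \<chi> (\<lambda>x. ?r (ufst (t x))) (\<pi> ?l)" and z: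
        "lifts \<chi> (\<lambda>x. ufst (usnd (t x))) (\<pi> i)"
    have tB: "(\<lambda>x. ufst (t x)) \<in> base X \<chi> \<rightarrow> ?B"
      using t pairs_proj(1) by blast
    note xy = r_lifts[OF tB liftsD(1)[OF z], THEN iffD1, OF f]
    have "\<forall>x\<in>base X \<chi>. D (ufst (t x)) (ufst (usnd (t x))) (usnd (usnd (t x)))"
      using t by blast
    then obtain a b where ab: "\<And>x. x \<in> base X \<chi> \<Longrightarrow> R i (ar j k) (ufst (ufst (t x))) (ufst (usnd (t
        x))) (a x)"
      "\<And>x. x \<in> base X \<chi> \<Longrightarrow> R i j (usnd (ufst (t x))) (ufst (usnd (t x))) (b x)"
      "\<And>x. x \<in> base X \<chi> \<Longrightarrow> R j k (a x) (b x) (usnd (usnd (t x)))"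
      unfolding D_def by metis
    have "lifts \<chi> a (\<pi> (ar j k))"
      by (rule R_sound[OF T(1) T'(4) ab(1) xy[THEN conjunct1] z])
    moreover have "lifts \<chi> b (\<pi> j)"
      by (rule R_sound[OF T(1,2) ab(2) xy[THEN conjunct2] z])
    ultimately show "lifts \<chi> (\<lambda>x. usnd (usnd (t x))) (\<pi> k)"
      by (intro R_sound[OF T(2,3), where a = a and b = b] ab(3))
  qed
  then obtain c where c: "c \<in> ?B \<rightarrow> A ?z" "lifts (atom ?B ?l ?r) c (\<pi> ?z)"
      "\<forall>v\<in>?J. R i k (c (ufst v)) (ufst (usnd v)) (usnd (usnd v))"
    by blast
  \<comment> \<open>Here \<open>x\<close> alone is the parameter, \<open>y\<close> the argument and
    \<open>c (x, y)\<close> the value.\<close>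
  have "\<exists>s\<in>S (ar ?x (ar ?y ?z)). \<forall>x\<in>A ?x. \<exists>sx. R ?x (ar ?y ?z) s x sx \<and>
      (\<forall>b\<in>?B. ufst b = x \<longrightarrow> R ?y ?z sx (usnd b) (c b))"
  proof (rule curry_realizer[OF T'(2,3,1) small_A[OF T'(1)] B _ pairs_proj c(1)])
    fix \<chi> t
    assume t: "t \<in> base X \<chi> \<rightarrow> ?B" and *: "lifts \<chi> (\<lambda>x. ufst (t x)) (\<pi> ?x)"
        "lifts \<chi> (\<lambda>x. usnd (t x)) (\<pi> ?y)"
    have "lifts \<chi> t (atom ?B ?l ?r)"
      using atom(5)[OF l B r t] r_lifts[OF t liftsD(1)[OF *(1)]] * by simp
    from lifts_comp[OF this c(2)] show "lifts \<chi> (\<lambda>x. c (t x)) (\<pi> ?z)" .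
  qed simp
  then obtain s where s: "s \<in> S (ar ?x (ar ?y ?z))" "\<forall>x\<in>A ?x. \<exists>sx. R ?x (ar ?y ?z) s x sx \<and>
      (\<forall>b\<in>?B. ufst b = x \<longrightarrow> R ?y ?z sx (usnd b) (c b))"
    by blast
  have "is_s P i j k s"
    unfolding is_s_def P_simps
  proof
    fix x assume x: "x \<in> A ?x"
    then obtain sx where sx: "R ?x (ar ?y ?z) s x sx" "\<forall>b\<in>?B. ufst b = x \<longrightarrow>
        R ?y ?z sx (usnd b) (c b)"
      using s(2) by blast
    have "\<exists>sxy. app P ?y ?z sx y = Some sxy \<and>
        (\<forall>z\<in>A i. \<forall>xz yz r. app P i (ar j k) x z = Some xz \<and> app P i j y z = Some yz \<and>
           app P j k xz yz = Some r \<longrightarrow> app P i k sxy z = Some r)" if y: "y \<in> A ?y" for y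
    proof (intro exI[of _ "c (upair x y)"] conjI ballI allI impI)
      show "app P ?y ?z sx y = Some (c (upair x y))"
        using sx(2)[rule_format, of "upair x y"] x y T' by (simp add: app_iff pairs_iff)
      fix z xz yz r assume z: "z \<in> A i" and "app P i (ar j k) x z = Some xz \<and>
          app P i j y z = Some yz \<and>
           app P j k xz yz = Some r"
      then have *: "R i (ar j k) x z xz" "R i j y z yz" "R j k xz yz r"
        using T T' by (simp_all add: app_iff)
      then have "upair (upair x y) (upair z r) \<in> ?J"
        using x y z R_A[OF T(2,3) *(3)] unfolding D_def by (auto simp: pairs_iff)
      then have "R i k (c (upair x y)) z r"
        using c(3) by force
      then show "app P i k (c (upair x y)) z = Some r"
        using T by (simp add: app_iff)
    qed
    then show "\<exists>sx. app P ?x (ar ?y ?z) s x = Some sx \<and>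
        (\<forall>y\<in>A ?y. \<exists>sxy. app P ?y ?z sx y = Some sxy \<and>
        (\<forall>z\<in>A i. \<forall>xz yz r. app P i (ar j k) x z = Some xz \<and> app P i j y z = Some yz \<and>
           app P j k xz yz = Some r \<longrightarrow> app P i k sxy z = Some r))"
      using sx(1) T' by (intro exI[of _ sx]) (simp add: app_iff)
  qed
  then show ?thesis
    using s(1) by blast
qed

lemma S_A: "S i \<subseteq> A i"
  by (auto simp: S_def)

text \<open>This is soundness of application, read at constant functions over every stage.\<close>

lemma S_app:
  assumes T: "i \<in> I" "j \<in> I" and a: "a \<in> S (ar i j)" and b: "b \<in> S i" and c: "R i j a b c"
  shows "c \<in> S j"
proof -
  have "lifts \<chi> (\<lambda>_. c) (\<pi> j)" if "\<chi> \<in> Pred X" for \<chi>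
    by (rule R_sound[OF T c]) (use a b that in \<open>auto simp: S_def\<close>)
  then show ?thesis
    using R_A[OF T c] by (simp add: S_def)
qed

lemma typed_pca_inclusion: "typed_pca_inclusion P S"
proof -
  have S: "has_combinators P S"
    unfolding has_combinators_def P_simps using ex_k ex_pairing ex_s by blast
  have "has_combinators P A"
    unfolding has_combinators_def P_simps
  proof (intro conjI ballI)
    fix i j assume "i \<in> I" "j \<in> I"
    then show "\<exists>k\<in>A (ar i (ar j i)). is_k P i j k"
      and "\<exists>q\<in>A (ar i (ar j (pr i j))). \<exists>p1\<in>A (ar (pr i j) i). \<exists>p2\<in>A (ar (pr i j) j). is_pairing P
          i j q p1 p2"
      using ex_k[of i j] ex_pairing[of i j] S_A by blast+
  next
    fix i j k assume "i \<in> I" "j \<in> I" "k \<in> I"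
    then show "\<exists>s\<in>A (ar (ar i (ar j k)) (ar (ar i j) (ar i k))). is_s P i j k s"
      using ex_s[of i j k] S_A by blast
  qed
  then have "typed_pca P"
    unfolding typed_pca_def P_simps using small_I l0 small_A R_A by (auto simp: app_iff)
  moreover have "typed_sub_pca P S"
    unfolding typed_sub_pca_def P_simps
  proof (intro conjI ballI allI impI)
    fix i j a b c assume "i \<in> I" "j \<in> I" "a \<in> S (ar i j)" "b \<in> S i" "app P i j a b = Some c"
    then show "c \<in> S j"
      using S_app[of i j a b c] by (simp add: app_iff)
  qed (rule S_A S)+
  ultimately show ?thesis
    by (simp add: typed_pca_inclusion_def)
qed

sublocale pca: pca_inclusion P S
  by standard (rule typed_pca_inclusion)

section \<open>Predicates as quantified atoms and their realizer sets\<close>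

definition presents :: "'x \<Rightarrow> 'u \<Rightarrow> 'u set \<Rightarrow> ('u \<Rightarrow> 'u) \<Rightarrow> ('u \<Rightarrow> 'u) \<Rightarrow> bool" where
  "presents \<chi> i N u g \<longleftrightarrow> \<chi> \<in> Pred X \<and> i \<in> I \<and> small N \<and> u \<in> N \<rightarrow>\<^sub>E base X \<chi> \<and> g \<in> N \<rightarrow> A i \<and>
     is_ex X N (base X \<chi>) u (atom N i g) \<chi>"

definition vals :: "'u set \<Rightarrow> ('u \<Rightarrow> 'u) \<Rightarrow> ('u \<Rightarrow> 'u) \<Rightarrow> 'u \<Rightarrow> 'u set" where
  "vals N u g m = g ` {n \<in> N. u n = m}"

lemma val_vals: "i \<in> I \<Longrightarrow> g \<in> N \<rightarrow> A i \<Longrightarrow> pca.val M i (vals N u g)"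
  unfolding pca.val_def vals_def P_simps by blast

lemma lifts_presents_iff:
  assumes \<chi>: "presents \<chi> i N u g" and \<chi>': "presents \<chi>' j N' u' g'" and t: "t \<in> base X \<chi> \<rightarrow> base X \<chi>'"
  shows "lifts \<chi> t \<chi>' \<longleftrightarrow> pca.rl (base X \<chi>) i (vals N u g) j (\<lambda>m. vals N' u' g' (t m))"
proof -
  let ?M = "base X \<chi>" and ?M' = "base X \<chi>'"
  have c: "\<chi> \<in> Pred X" "i \<in> I" "small N" "u \<in> N \<rightarrow>\<^sub>E ?M" "g \<in> N \<rightarrow> A i"
      "is_ex X N ?M u (atom N i g) \<chi>"
    and c': "\<chi>' \<in> Pred X" "j \<in> I" "small N'" "u' \<in> N' \<rightarrow>\<^sub>E ?M'" "g' \<in> N' \<rightarrow> A j"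
        "is_ex X N' ?M' u' (atom N' j g') \<chi>'"
    using \<chi> \<chi>' by (simp_all add: presents_def)
  note M = small_base[OF c(1)] small_base[OF c'(1)]
  note a = atom[OF c(2,3,5)] and a' = atom[OF c'(2,3,5)]
  have af: "atom N i g \<in> fiber X N" "atom N' j g' \<in> fiber X N'"
    using a a' by (simp_all add: fiber_def)
  have tu: "(\<lambda>n. t (u n)) \<in> N \<rightarrow> ?M'"
    using c(4) t by blast
  \<comment> \<open>A realizer over \<open>m\<close> is some \<open>g n\<close> with
    \<open>u n = m\<close>, so points together with their realizers range exactly over
    \<open>N\<close>.\<close>
  have rl_iff: "pca.rl ?M i (vals N u g) j (\<lambda>m. vals N' u' g' (t m)) \<longleftrightarrow>
      (\<exists>r\<in>S (ar i j). \<forall>n\<in>N. \<exists>n'\<in>N'. u' n' = t (u n) \<and> R i j r (g n) (g' n'))"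
    unfolding pca.rl_def vals_def P_simps app_iff[OF c(2) c'(2)] using c(4)
        by (intro bex_cong refl) blast
  show ?thesis
    unfolding rl_iff
  proof
    assume "lifts \<chi> t \<chi>'"
    from lifts_comp[OF ex_unit[OF c(6,3,4) af(1)] this] have "lifts (atom N i g) (\<lambda>n. t (u n)) \<chi>'" .
    from ex_prime_lifts[OF c(2,3) c'(3) M(2) c(5) c'(4) af(2) c'(6) tu this]
    obtain L e w where L: "small L" "e \<in> L \<rightarrow> N" "e ` L = N" "w \<in> L \<rightarrow> N'"
        "\<forall>x\<in>L. u' (w x) = t (u (e x))"
      and lw: "lifts (atom L i (\<lambda>x. g (e x))) w (atom N' j g')"
      by metis
    have f: "(\<lambda>x. g (e x)) \<in> L \<rightarrow> A i" "(\<lambda>x. g' (w x)) \<in> L \<rightarrow> A j"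
      using L(2,4) c(5) c'(5) by blast+
    obtain r where r: "r \<in> S (ar i j)" "\<forall>x\<in>L. R i j r (g (e x)) (g' (w x))"
      using realizer[OF c(2) c'(2) L(1) f lifts_comp[OF lw a'(3)]] by blast
    have "\<exists>n'\<in>N'. u' n' = t (u n) \<and> R i j r (g n) (g' n')" if "n \<in> N" for n
    proof -
      obtain x where "x \<in> L" "n = e x"
        using \<open>n \<in> N\<close> L(3) by blast
      then show ?thesis
        using r(2) L(4,5) by blast
    qed
    then show "\<exists>r\<in>S (ar i j). \<forall>n\<in>N. \<exists>n'\<in>N'. u' n' = t (u n) \<and> R i j r (g n) (g' n')"
      using r(1) by blast
  next
    assume "\<exists>r\<in>S (ar i j). \<forall>n\<in>N. \<exists>n'\<in>N'. u' n' = t (u n) \<and> R i j r (g n) (g' n')"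
    then obtain r where r: "r \<in> S (ar i j)" "\<forall>n\<in>N. \<exists>n'\<in>N'. u' n' = t (u n) \<and> R i j r (g n) (g' n')"
      by blast
    then obtain w where w: "\<And>n. n \<in> N \<Longrightarrow> w n \<in> N'" "\<And>n. n \<in> N \<Longrightarrow> u' (w n) = t (u n)"
      "\<And>n. n \<in> N \<Longrightarrow> R i j r (g n) (g' (w n))"
      by metis
    \<comment> \<open>Soundness is applied with the constant \<open>r\<close> as the function;
      membership in \<open>S\<close> makes \<open>r\<close> hold at this stage.\<close>
    have "lifts (atom N i g) (\<lambda>n. g' (w n)) (\<pi> j)"
      by (rule R_sound[OF c(2) c'(2) _ _ a(3)]) (use w(3) r(1) a(1,2) in \<open>auto simp: S_def\<close>)
    then have "lifts (atom N i g) w (atom N' j g')"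
      using a'(5)[of w "atom N i g"] a(2) w(1) by simp
    from lifts_comp[OF this ex_unit[OF c'(6,3,4) af(2)]] have
        "lifts (atom N i g) (\<lambda>n. u' (w n)) \<chi>'" .
    then have "lifts (atom N i g) (\<lambda>n. t (u n)) \<chi>'"
      using lifts_cong[of "atom N i g" "\<lambda>n. u' (w n)" "\<lambda>n. t (u n)"] w(2) a(2) by simp
    then show "lifts \<chi> t \<chi>'"
      by (rule ex_elim[OF c(6,3) M(1) c(4) af(1) c'(1) t])
  qed
qed

lemma ex_presents:
  assumes "\<chi> \<in> Pred X"
  shows "\<exists>i N u g. presents \<chi> i N u g"
proof -
  let ?M = "base X \<chi>"
  note M = small_base[OF assms]
  have \<chi>: "\<chi> \<in> fiber X ?M"
    using assms by (simp add: fiber_def)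
  obtain N u \<psi> where N: "small N" and u: "u \<in> N \<rightarrow>\<^sub>E ?M" and \<psi>: "\<psi> \<in> fiber \<G> N" and iso:
      "iso X \<chi> (ex_along X N ?M u \<psi>)"
    using generates M \<chi> unfolding generates_under_ex_def by blast
  have \<psi>G: "\<psi> \<in> Pred \<G>" and \<psi>b: "base X \<psi> = N" and \<psi>X: "\<psi> \<in> fiber X N"
    using \<psi> by (auto simp: fiber_def generated_subfibration_def)
  obtain k g where k: "k \<in> I" and g: "g \<in> N \<rightarrow> A k" and iso': "iso X \<psi> (atom N k g)"
    using \<G>_atom[OF \<psi>G] \<psi>b by blast
  have "is_ex X N ?M u (atom N k g) \<chi>"
    using is_ex_iso[OF is_ex_ex_along[OF models(4) N M u \<psi>X] iso' iso_sym[OF iso]] .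
  then show ?thesis
    unfolding presents_def using assms k N u g by blast
qed

text \<open>Realizer sets come from a chosen presentation of each predicate. A given family over
  \<open>M\<close> is realized by quantifying, over its total space \<open>K\<close>, the atom of
  realizers along the projection to \<open>M\<close>.\<close>

lemma ex_realized: "\<exists>ty ex. realized X P S ty ex"
proof -
  have "\<forall>\<chi>. \<exists>i N u g. \<chi> \<in> Pred X \<longrightarrow> presents \<chi> i N u g"
    using ex_presents by blast
  then obtain ty N u g where p: "\<And>\<chi>. \<chi> \<in> Pred X \<Longrightarrow> presents \<chi> (ty \<chi>) (N \<chi>) (u \<chi>) (g \<chi>)"
    by metis
  define ex where "ex \<chi> = vals (N \<chi>) (u \<chi>) (g \<chi>)" for \<chi>
  have "realized X P S ty ex"
  proof
    show "pca.val (base X \<phi>) (ty \<phi>) (ex \<phi>)" if "\<phi> \<in> Pred X" for \<phi>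
      using p[OF that] val_vals unfolding presents_def ex_def by blast
    show "lifts \<phi> u \<psi> \<longleftrightarrow> pca.rl (base X \<phi>) (ty \<phi>) (ex \<phi>) (ty \<psi>) (\<lambda>m. ex \<psi> (u m))"
      if "\<phi> \<in> Pred X" "\<psi> \<in> Pred X" "u \<in> base X \<phi> \<rightarrow> base X \<psi>" for \<phi> \<psi> u
      unfolding ex_def by (rule lifts_presents_iff[OF p[OF that(1)] p[OF that(2)] that(3)])
  next
    fix M :: "'u set" and i f
    assume M: "small M" and v: "pca.val M i f"
    then have i: "i \<in> I" and fA: "\<And>m a. m \<in> M \<Longrightarrow> a \<in> f m \<Longrightarrow> a \<in> A i"
      unfolding pca.val_def by auto
    define K where "K = {upair m a |m a. m \<in> M \<and> a \<in> f m}"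
    have K: "small K"
      by (rule small_upair[OF M small_A[OF i]]) (use fA in \<open>auto simp: K_def\<close>)
    have gK: "usnd \<in> K \<rightarrow> A i" and uK: "restrict ufst K \<in> K \<rightarrow>\<^sub>E M"
      using fA by (auto simp: K_def)
    have "atom K i usnd \<in> fiber X K"
      using atom[OF i K gK] by (simp add: fiber_def)
    then obtain \<phi> where \<phi>: "is_ex X K M (restrict ufst K) (atom K i usnd) \<phi>"
      using models(4) K M uK unfolding models_ex_def by blast
    then have b: "\<phi> \<in> Pred X" "base X \<phi> = M"
      by (auto simp: is_ex_def fiber_def)
    have pf: "presents \<phi> i K (restrict ufst K) usnd"
      using b i K uK gK \<phi> by (simp add: presents_def)
    have f: "vals K (restrict ufst K) usnd m = f m" if "m \<in> M" for m
      using that by (force simp: vals_def K_def)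
    have "pca.rl M (ty \<phi>) (ex \<phi>) i (vals K (restrict ufst K) usnd)"
      using lifts_presents_iff[OF p[OF b(1)] pf, of "\<lambda>x. x"] lifts_id[OF b(1)] b(2)
          by (simp add: ex_def)
    then have 1: "pca.rl M (ty \<phi>) (ex \<phi>) i f"
      by (rule pca.rl_cong[THEN iffD1, rotated 2]) (simp_all add: f)
    have "pca.rl M i (vals K (restrict ufst K) usnd) (ty \<phi>) (ex \<phi>)"
      using lifts_presents_iff[OF pf p[OF b(1)], of "\<lambda>x. x"] lifts_id[OF b(1)] b(2)
          by (simp add: ex_def)
    then have "pca.rl M i f (ty \<phi>) (ex \<phi>)"
      by (rule pca.rl_cong[THEN iffD1, rotated 2]) (simp_all add: f)
    with 1 show "\<exists>\<phi>\<in>Pred X. base X \<phi> = M \<and> pca.rl M (ty \<phi>) (ex \<phi>) i f \<and> pca.rl M i f (ty \<phi>) (ex \<phi>)"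
      using b by blast
  qed
  then show ?thesis
    by blast
qed

end

section \<open>From a presentation to an equivalence, and the characterisation\<close>

lemma (in presented) ex_fibered_equivalent:
  "\<exists>P S. typed_pca_inclusion P S \<and> fibered_equivalent X (realizability_hyperdoctrine P S)"
proof -
  have "\<forall>i j. \<exists>k pf. i \<in> I \<and> j \<in> I \<longrightarrow> is_prod i j k pf"
    using ex_prod by blast
  then obtain pr pf where prod: "\<And>i j. i \<in> I \<and> j \<in> I \<longrightarrow> is_prod i j (pr i j) (pf i j)"
    by metis
  have "\<forall>i j. \<exists>k R. i \<in> I \<and> j \<in> I \<longrightarrow> is_exp i j k R"
    using ex_exp by blast
  then obtain ar R where exp: "\<And>i j. i \<in> I \<and> j \<in> I \<longrightarrow> is_exp i j (ar i j) (R i j)"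
    by metis
  obtain l0 t0 where t0: "l0 \<in> I" "t0 \<in> A l0" "\<forall>\<chi>\<in>Pred X. lifts \<chi> (\<lambda>_. t0) (\<pi> l0)"
    using ex_terminal by blast
  interpret presented_pca X I A \<pi> pr pf ar R l0 t0
    by standard (use prod exp t0 in blast)+
  have "fibered_equivalent X (realizability_hyperdoctrine P S)"
    using ex_realized realized.fibered_equivalent by blast
  then show ?thesis
    using typed_pca_inclusion by blast
qed

theorem theorem4p11p1:
  fixes X :: "('u, 'x) fibration"
  assumes "set_universe TYPE('u)"
    and "posetal_fibration X"
    and "pre_stack X"
  shows "(\<exists>P S. typed_pca_inclusion P S \<and> fibered_equivalent X (realizability_hyperdoctrine P S))
    \<longleftrightarrow>
     (models_top X \<and> models_meet X \<and> models_imp X \<and> models_ex X \<and> models_all X) \<and>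
     (\<exists>(I :: 'u set) (A :: 'u \<Rightarrow> 'u set) (\<pi> :: 'u \<Rightarrow> 'x).
        small I \<and> (\<forall>i\<in>I. small (A i)) \<and>
        (\<forall>i\<in>I. \<pi> i \<in> fiber X (A i) \<and> ex_prime X (A i) (\<pi> i)) \<and>
        closed_under_finite_meets X (generated_subfibration X I A \<pi>) \<and>
        (\<forall>i\<in>I. modest (generated_subfibration X I A \<pi>) (A i) (\<pi> i)) \<and>
        generates_under_ex X (generated_subfibration X I A \<pi>))" (is "?l \<longleftrightarrow> ?r")
proof
  interpret posetal_fib X
    by standard (use assms in simp_all)
  assume ?l
  then obtain P S where P: "typed_pca_inclusion P S" "fibered_equivalent X (realizability_hyperdoctrine P S)"
    by blast
  obtain ty ex where "realized X P S ty ex"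
    by (rule realized_if_fibered_equivalent[OF P])
  then interpret realized X P S ty ex .
  show ?r
    using models_top models_meet models_imp models_ex models_all small_T small_C gen(4) ex_prime
      closed_under_finite_meets modest generates
    by (intro conjI exI[of _ T] exI[of _ C] exI[of _ gen] ballI)
next
  assume ?r
  note m = this[THEN conjunct1] and r = this[THEN conjunct2]
  from r obtain I :: "'u set" and A \<pi> where r: "small I \<and> (\<forall>i\<in>I. small (A i)) \<and>
    (\<forall>i\<in>I. \<pi> i \<in> fiber X (A i) \<and> ex_prime X (A i) (\<pi> i)) \<and>
    closed_under_finite_meets X (generated_subfibration X I A \<pi>) \<and>
    (\<forall>i\<in>I. modest (generated_subfibration X I A \<pi>) (A i) (\<pi> i)) \<and>
    generates_under_ex X (generated_subfibration X I A \<pi>)"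
    by (elim exE) (rule that)
  interpret presented X I A \<pi>
    by standard (use assms r m in simp_all)
  show ?l
    by (rule ex_fibered_equivalent)
qed

end
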